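(* Let $R$ be a left Noetherian ring, let $G$ be a finitely generated amenable group and let $R\ast G$ be a fixed crossed product of $R$ with $G$. Then, for every finitely generated left $R$-module $K$, every left $R\ast G$-submodule of $(R\ast G)\otimes_R K$ is Hopfian (as a left $R\ast G$-module). In particular, the ring $\mathrm{End}_{R\ast G}(M)$ is stably finite for every left $R\ast G$-submodule $M\leq (R\ast G)\otimes_R K$.
   Context: Rings are associative and unital; modules are unital. Crossed product: given a ring $R$ and a group $G$, take maps $\sigma\colon G\to \mathrm{Aut}_{\mathrm{ring}}(R)$ and $\rho\colon G\times G\to U(R)$ (units of $R$), writing $r^{\sigma(g)}$ for the image of $r$ under $\sigma(g)$ and $r^{\sigma(g)\sigma(h)}=(r^{\sigma(g)})^{\sigma(h)}$, such that for all $r\in R$, $g,g_1,g_2,g_3\in G$: (i) $\rho(g_1,g_2)\rho(g_1g_2,g_3)=\rho(g_2,g_3)^{\sigma(g_1)}\rho(g_1,g_2g_3)$; (ii) $r^{\sigma(g_2)\sigma(g_1)}=\rho(g_1,g_2)\,r^{\sigma(g_1g_2)}\rho(g_1,g_2)^{-1}$; (iii) $\rho(g,e)=\rho(e,g)=1$ and $\sigma(e)=\mathrm{id}$. The crossed product $R\ast G$ (determined by $\sigma,\rho$) is the set of finite formal sums $\sum_{g\in G} r_g\underline g$ with componentwise addition and multiplication given bilinearly by $(r\underline g)(s\underline h)=r s^{\sigma(g)}\rho(g,h)\,\underline{gh}$; it is a unital ring containing $R$ as a subring via $r\mapsto r\underline e$. Amenable: for subsets $A,C\subseteq G$ put $\partial_C(A)=\{x\in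 G: xC\cap A\neq\emptyset\}\setminus\{x\in G: xC\subseteq A\}$. A group $G$ is amenable if there is a net $\{F_i\}_{i\in I}$ of nonempty finite subsets of $G$ with $\lim_I |\partial_C(F_i)|/|F_i|=0$ for every finite $C\subseteq G$. A module is Hopfian if every surjective endomorphism of it is an automorphism. A ring $S$ is directly finite if $xy=1$ implies $yx=1$ for all $x,y\in S$; it is stably finite if the matrix ring $\mathrm{Mat}_k(S)$ is directly finite for every integer $k\geq 1$. *)

theory Defs
  imports Complex_Main "HOL-Algebra.Algebra" "HOL-Algebra.Free_Abelian_Groups"
begin

section \<open>Left modules over arbitrary rings\<close>

text \<open>
  The locale \<^locale>\<open>module\<close> of \<open>HOL-Algebra\<close> requires a commutative ring of scalars. The following
  is the same locale over an arbitrary ring. As there, the fields \<open>mult\<close> and \<open>one\<close> of the module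
  record play no role. The locale \<^locale>\<open>submodule\<close> does not assume commutativity and is used as
  it is: \<open>submodule N R M\<close> says that \<open>N\<close> is an additive subgroup of \<open>M\<close> closed under left
  multiplication by \<open>R\<close>, and the module it carries is \<open>M\<lparr>carrier := N\<rparr>\<close>.
\<close>

locale left_module = R: ring R + M: abelian_group M
  for R :: "('r, 'a) ring_scheme" (structure) and M :: "('r, 'm, 'b) module_scheme" (structure) +
  assumes smult_closed [simp, intro]:
      "\<lbrakk>a \<in> carrier R; x \<in> carrier M\<rbrakk> \<Longrightarrow> a \<odot>\<^bsub>M\<^esub> x \<in> carrier M"
    and smult_l_distr:
      "\<lbrakk>a \<in> carrier R; b \<in> carrier R; x \<in> carrier M\<rbrakk> \<Longrightarrow>
        (a \<oplus> b) \<odot>\<^bsub>M\<^esub> x = a \<odot>\<^bsub>M\<^esub> x \<oplus>\<^bsub>M\<^esub> b \<odot>\<^bsub>M\<^esub> x"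
    and smult_r_distr:
      "\<lbrakk>a \<in> carrier R; x \<in> carrier M; y \<in> carrier M\<rbrakk> \<Longrightarrow>
        a \<odot>\<^bsub>M\<^esub> (x \<oplus>\<^bsub>M\<^esub> y) = a \<odot>\<^bsub>M\<^esub> x \<oplus>\<^bsub>M\<^esub> a \<odot>\<^bsub>M\<^esub> y"
    and smult_assoc1:
      "\<lbrakk>a \<in> carrier R; b \<in> carrier R; x \<in> carrier M\<rbrakk> \<Longrightarrow>
        (a \<otimes> b) \<odot>\<^bsub>M\<^esub> x = a \<odot>\<^bsub>M\<^esub> (b \<odot>\<^bsub>M\<^esub> x)"
    and smult_one [simp]:
      "x \<in> carrier M \<Longrightarrow> \<one> \<odot>\<^bsub>M\<^esub> x = x"

definition submodule_span ::
    "('r, 'a) ring_scheme \<Rightarrow> ('r, 'm, 'b) module_scheme \<Rightarrow> 'm set \<Rightarrow> 'm set" where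
  "submodule_span R M A = \<Inter> {N. submodule N R M \<and> A \<subseteq> N}"

definition fin_gen_module :: "('r, 'a) ring_scheme \<Rightarrow> ('r, 'm, 'b) module_scheme \<Rightarrow> bool" where
  "fin_gen_module R M \<longleftrightarrow>
     left_module R M \<and> (\<exists>A. finite A \<and> A \<subseteq> carrier M \<and> submodule_span R M A = carrier M)"

text \<open>The ring as a left module over itself; its submodules are the left ideals.\<close>

definition regular_module :: "('r, 'a) ring_scheme \<Rightarrow> ('r, 'r) module" where
  "regular_module R =
     \<lparr>carrier = carrier R, monoid.mult = monoid.mult R, one = \<one>\<^bsub>R\<^esub>,
      ring.zero = \<zero>\<^bsub>R\<^esub>, ring.add = ring.add R, smult = monoid.mult R\<rparr>"

definition left_noetherian :: "('r, 'a) ring_scheme \<Rightarrow> bool" where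
  "left_noetherian R \<longleftrightarrow> ring R \<and>
     (\<forall>I. submodule I R (regular_module R) \<longrightarrow>
        (\<exists>A. finite A \<and> A \<subseteq> carrier R \<and> I = submodule_span R (regular_module R) A))"


section \<open>Endomorphisms, Hopfian modules, stable finiteness\<close>

text \<open>Endomorphisms are extensional functions, so that equal endomorphisms are equal in HOL.\<close>

definition module_End :: "('r, 'a) ring_scheme \<Rightarrow> ('r, 'm, 'b) module_scheme \<Rightarrow> ('m \<Rightarrow> 'm) set" where
  "module_End R M = {f \<in> carrier M \<rightarrow>\<^sub>E carrier M.
     (\<forall>x\<in>carrier M. \<forall>y\<in>carrier M. f (x \<oplus>\<^bsub>M\<^esub> y) = f x \<oplus>\<^bsub>M\<^esub> f y) \<and>
     (\<forall>r\<in>carrier R. \<forall>x\<in>carrier M. f (r \<odot>\<^bsub>M\<^esub> x) = r \<odot>\<^bsub>M\<^esub> f x)}"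

definition End_ring ::
    "('r, 'a) ring_scheme \<Rightarrow> ('r, 'm, 'b) module_scheme \<Rightarrow> ('m \<Rightarrow> 'm) ring" where
  "End_ring R M =
     \<lparr>carrier = module_End R M,
      monoid.mult = (\<lambda>f g. compose (carrier M) f g),
      one = (\<lambda>x\<in>carrier M. x),
      ring.zero = (\<lambda>x\<in>carrier M. \<zero>\<^bsub>M\<^esub>),
      ring.add = (\<lambda>f g. \<lambda>x\<in>carrier M. f x \<oplus>\<^bsub>M\<^esub> g x)\<rparr>"

definition hopfian :: "('r, 'a) ring_scheme \<Rightarrow> ('r, 'm, 'b) module_scheme \<Rightarrow> bool" where
  "hopfian R M \<longleftrightarrow>
     (\<forall>f\<in>module_End R M. f ` carrier M = carrier M \<longrightarrow> bij_betw f (carrier M) (carrier M))"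

definition mat_ring :: "nat \<Rightarrow> ('s, 'a) ring_scheme \<Rightarrow> (nat \<times> nat \<Rightarrow> 's) ring" where
  "mat_ring k S =
     \<lparr>carrier = {..<k} \<times> {..<k} \<rightarrow>\<^sub>E carrier S,
      monoid.mult = (\<lambda>A B. \<lambda>(i, j)\<in>{..<k} \<times> {..<k}. \<Oplus>\<^bsub>S\<^esub>l\<in>{..<k}. A (i, l) \<otimes>\<^bsub>S\<^esub> B (l, j)),
      one = (\<lambda>(i, j)\<in>{..<k} \<times> {..<k}. if i = j then \<one>\<^bsub>S\<^esub> else \<zero>\<^bsub>S\<^esub>),
      ring.zero = (\<lambda>p\<in>{..<k} \<times> {..<k}. \<zero>\<^bsub>S\<^esub>),
      ring.add = (\<lambda>A B. \<lambda>p\<in>{..<k} \<times> {..<k}. A p \<oplus>\<^bsub>S\<^esub> B p)\<rparr>"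

definition directly_finite :: "('s, 'a) ring_scheme \<Rightarrow> bool" where
  "directly_finite S \<longleftrightarrow>
     (\<forall>x\<in>carrier S. \<forall>y\<in>carrier S. x \<otimes>\<^bsub>S\<^esub> y = \<one>\<^bsub>S\<^esub> \<longrightarrow> y \<otimes>\<^bsub>S\<^esub> x = \<one>\<^bsub>S\<^esub>)"

definition stably_finite :: "('s, 'a) ring_scheme \<Rightarrow> bool" where
  "stably_finite S \<longleftrightarrow> (\<forall>k\<ge>1. directly_finite (mat_ring k S))"


section \<open>Crossed products\<close>

text \<open>Here \<open>\<sigma> g r\<close> is \<open>r\<close> to the power \<open>\<sigma>(g)\<close>; exponents compose from left to right.\<close>

locale crossed_system = R: ring R + G: group G
  for R :: "('r, 'a) ring_scheme" (structure) and G :: "('g, 'b) monoid_scheme" (structure) +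
  fixes \<sigma> :: "'g \<Rightarrow> 'r \<Rightarrow> 'r" and \<rho> :: "'g \<Rightarrow> 'g \<Rightarrow> 'r"
  assumes aut: "g \<in> carrier G \<Longrightarrow> \<sigma> g \<in> ring_iso R R"
    and unit: "\<lbrakk>g \<in> carrier G; h \<in> carrier G\<rbrakk> \<Longrightarrow> \<rho> g h \<in> Units R"
    and cocycle: "\<lbrakk>g1 \<in> carrier G; g2 \<in> carrier G; g3 \<in> carrier G\<rbrakk> \<Longrightarrow>
        \<rho> g1 g2 \<otimes> \<rho> (g1 \<otimes>\<^bsub>G\<^esub> g2) g3 = \<sigma> g1 (\<rho> g2 g3) \<otimes> \<rho> g1 (g2 \<otimes>\<^bsub>G\<^esub> g3)"
    and twisted: "\<lbrakk>r \<in> carrier R; g1 \<in> carrier G; g2 \<in> carrier G\<rbrakk> \<Longrightarrow>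
        \<sigma> g1 (\<sigma> g2 r) = \<rho> g1 g2 \<otimes> \<sigma> (g1 \<otimes>\<^bsub>G\<^esub> g2) r \<otimes> inv (\<rho> g1 g2)"
    and rho_one: "g \<in> carrier G \<Longrightarrow> \<rho> g \<one>\<^bsub>G\<^esub> = \<one>" "g \<in> carrier G \<Longrightarrow> \<rho> \<one>\<^bsub>G\<^esub> g = \<one>"
    and sigma_one: "r \<in> carrier R \<Longrightarrow> \<sigma> \<one>\<^bsub>G\<^esub> r = r"

text \<open>
  A formal sum is represented by its finitely supported coefficient function, which is zero outside
  \<open>carrier G\<close>. The coefficient of a product at \<open>x\<close> collects all products of terms at \<open>g\<close> and \<open>h\<close>
  with \<open>gh = x\<close>.
\<close>

definition supp :: "('r, 'a) ring_scheme \<Rightarrow> ('g \<Rightarrow> 'r) \<Rightarrow> 'g set" where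
  "supp R f = {g. f g \<noteq> \<zero>\<^bsub>R\<^esub>}"

definition crossed_product ::
    "('r, 'a) ring_scheme \<Rightarrow> ('g, 'b) monoid_scheme \<Rightarrow> ('g \<Rightarrow> 'r \<Rightarrow> 'r) \<Rightarrow> ('g \<Rightarrow> 'g \<Rightarrow> 'r) \<Rightarrow>
      ('g \<Rightarrow> 'r) ring" where
  "crossed_product R G \<sigma> \<rho> =
     \<lparr>carrier = {f. range f \<subseteq> carrier R \<and> finite (supp R f) \<and> supp R f \<subseteq> carrier G},
      monoid.mult = (\<lambda>f f'. \<lambda>x. finsum R
         (\<lambda>(g, h). f g \<otimes>\<^bsub>R\<^esub> \<sigma> g (f' h) \<otimes>\<^bsub>R\<^esub> \<rho> g h)
         {(g, h) \<in> supp R f \<times> supp R f'. g \<otimes>\<^bsub>G\<^esub> h = x}),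
      one = (\<lambda>x. if x = \<one>\<^bsub>G\<^esub> then \<one>\<^bsub>R\<^esub> else \<zero>\<^bsub>R\<^esub>),
      ring.zero = (\<lambda>x. \<zero>\<^bsub>R\<^esub>),
      ring.add = (\<lambda>f f'. \<lambda>x. f x \<oplus>\<^bsub>R\<^esub> f' x)\<rparr>"

definition coeff_embed ::
    "('r, 'a) ring_scheme \<Rightarrow> ('g, 'b) monoid_scheme \<Rightarrow> 'r \<Rightarrow> 'g \<Rightarrow> 'r" where
  "coeff_embed R G r = (\<lambda>x. if x = \<one>\<^bsub>G\<^esub> then r else \<zero>\<^bsub>R\<^esub>)"


section \<open>The tensor product \<open>A \<otimes>\<^sub>R K\<close>\<close>

text \<open>
  Let \<open>\<phi> : R \<rightarrow> A\<close> be a ring homomorphism, making \<open>A\<close> an \<open>(A, R)\<close>-bimodule, and let \<open>K\<close> be a left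
  \<open>R\<close>-module. The tensor product is the free abelian group on \<open>A \<times> K\<close> modulo the subgroup generated
  by the usual relators; \<open>A\<close> acts by \<open>a \<cdot> (b \<otimes> x) = ab \<otimes> x\<close>.
\<close>

definition tensor_free ::
    "('s, 'a) ring_scheme \<Rightarrow> ('r, 'k, 'b) module_scheme \<Rightarrow> ('s \<times> 'k \<Rightarrow>\<^sub>0 int) monoid" where
  "tensor_free A K = free_Abelian_group (carrier A \<times> carrier K)"

definition tensor_relators ::
    "('r, 'c) ring_scheme \<Rightarrow> ('s, 'a) ring_scheme \<Rightarrow> ('r \<Rightarrow> 's) \<Rightarrow> ('r, 'k, 'b) module_scheme \<Rightarrow>
      ('s \<times> 'k \<Rightarrow>\<^sub>0 int) set" where
  "tensor_relators R A \<phi> K =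
     {frag_of (a \<oplus>\<^bsub>A\<^esub> b, x) - frag_of (a, x) - frag_of (b, x) | a b x.
        a \<in> carrier A \<and> b \<in> carrier A \<and> x \<in> carrier K} \<union>
     {frag_of (a, x \<oplus>\<^bsub>K\<^esub> y) - frag_of (a, x) - frag_of (a, y) | a x y.
        a \<in> carrier A \<and> x \<in> carrier K \<and> y \<in> carrier K} \<union>
     {frag_of (a \<otimes>\<^bsub>A\<^esub> \<phi> r, x) - frag_of (a, r \<odot>\<^bsub>K\<^esub> x) | a r x.
        a \<in> carrier A \<and> r \<in> carrier R \<and> x \<in> carrier K}"

definition tensor_kernel ::
    "('r, 'c) ring_scheme \<Rightarrow> ('s, 'a) ring_scheme \<Rightarrow> ('r \<Rightarrow> 's) \<Rightarrow> ('r, 'k, 'b) module_scheme \<Rightarrow>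
      ('s \<times> 'k \<Rightarrow>\<^sub>0 int) set" where
  "tensor_kernel R A \<phi> K = generate (tensor_free A K) (tensor_relators R A \<phi> K)"

text \<open>
  In \<open>smult\<close>, \<open>C\<close> is a coset of the kernel; multiplication by \<open>a\<close> on the free group preserves
  the kernel, so the union is that of a single coset.
\<close>

definition tensor_module ::
    "('r, 'c) ring_scheme \<Rightarrow> ('s, 'a) ring_scheme \<Rightarrow> ('r \<Rightarrow> 's) \<Rightarrow> ('r, 'k, 'b) module_scheme \<Rightarrow>
      ('s, ('s \<times> 'k \<Rightarrow>\<^sub>0 int) set) module" where
  "tensor_module R A \<phi> K =
     (let F = tensor_free A K; H = tensor_kernel R A \<phi> K; Q = F Mod H in
     \<lparr>carrier = carrier Q, monoid.mult = undefined, one = undefined,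
      ring.zero = \<one>\<^bsub>Q\<^esub>, ring.add = monoid.mult Q,
      smult = (\<lambda>a C. \<Union>c\<in>C. H #>\<^bsub>F\<^esub> frag_extend (\<lambda>(b, x). frag_of (a \<otimes>\<^bsub>A\<^esub> b, x)) c)\<rparr>)"

definition induced_module ::
    "('r, 'a) ring_scheme \<Rightarrow> ('g, 'b) monoid_scheme \<Rightarrow> ('g \<Rightarrow> 'r \<Rightarrow> 'r) \<Rightarrow> ('g \<Rightarrow> 'g \<Rightarrow> 'r) \<Rightarrow>
      ('r, 'k, 'c) module_scheme \<Rightarrow> ('g \<Rightarrow> 'r, (('g \<Rightarrow> 'r) \<times> 'k \<Rightarrow>\<^sub>0 int) set) module" where
  "induced_module R G \<sigma> \<rho> K = tensor_module R (crossed_product R G \<sigma> \<rho>) (coeff_embed R G) K"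


section \<open>Finitely generated amenable groups\<close>

definition fin_gen_group :: "('g, 'a) monoid_scheme \<Rightarrow> bool" where
  "fin_gen_group G \<longleftrightarrow>
     group G \<and> (\<exists>S. finite S \<and> S \<subseteq> carrier G \<and> generate G S = carrier G)"

definition boundary :: "('g, 'a) monoid_scheme \<Rightarrow> 'g set \<Rightarrow> 'g set \<Rightarrow> 'g set" where
  "boundary G C A =
     {x \<in> carrier G. (x <#\<^bsub>G\<^esub> C) \<inter> A \<noteq> {}} - {x \<in> carrier G. x <#\<^bsub>G\<^esub> C \<subseteq> A}"

definition directed_set :: "'i set \<Rightarrow> ('i \<Rightarrow> 'i \<Rightarrow> bool) \<Rightarrow> bool" where
  "directed_set I leq \<longleftrightarrow> I \<noteq> {} \<and>
     (\<forall>i\<in>I. leq i i) \<and>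
     (\<forall>i\<in>I. \<forall>j\<in>I. \<forall>k\<in>I. leq i j \<longrightarrow> leq j k \<longrightarrow> leq i k) \<and>
     (\<forall>i\<in>I. \<forall>j\<in>I. \<exists>k\<in>I. leq i k \<and> leq j k)"

text \<open>The filter of tails of a directed set, so that net limits are limits along a filter.\<close>

definition tails :: "'i set \<Rightarrow> ('i \<Rightarrow> 'i \<Rightarrow> bool) \<Rightarrow> 'i filter" where
  "tails I leq = (INF i\<in>I. principal {j \<in> I. leq i j})"

text \<open>
  HOL cannot quantify existentially over the type of indices of a net, so this type is a parameter.
  With a type variable for it in an assumption of a theorem, nets over all directed sets are covered.
\<close>

definition amenable :: "'i itself \<Rightarrow> ('g, 'a) monoid_scheme \<Rightarrow> bool" where
  "amenable (_ :: 'i itself) G \<longleftrightarrow> group G \<and>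
     (\<exists>(I :: 'i set) leq F. directed_set I leq \<and>
        (\<forall>i\<in>I. finite (F i) \<and> F i \<noteq> {} \<and> F i \<subseteq> carrier G) \<and>
        (\<forall>C. finite C \<and> C \<subseteq> carrier G \<longrightarrow>
           ((\<lambda>i. real (card (boundary G C (F i))) / real (card (F i))) \<longlongrightarrow> 0) (tails I leq)))"

end

theory Submission
  imports Defs
begin

text \<open>
  Let \<open>V = (R * G) \<otimes> K\<close>. As an \<open>R\<close>-module it is a direct sum of copies of \<open>K\<close>, twisted by the
  automorphisms \<open>\<sigma>(g)\<close>, and the group elements permute the summands semilinearly. This structure is
  all that the main argument uses; it is axiomatised as \<open>twisted_graded_module\<close>.

  If \<open>K\<close> has finite length, one can average over Folner sets the length of the sum of the translates of a
  finitely generated submodule. This invariant is additive, bounded on \<open>V\<close> and positive on nonzero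
  submodules, so a surjective endomorphism has no kernel. A Noetherian \<open>K\<close> has finite length only
  relative to torsion theories and only in layers, so the argument climbs along a filtration by torsion
  theories, as in the definition of the Gabriel dimension. A torsion theory is given by a Gabriel filter
  \<open>F\<close> of left ideals, here always invariant under every \<open>\<sigma>(g)\<close>, and the \<open>F\<close>-length of a module is the
  largest number of non-torsion factors in a chain of submodules. The next filter \<open>F'\<close> consists of the
  left ideals \<open>I\<close> for which \<open>R/I\<close> has finite \<open>F\<close>-length.

  The core is \<open>kernel_torsion\<close>. Let \<open>W \<le> V\<close> be stable under \<open>R\<close> and \<open>G\<close> and consist of \<open>F'\<close>-torsion
  elements, let \<open>\<phi>\<close> be an equivariant surjection of \<open>W\<close> onto itself, and suppose that its kernel
  contains an element \<open>x\<close> that is not \<open>F\<close>-torsion. Choose \<open>x\<^sub>0 = x\<close> and \<open>\<phi>(x\<^sub>k\<^sub>+\<^sub>1) = x\<^sub>k\<close>, let \<open>C\<close> be the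
  support of \<open>x\<close> and \<open>D\<close> that of \<open>x\<^sub>0, \<dots>, x\<^sub>n\<^sub>-\<^sub>1\<close>. For a finite set \<open>Q\<close> with \<open>|QD| \<le> 2|Q|\<close>, pick
  at least \<open>|Q| / |C|\<^sup>2\<close> elements \<open>g\<close> of \<open>Q\<close> with disjoint translates \<open>gC\<close>. The elements \<open>g x\<^sub>k\<close> then produce a
  chain with at least \<open>n |Q| / |C|\<^sup>2\<close> non-torsion factors among the elements of \<open>W\<close> supported on \<open>QD\<close>. But
  these elements lie in a sum of \<open>|QD| \<le> 2|Q|\<close> twisted copies of the finitely generated \<open>F'\<close>-torsion
  submodule of \<open>K\<close>, whose \<open>F\<close>-length \<open>l\<close> is finite. For \<open>n > 2 l |C|\<^sup>2\<close> this is absurd.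

  Hence the kernel of \<open>\<phi>\<close> is \<open>F\<close>-torsion, and \<open>\<phi>\<close> restricts to a surjection of the \<open>F\<close>-torsion part of
  \<open>W\<close> with the same kernel: if surjections are injective on \<open>F\<close>-torsion submodules, they are so on
  \<open>F'\<close>-torsion submodules (\<open>hopfian_finite_length_filter\<close>). This property passes to unions of chains of
  filters, because the torsion part of \<open>V\<close> is generated by the translates of a finite set. Zorn's lemma
  therefore gives a maximal filter \<open>F\<close> with the property, and \<open>F' = F\<close>. As \<open>R\<close> is Noetherian, a left ideal
  maximal outside \<open>F\<close> would have colength one and lie in \<open>F'\<close>; so \<open>F\<close> contains every left ideal, every
  submodule is \<open>F\<close>-torsion, and every equivariant surjection is injective.

  To see that \<open>V\<close> has the required structure, note that the scalars, the group elements and the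
  coordinate maps are all induced by right \<open>R\<close>-linear maps of the crossed product into itself, so that
  identities between them can be checked on pure tensors, that is, in \<open>R * G\<close>. The powers \<open>V\<^sup>k\<close> have the
  same structure. A \<open>k\<close>-by-\<open>k\<close> matrix over \<open>End(M)\<close> acts on \<open>M\<^sup>k\<close>; if it has a right inverse, the action
  is surjective, hence injective, and the inverse is two-sided. This is stable finiteness.
\<close>

section \<open>Submodules of left modules\<close>

lemma left_module_regular:
  assumes "ring R"
  shows "left_module R (regular_module R)"
proof -
  interpret R: ring R by fact
  have "abelian_group (regular_module R)"
    by (rule abelian_groupI)
      (auto simp: regular_module_def R.add.m_ac intro!: bexI[of _ "\<ominus>\<^bsub>R\<^esub> _"] R.l_neg)
  then show ?thesis
    unfolding left_module_def left_module_axioms_def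
    using assms by (auto simp: regular_module_def R.l_distr R.r_distr R.m_assoc)
qed

context left_module
begin

lemma smult_l_null [simp]:
  assumes "x \<in> carrier M"
  shows "\<zero> \<odot>\<^bsub>M\<^esub> x = \<zero>\<^bsub>M\<^esub>"
proof -
  have "\<zero> \<odot>\<^bsub>M\<^esub> x \<oplus>\<^bsub>M\<^esub> \<zero> \<odot>\<^bsub>M\<^esub> x = \<zero> \<odot>\<^bsub>M\<^esub> x"
    using smult_l_distr[of \<zero> \<zero> x] assms by simp
  then show ?thesis
    using assms by (metis M.add.r_cancel_one' R.zero_closed smult_closed)
qed

lemma smult_r_null [simp]:
  assumes "a \<in> carrier R"
  shows "a \<odot>\<^bsub>M\<^esub> \<zero>\<^bsub>M\<^esub> = \<zero>\<^bsub>M\<^esub>"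
proof -
  have "a \<odot>\<^bsub>M\<^esub> \<zero>\<^bsub>M\<^esub> \<oplus>\<^bsub>M\<^esub> a \<odot>\<^bsub>M\<^esub> \<zero>\<^bsub>M\<^esub> = a \<odot>\<^bsub>M\<^esub> \<zero>\<^bsub>M\<^esub>"
    using smult_r_distr[of a "\<zero>\<^bsub>M\<^esub>" "\<zero>\<^bsub>M\<^esub>"] assms by simp
  then show ?thesis
    using assms by (metis M.add.r_cancel_one' M.zero_closed smult_closed)
qed

lemma smult_minus_one:
  assumes "x \<in> carrier M"
  shows "(\<ominus> \<one>) \<odot>\<^bsub>M\<^esub> x = \<ominus>\<^bsub>M\<^esub> x"
proof -
  have "(\<ominus> \<one>) \<odot>\<^bsub>M\<^esub> x \<oplus>\<^bsub>M\<^esub> x = (\<ominus> \<one> \<oplus> \<one>) \<odot>\<^bsub>M\<^esub> x"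
    using assms by (subst smult_l_distr) auto
  also have "\<dots> = \<zero>\<^bsub>M\<^esub>"
    using assms by (simp add: R.l_neg)
  finally show ?thesis
    using assms by (intro M.minus_equality[symmetric]) auto
qed

text \<open>Closure under negation comes for free, as negation is multiplication by \<open>-1\<close>.\<close>

lemma submodule_iff:
  "submodule N R M \<longleftrightarrow> N \<subseteq> carrier M \<and> \<zero>\<^bsub>M\<^esub> \<in> N \<and>
     (\<forall>x\<in>N. \<forall>y\<in>N. x \<oplus>\<^bsub>M\<^esub> y \<in> N) \<and> (\<forall>a\<in>carrier R. \<forall>x\<in>N. a \<odot>\<^bsub>M\<^esub> x \<in> N)"
  (is "?L \<longleftrightarrow> ?R")
proof
  assume ?L
  then interpret N: submodule N R M .
  show ?R
    using N.subset N.m_closed N.one_closed by auto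
next
  assume r: ?R
  then have "(\<ominus> \<one>) \<odot>\<^bsub>M\<^esub> x \<in> N \<and> x \<in> carrier M" if "x \<in> N" for x
    using that R.a_inv_closed[OF R.one_closed] by blast
  with smult_minus_one have "\<ominus>\<^bsub>M\<^esub> x \<in> N" if "x \<in> N" for x
    using that by metis
  moreover have "m_inv (add_monoid M) x = \<ominus>\<^bsub>M\<^esub> x" for x
    by (simp add: a_inv_def)
  ultimately show ?L
    using r unfolding submodule_def submodule_axioms_def subgroup_def by simp
qed

lemma submoduleI:
  assumes "N \<subseteq> carrier M" "\<zero>\<^bsub>M\<^esub> \<in> N" "\<And>x y. x \<in> N \<Longrightarrow> y \<in> N \<Longrightarrow> x \<oplus>\<^bsub>M\<^esub> y \<in> N"
    and "\<And>a x. a \<in> carrier R \<Longrightarrow> x \<in> N \<Longrightarrow> a \<odot>\<^bsub>M\<^esub> x \<in> N"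
  shows "submodule N R M"
  unfolding submodule_iff using assms by blast

lemma submoduleD:
  assumes "submodule N R M"
  shows "x \<in> N \<Longrightarrow> x \<in> carrier M" "\<zero>\<^bsub>M\<^esub> \<in> N" "x \<in> N \<Longrightarrow> y \<in> N \<Longrightarrow> x \<oplus>\<^bsub>M\<^esub> y \<in> N"
    "a \<in> carrier R \<Longrightarrow> x \<in> N \<Longrightarrow> a \<odot>\<^bsub>M\<^esub> x \<in> N" "x \<in> N \<Longrightarrow> \<ominus>\<^bsub>M\<^esub> x \<in> N"
proof -
  have s: "N \<subseteq> carrier M" "\<zero>\<^bsub>M\<^esub> \<in> N" "\<forall>x\<in>N. \<forall>y\<in>N. x \<oplus>\<^bsub>M\<^esub> y \<in> N"
      "\<forall>a\<in>carrier R. \<forall>x\<in>N. a \<odot>\<^bsub>M\<^esub> x \<in> N"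
    using assms unfolding submodule_iff by simp_all
  show "x \<in> N \<Longrightarrow> x \<in> carrier M" "\<zero>\<^bsub>M\<^esub> \<in> N" "x \<in> N \<Longrightarrow> y \<in> N \<Longrightarrow> x \<oplus>\<^bsub>M\<^esub> y \<in> N"
    "a \<in> carrier R \<Longrightarrow> x \<in> N \<Longrightarrow> a \<odot>\<^bsub>M\<^esub> x \<in> N"
    using s by blast+
  show "\<ominus>\<^bsub>M\<^esub> x \<in> N" if "x \<in> N"
  proof -
    have "(\<ominus> \<one>) \<odot>\<^bsub>M\<^esub> x \<in> N" "x \<in> carrier M"
      using s that R.a_inv_closed[OF R.one_closed] by blast+
    then show ?thesis
      by (simp add: smult_minus_one)
  qed
qed

lemma submodule_carrier: "submodule (carrier M) R M"
  by (rule submoduleI) auto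

lemma submodule_zero: "submodule {\<zero>\<^bsub>M\<^esub>} R M"
  by (rule submoduleI) auto

lemma submodule_inter:
  assumes "submodule N R M" "submodule P R M"
  shows "submodule (N \<inter> P) R M"
  using assms unfolding submodule_iff by blast

text \<open>
  The twist \<open>s\<close> of the scalars makes room for maps that are only semilinear, such as the action of a
  group element or an automorphism of \<open>R\<close> itself.
\<close>

lemma submodule_vimage:
  assumes D: "submodule D R M" and M': "left_module R M'" and N: "submodule N R M'"
    and closed: "\<And>x. x \<in> D \<Longrightarrow> f x \<in> carrier M'"
    and add: "\<And>x y. x \<in> D \<Longrightarrow> y \<in> D \<Longrightarrow> f (x \<oplus>\<^bsub>M\<^esub> y) = f x \<oplus>\<^bsub>M'\<^esub> f y"
    and smult: "\<And>r x. r \<in> carrier R \<Longrightarrow> x \<in> D \<Longrightarrow> f (r \<odot>\<^bsub>M\<^esub> x) = s r \<odot>\<^bsub>M'\<^esub> f x"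
    and s: "\<And>r. r \<in> carrier R \<Longrightarrow> s r \<in> carrier R"
  shows "submodule {x \<in> D. f x \<in> N} R M" (is "submodule ?P R M")
proof (rule submoduleI)
  interpret M': left_module R M' by (rule M')
  note D = submoduleD[OF D] and N = M'.submoduleD[OF N]
  show "?P \<subseteq> carrier M"
    using D(1) by blast
  have "f \<zero>\<^bsub>M\<^esub> \<oplus>\<^bsub>M'\<^esub> f \<zero>\<^bsub>M\<^esub> = f \<zero>\<^bsub>M\<^esub>"
    using add[OF D(2) D(2)] by simp
  then have "f \<zero>\<^bsub>M\<^esub> = \<zero>\<^bsub>M'\<^esub>"
    using closed[OF D(2)] by (metis M'.M.add.r_cancel_one')
  then show "\<zero>\<^bsub>M\<^esub> \<in> ?P"
    using D(2) N(2) by simp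
  show "x \<oplus>\<^bsub>M\<^esub> y \<in> ?P" if "x \<in> ?P" "y \<in> ?P" for x y
    using that D(3) N(3) by (simp add: add)
  show "r \<odot>\<^bsub>M\<^esub> x \<in> ?P" if "r \<in> carrier R" "x \<in> ?P" for r x
    using that D(4) N(4) s by (simp add: smult)
qed

lemma submodule_finsum:
  assumes "submodule N R M" "\<And>i. i \<in> I \<Longrightarrow> f i \<in> N"
  shows "finsum M f I \<in> N"
  using assms(2)
proof (induction I rule: infinite_finite_induct)
  case (infinite I)
  then show ?case
    using submoduleD(2)[OF assms(1)] M.finsum_infinite[of I f] by metis
next
  case empty
  show ?case
    using submoduleD(2)[OF assms(1)] M.finsum_empty by metis
next
  case (insert i I)
  have f: "f j \<in> N" if "j \<in> insert i I" for j
    using insert.prems that .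
  have "finsum M f (insert i I) = f i \<oplus>\<^bsub>M\<^esub> finsum M f I"
    by (rule M.finsum_insert[OF insert.hyps]) (use f submoduleD(1)[OF assms(1)] in blast)+
  moreover have "finsum M f I \<in> N"
    by (rule insert.IH) (use f in blast)
  ultimately show ?case
    using submoduleD(3)[OF assms(1) f[of i]] by simp
qed

lemma submodule_span_submodule:
  assumes "A \<subseteq> carrier M"
  shows "submodule (submodule_span R M A) R M"
  unfolding submodule_span_def
proof (rule submoduleI)
  show "\<Inter>{N. submodule N R M \<and> A \<subseteq> N} \<subseteq> carrier M"
    using assms submodule_carrier by blast
  show "\<zero>\<^bsub>M\<^esub> \<in> \<Inter>{N. submodule N R M \<and> A \<subseteq> N}"
    using submoduleD(2) by blast
  show "x \<oplus>\<^bsub>M\<^esub> y \<in> \<Inter>{N. submodule N R M \<and> A \<subseteq> N}"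
    if "x \<in> \<Inter>{N. submodule N R M \<and> A \<subseteq> N}" "y \<in> \<Inter>{N. submodule N R M \<and> A \<subseteq> N}" for x y
    using that submoduleD(3) by blast
  show "a \<odot>\<^bsub>M\<^esub> x \<in> \<Inter>{N. submodule N R M \<and> A \<subseteq> N}"
    if "a \<in> carrier R" "x \<in> \<Inter>{N. submodule N R M \<and> A \<subseteq> N}" for a x
    using that submoduleD(4) by blast
qed

lemma submodule_span_superset: "A \<subseteq> submodule_span R M A"
  unfolding submodule_span_def by blast

lemma submodule_span_minimal: "submodule N R M \<Longrightarrow> A \<subseteq> N \<Longrightarrow> submodule_span R M A \<subseteq> N"
  unfolding submodule_span_def by blast

lemma submodule_span_mono: "A \<subseteq> B \<Longrightarrow> submodule_span R M A \<subseteq> submodule_span R M B"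
  unfolding submodule_span_def by blast

lemma submodule_span_empty: "submodule_span R M {} = {\<zero>\<^bsub>M\<^esub>}"
proof
  show "submodule_span R M {} \<subseteq> {\<zero>\<^bsub>M\<^esub>}"
    by (rule submodule_span_minimal[OF submodule_zero]) simp
  show "{\<zero>\<^bsub>M\<^esub>} \<subseteq> submodule_span R M {}"
    using submoduleD(2)[OF submodule_span_submodule[OF empty_subsetI]] by blast
qed

end

definition submodule_adjoin ::
    "('r, 'a) ring_scheme \<Rightarrow> ('r, 'm, 'b) module_scheme \<Rightarrow> 'm set \<Rightarrow> 'm \<Rightarrow> 'm set" where
  "submodule_adjoin R M N x = {y \<oplus>\<^bsub>M\<^esub> a \<odot>\<^bsub>M\<^esub> x | y a. y \<in> N \<and> a \<in> carrier R}"

definition colon ::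
    "('r, 'a) ring_scheme \<Rightarrow> ('r, 'm, 'b) module_scheme \<Rightarrow> 'm set \<Rightarrow> 'm \<Rightarrow> 'r set" where
  "colon R M N x = {r \<in> carrier R. r \<odot>\<^bsub>M\<^esub> x \<in> N}"

abbreviation annihilator ::
    "('r, 'a) ring_scheme \<Rightarrow> ('r, 'm, 'b) module_scheme \<Rightarrow> 'm \<Rightarrow> 'r set" where
  "annihilator R M x \<equiv> colon R M {\<zero>\<^bsub>M\<^esub>} x"

abbreviation left_ideal :: "('r, 'a) ring_scheme \<Rightarrow> 'r set \<Rightarrow> bool" where
  "left_ideal R I \<equiv> submodule I R (regular_module R)"

lemma regular_module_simps [simp]:
  "carrier (regular_module R) = carrier R" "\<zero>\<^bsub>regular_module R\<^esub> = \<zero>\<^bsub>R\<^esub>"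
  "a \<oplus>\<^bsub>regular_module R\<^esub> b = a \<oplus>\<^bsub>R\<^esub> b" "a \<odot>\<^bsub>regular_module R\<^esub> b = a \<otimes>\<^bsub>R\<^esub> b"
  by (simp_all add: regular_module_def)

context left_module
begin

lemmas left_ideal_iff = left_module.submodule_iff[OF left_module_regular[OF R.ring_axioms],
    unfolded regular_module_simps]

lemma submodule_adjoin_submodule:
  assumes N: "submodule N R M" and x: "x \<in> carrier M"
  shows "submodule (submodule_adjoin R M N x) R M"
proof (rule submoduleI)
  note D = submoduleD[OF N]
  show "submodule_adjoin R M N x \<subseteq> carrier M"
    unfolding submodule_adjoin_def using D(1) x by blast
  show "\<zero>\<^bsub>M\<^esub> \<in> submodule_adjoin R M N x"
    unfolding submodule_adjoin_def using D(2) x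
    by (intro CollectI exI[of _ "\<zero>\<^bsub>M\<^esub>"] exI[of _ \<zero>]) simp
  fix u v
  assume "u \<in> submodule_adjoin R M N x" "v \<in> submodule_adjoin R M N x"
  then obtain y a z b where yz: "y \<in> N" "a \<in> carrier R" "u = y \<oplus>\<^bsub>M\<^esub> a \<odot>\<^bsub>M\<^esub> x"
      "z \<in> N" "b \<in> carrier R" "v = z \<oplus>\<^bsub>M\<^esub> b \<odot>\<^bsub>M\<^esub> x"
    unfolding submodule_adjoin_def by blast
  then have "u \<oplus>\<^bsub>M\<^esub> v = (y \<oplus>\<^bsub>M\<^esub> z) \<oplus>\<^bsub>M\<^esub> (a \<oplus> b) \<odot>\<^bsub>M\<^esub> x"
    using x D(1) by (simp add: smult_l_distr M.add.m_ac)
  then show "u \<oplus>\<^bsub>M\<^esub> v \<in> submodule_adjoin R M N x"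
    unfolding submodule_adjoin_def using yz D(3) by blast
next
  note D = submoduleD[OF N]
  fix r u
  assume r: "r \<in> carrier R" and "u \<in> submodule_adjoin R M N x"
  then obtain y a where y: "y \<in> N" "a \<in> carrier R" "u = y \<oplus>\<^bsub>M\<^esub> a \<odot>\<^bsub>M\<^esub> x"
    unfolding submodule_adjoin_def by blast
  then have "r \<odot>\<^bsub>M\<^esub> u = r \<odot>\<^bsub>M\<^esub> y \<oplus>\<^bsub>M\<^esub> (r \<otimes> a) \<odot>\<^bsub>M\<^esub> x"
    using x r D(1) by (simp add: smult_r_distr smult_assoc1)
  then show "r \<odot>\<^bsub>M\<^esub> u \<in> submodule_adjoin R M N x"
    unfolding submodule_adjoin_def using y r D(4) by blast
qed

lemma submodule_adjoin_superset:
  assumes "submodule N R M" and x: "x \<in> carrier M"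
  shows "N \<subseteq> submodule_adjoin R M N x" "x \<in> submodule_adjoin R M N x"
proof -
  note D = submoduleD[OF assms(1)]
  show "N \<subseteq> submodule_adjoin R M N x"
  proof
    fix y assume "y \<in> N"
    moreover from this have "y \<in> carrier M"
      by (rule D(1))
    ultimately show "y \<in> submodule_adjoin R M N x"
      unfolding submodule_adjoin_def using x
      by (intro CollectI exI[of _ y] exI[of _ \<zero>]) simp
  qed
  show "x \<in> submodule_adjoin R M N x"
    unfolding submodule_adjoin_def using D(2) x
    by (intro CollectI exI[of _ "\<zero>\<^bsub>M\<^esub>"] exI[of _ \<one>]) simp
qed

lemma submodule_span_insert:
  assumes "A \<subseteq> carrier M" and "x \<in> carrier M"
  shows "submodule_span R M (insert x A) = submodule_adjoin R M (submodule_span R M A) x"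
    (is "_ = ?S")
proof
  note s = submodule_span_submodule[OF assms(1)]
  show "submodule_span R M (insert x A) \<subseteq> ?S"
    using submodule_adjoin_superset[OF s assms(2)] submodule_span_superset[of A]
    by (intro submodule_span_minimal submodule_adjoin_submodule[OF s assms(2)]) blast
  have "submodule (submodule_span R M (insert x A)) R M"
    by (intro submodule_span_submodule) (use assms in auto)
  note D = submoduleD[OF this]
  show "?S \<subseteq> submodule_span R M (insert x A)"
    using D(3,4) submodule_span_mono[of A "insert x A"] submodule_span_superset[of "insert x A"]
    unfolding submodule_adjoin_def by blast
qed

lemma colon_left_ideal:
  assumes N: "submodule N R M" and x: "x \<in> carrier M"
  shows "left_ideal R (colon R M N x)"
  unfolding colon_def
  using x left_module.submodule_carrier[OF left_module_regular[OF R.ring_axioms]]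
  by (intro left_module.submodule_vimage[OF left_module_regular[OF R.ring_axioms] _ left_module_axioms N,
        of "carrier R" _ "\<lambda>r. r"]) (simp_all add: smult_l_distr smult_assoc1)

lemma colon_smult:
  assumes "x \<in> carrier M" "a \<in> carrier R"
  shows "colon R M N (a \<odot>\<^bsub>M\<^esub> x) = colon R (regular_module R) (colon R M N x) a"
  using assms by (auto simp: colon_def smult_assoc1)

lemma colon_mono: "N \<subseteq> P \<Longrightarrow> colon R M N x \<subseteq> colon R M P x"
  by (auto simp: colon_def)

lemma colon_self:
  assumes N: "submodule N R M" and "x \<in> N"
  shows "colon R M N x = carrier R"
  unfolding colon_def using assms submoduleD(4)[OF N] by blast

lemma colon_add_submodule:
  assumes N: "submodule N R M" and "x \<in> N" "y \<in> carrier M"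
  shows "colon R M N (x \<oplus>\<^bsub>M\<^esub> y) = colon R M N y"
proof -
  note D = submoduleD[OF N]
  have "r \<odot>\<^bsub>M\<^esub> (x \<oplus>\<^bsub>M\<^esub> y) \<in> N \<longleftrightarrow> r \<odot>\<^bsub>M\<^esub> y \<in> N" if r: "r \<in> carrier R" for r
  proof
    assume *: "r \<odot>\<^bsub>M\<^esub> (x \<oplus>\<^bsub>M\<^esub> y) \<in> N"
    have "r \<odot>\<^bsub>M\<^esub> y = \<ominus>\<^bsub>M\<^esub> (r \<odot>\<^bsub>M\<^esub> x) \<oplus>\<^bsub>M\<^esub> r \<odot>\<^bsub>M\<^esub> (x \<oplus>\<^bsub>M\<^esub> y)"
      using r assms D(1) by (simp add: smult_r_distr M.r_neg1)
    then show "r \<odot>\<^bsub>M\<^esub> y \<in> N"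
      using * r assms D(3,4,5) by metis
  next
    assume "r \<odot>\<^bsub>M\<^esub> y \<in> N"
    then show "r \<odot>\<^bsub>M\<^esub> (x \<oplus>\<^bsub>M\<^esub> y) \<in> N"
      using r assms D by (simp add: smult_r_distr)
  qed
  then show ?thesis
    by (auto simp: colon_def)
qed

lemma coefficient_left_ideal:
  assumes P: "submodule P R M" and N: "submodule N R M" and x: "x \<in> carrier M"
  shows "left_ideal R {r \<in> carrier R. \<exists>p\<in>P. p \<oplus>\<^bsub>M\<^esub> r \<odot>\<^bsub>M\<^esub> x \<in> N}" (is "left_ideal R ?I")
  unfolding left_ideal_iff
proof (intro conjI ballI)
  note DP = submoduleD[OF P] and D = submoduleD[OF N]
  show "\<zero> \<in> ?I"
    using DP(2) D(2) x by (intro CollectI conjI bexI[of _ "\<zero>\<^bsub>M\<^esub>"]) auto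
next
  note DP = submoduleD[OF P] and D = submoduleD[OF N]
  fix r s assume "r \<in> ?I" "s \<in> ?I"
  then obtain p q where *: "p \<in> P" "q \<in> P" "p \<oplus>\<^bsub>M\<^esub> r \<odot>\<^bsub>M\<^esub> x \<in> N" "q \<oplus>\<^bsub>M\<^esub> s \<odot>\<^bsub>M\<^esub> x \<in> N"
      "r \<in> carrier R" "s \<in> carrier R"
    by blast
  then have "(p \<oplus>\<^bsub>M\<^esub> q) \<oplus>\<^bsub>M\<^esub> (r \<oplus> s) \<odot>\<^bsub>M\<^esub> x = (p \<oplus>\<^bsub>M\<^esub> r \<odot>\<^bsub>M\<^esub> x) \<oplus>\<^bsub>M\<^esub> (q \<oplus>\<^bsub>M\<^esub> s \<odot>\<^bsub>M\<^esub> x)"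
    using x DP(1) by (simp add: smult_l_distr M.add.m_ac)
  then have "(p \<oplus>\<^bsub>M\<^esub> q) \<oplus>\<^bsub>M\<^esub> (r \<oplus> s) \<odot>\<^bsub>M\<^esub> x \<in> N"
    using *(3,4) D(3) by simp
  then show "r \<oplus> s \<in> ?I"
    using * DP(3) by blast
next
  note DP = submoduleD[OF P] and D = submoduleD[OF N]
  fix a r assume "a \<in> carrier R" "r \<in> ?I"
  then obtain p where *: "p \<in> P" "p \<oplus>\<^bsub>M\<^esub> r \<odot>\<^bsub>M\<^esub> x \<in> N" "r \<in> carrier R" "a \<in> carrier R"
    by blast
  then have "a \<odot>\<^bsub>M\<^esub> p \<oplus>\<^bsub>M\<^esub> (a \<otimes> r) \<odot>\<^bsub>M\<^esub> x = a \<odot>\<^bsub>M\<^esub> (p \<oplus>\<^bsub>M\<^esub> r \<odot>\<^bsub>M\<^esub> x)"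
    using x DP(1) by (simp add: smult_r_distr smult_assoc1)
  then have "a \<odot>\<^bsub>M\<^esub> p \<oplus>\<^bsub>M\<^esub> (a \<otimes> r) \<odot>\<^bsub>M\<^esub> x \<in> N"
    using *(2,4) D(4) by simp
  then show "a \<otimes> r \<in> ?I"
    using * DP(4) by blast
qed auto

text \<open>
  A finitely generated module over a left Noetherian ring is Noetherian: adjoining a generator \<open>x\<close>
  enlarges a submodule by representatives of generators of the left ideal of coefficients at \<open>x\<close>.
\<close>

lemma noetherian_submodule_fin_gen:
  assumes noeth: "left_noetherian R" and "finite B" "B \<subseteq> carrier M"
    and "submodule N R M" "N \<subseteq> submodule_span R M B"
  shows "\<exists>A. finite A \<and> A \<subseteq> carrier M \<and> N = submodule_span R M A"
  using assms(2-)
proof (induction B arbitrary: N rule: finite_induct)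
  case empty
  then have "N = {\<zero>\<^bsub>M\<^esub>}"
    using submodule_span_empty submoduleD(2)[OF empty(2)] by blast
  then show ?case
    using submodule_span_empty by (intro exI[of _ "{}"]) simp
next
  case (insert x B)
  note N = \<open>submodule N R M\<close>
  note D = submoduleD[OF N]
  let ?P = "submodule_span R M B"
  have x: "x \<in> carrier M" and P: "submodule ?P R M"
    using insert submodule_span_submodule[of B] by auto
  note DP = submoduleD[OF P]
  have Nadj: "N \<subseteq> submodule_adjoin R M ?P x"
    using insert.prems submodule_span_insert[of B x] by auto
  define I where "I = {r \<in> carrier R. \<exists>p\<in>?P. p \<oplus>\<^bsub>M\<^esub> r \<odot>\<^bsub>M\<^esub> x \<in> N}"
  have "left_ideal R I"
    unfolding I_def using coefficient_left_ideal[OF P N x] .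
  then obtain C where C: "finite C" "C \<subseteq> carrier R" "I = submodule_span R (regular_module R) C"
    using noeth unfolding left_noetherian_def by blast
  interpret reg: left_module R "regular_module R"
    by (rule left_module_regular) (rule R.ring_axioms)
  have "\<exists>p. p \<in> ?P \<and> p \<oplus>\<^bsub>M\<^esub> r \<odot>\<^bsub>M\<^esub> x \<in> N" if "r \<in> C" for r
    using that C(3) reg.submodule_span_superset[of C] unfolding I_def by blast
  then obtain p where p: "p r \<in> ?P" "p r \<oplus>\<^bsub>M\<^esub> r \<odot>\<^bsub>M\<^esub> x \<in> N" if "r \<in> C" for r
    by metis
  obtain A where A: "finite A" "A \<subseteq> carrier M" "N \<inter> ?P = submodule_span R M A"
    using insert.IH[of "N \<inter> ?P"] insert.prems submodule_inter[OF N P] by auto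
  define A' where "A' = A \<union> (\<lambda>r. p r \<oplus>\<^bsub>M\<^esub> r \<odot>\<^bsub>M\<^esub> x) ` C"
  have A'N: "A' \<subseteq> N"
    using A(3) submodule_span_superset[of A] p unfolding A'_def by auto
  then have A'M: "A' \<subseteq> carrier M"
    using D(1) by auto
  have S: "submodule (submodule_span R M A') R M"
    by (rule submodule_span_submodule) fact
  note DS = submoduleD[OF S]
  define I' where "I' = {r \<in> carrier R. \<exists>q\<in>?P. q \<oplus>\<^bsub>M\<^esub> r \<odot>\<^bsub>M\<^esub> x \<in> submodule_span R M A'}"
  have I': "left_ideal R I'"
    unfolding I'_def using coefficient_left_ideal[OF P S x] .
  have "C \<subseteq> I'"
    using p submodule_span_superset[of A'] C(2) unfolding I'_def A'_def by blast
  then have II': "I \<subseteq> I'"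
    using C(3) reg.submodule_span_minimal[OF I'] by simp
  have "N \<subseteq> submodule_span R M A'"
  proof
    fix y assume y: "y \<in> N"
    then obtain q r where q: "q \<in> ?P" "r \<in> carrier R" "y = q \<oplus>\<^bsub>M\<^esub> r \<odot>\<^bsub>M\<^esub> x"
      using Nadj unfolding submodule_adjoin_def by blast
    then have "r \<in> I'"
      using y II' unfolding I_def by blast
    then obtain q' where q': "q' \<in> ?P" "q' \<oplus>\<^bsub>M\<^esub> r \<odot>\<^bsub>M\<^esub> x \<in> submodule_span R M A'" (is "?z \<in> _")
      unfolding I'_def by blast
    have zN: "?z \<in> N"
      using q'(2) submodule_span_minimal[OF N A'N] by blast
    define d where "d = q \<oplus>\<^bsub>M\<^esub> \<ominus>\<^bsub>M\<^esub> q'"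
    have dP: "d \<in> ?P"
      unfolding d_def using DP(3)[OF q(1) DP(5)[OF q'(1)]] .
    have mem: "d \<in> carrier M" "q \<in> carrier M" "q' \<in> carrier M" "r \<odot>\<^bsub>M\<^esub> x \<in> carrier M"
      using dP q q' x DP(1) by auto
    have yd: "y = d \<oplus>\<^bsub>M\<^esub> ?z"
      unfolding q(3) d_def using mem by (simp add: M.a_assoc M.r_neg1)
    have "y \<oplus>\<^bsub>M\<^esub> \<ominus>\<^bsub>M\<^esub> ?z = d"
      unfolding yd using mem by (simp only: M.a_assoc M.r_neg M.a_closed M.a_inv_closed M.r_zero)
    then have "d \<in> N"
      using D(3)[OF y D(5)[OF zN]] by simp
    then have "d \<in> submodule_span R M A'"
      using dP A(3) submodule_span_mono[of A A'] unfolding A'_def by auto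
    then show "y \<in> submodule_span R M A'"
      unfolding yd using DS(3) q'(2) by blast
  qed
  then have "N = submodule_span R M A'"
    using submodule_span_minimal[OF N A'N] by blast
  moreover have "finite A'"
    using A C unfolding A'_def by auto
  ultimately show ?case
    using A'M by blast
qed

end

text \<open>
  The union of a chain of left ideals is finitely generated, and its generators already lie in one
  member of the chain; so Zorn's lemma applies.
\<close>

lemma left_noetherian_maximal:
  assumes noeth: "left_noetherian R" and S: "\<And>I. I \<in> S \<Longrightarrow> left_ideal R I" "S \<noteq> {}"
  shows "\<exists>I\<in>S. \<forall>J\<in>S. I \<subseteq> J \<longrightarrow> J = I"
proof (rule subset_Zorn_nonempty)
  show "S \<noteq> {}" by fact
  fix C assume C: "C \<noteq> {}" "subset.chain S C"
  interpret R: ring R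
    using noeth unfolding left_noetherian_def by blast
  interpret reg: left_module R "regular_module R"
    by (rule left_module_regular) (rule R.ring_axioms)
  have CS: "C \<subseteq> S" and total: "\<And>I J. I \<in> C \<Longrightarrow> J \<in> C \<Longrightarrow> I \<subseteq> J \<or> J \<subseteq> I"
    using C(2) by (auto simp: subset_chain_def)
  note D = reg.submoduleD[OF S(1)[OF subsetD[OF CS]], unfolded regular_module_simps]
  have "left_ideal R (\<Union>C)"
    unfolding reg.left_ideal_iff
  proof (intro conjI ballI)
    fix x y assume "x \<in> \<Union>C" "y \<in> \<Union>C"
    then obtain I J where "I \<in> C" "x \<in> I" "J \<in> C" "y \<in> J"
      by blast
    then obtain L where "L \<in> C" "x \<in> L" "y \<in> L"
      using total[of I J] by blast
    then show "x \<oplus>\<^bsub>R\<^esub> y \<in> \<Union>C"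
      using D(3) by blast
  next
    fix a x assume "a \<in> carrier R" "x \<in> \<Union>C"
    then show "a \<otimes>\<^bsub>R\<^esub> x \<in> \<Union>C"
      using D(4) by blast
  next
    show "\<Union>C \<subseteq> carrier R"
      using D(1) by blast
    show "\<zero>\<^bsub>R\<^esub> \<in> \<Union>C"
      using C(1) D(2) by blast
  qed
  then obtain A where A: "finite A" "\<Union>C = submodule_span R (regular_module R) A"
    using noeth unfolding left_noetherian_def by blast
  have "A \<subseteq> \<Union>C"
    unfolding A(2) by (rule reg.submodule_span_superset)
  with A(1) have "\<exists>I\<in>C. A \<subseteq> I"
  proof (induction A rule: finite_induct)
    case empty
    then show ?case using C(1) by auto
  next
    case (insert a A)
    then obtain I J where "I \<in> C" "A \<subseteq> I" "J \<in> C" "a \<in> J"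
      by blast
    then show ?case
      using total[of I J] by blast
  qed
  then obtain I where "I \<in> C" "A \<subseteq> I"
    by blast
  then have "\<Union>C = I"
    using A(2) reg.submodule_span_minimal[OF S(1)[of I]] CS by auto
  then show "\<Union>C \<in> S"
    using \<open>I \<in> C\<close> CS by auto
qed

section \<open>Gabriel filters and relative length\<close>

text \<open>
  Gabriel filters are another form of hereditary torsion theories: \<open>I\<close> belongs to \<open>F\<close> if and only if
  \<open>R/I\<close> is torsion. An element \<open>x\<close> of a module is torsion modulo \<open>N\<close> when \<open>colon R M N x \<in> F\<close>, so
  torsion in subquotients can be expressed without forming quotient modules.
\<close>

locale gabriel_filter = R: ring R for R :: "('r, 'a) ring_scheme" (structure) +
  fixes F :: "'r set set"
  assumes left_ideal: "I \<in> F \<Longrightarrow> left_ideal R I"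
    and carrier_mem: "carrier R \<in> F"
    and upward: "I \<in> F \<Longrightarrow> left_ideal R J \<Longrightarrow> I \<subseteq> J \<Longrightarrow> J \<in> F"
    and colon_mem: "I \<in> F \<Longrightarrow> a \<in> carrier R \<Longrightarrow> colon R (regular_module R) I a \<in> F"
    and extension: "J \<in> F \<Longrightarrow> left_ideal R I \<Longrightarrow>
      (\<And>a. a \<in> J \<Longrightarrow> colon R (regular_module R) I a \<in> F) \<Longrightarrow> I \<in> F"

lemma (in gabriel_filter) inter_mem:
  assumes "I \<in> F" "J \<in> F"
  shows "I \<inter> J \<in> F"
proof (rule extension[OF \<open>J \<in> F\<close>])
  interpret reg: left_module R "regular_module R"
    by (rule left_module_regular) (rule R.ring_axioms)
  note I = left_ideal[OF assms(1)] and J = left_ideal[OF assms(2)]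
  show "left_ideal R (I \<inter> J)"
    by (rule reg.submodule_inter[OF I J])
  fix a assume a: "a \<in> J"
  then have "colon R (regular_module R) (I \<inter> J) a = colon R (regular_module R) I a"
    using reg.submoduleD(4)[OF J] unfolding colon_def by fastforce
  then show "colon R (regular_module R) (I \<inter> J) a \<in> F"
    using colon_mem[OF assms(1)] reg.submoduleD(1)[OF J a] by simp
qed

definition torsion ::
    "('r, 'a) ring_scheme \<Rightarrow> ('r, 'm, 'b) module_scheme \<Rightarrow> 'r set set \<Rightarrow> 'm set" where
  "torsion R M F = {x \<in> carrier M. annihilator R M x \<in> F}"

text \<open>
  Relative length enters only through upper bounds. Chains are indexed by all natural numbers; a finite
  chain is one that becomes constant, and the later steps are not jumps. A jump is a step \<open>A i \<subseteq> A (i + 1)\<close>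
  whose factor module is not torsion.
\<close>

definition submodule_chain ::
    "('r, 'a) ring_scheme \<Rightarrow> ('r, 'm, 'b) module_scheme \<Rightarrow> 'm set \<Rightarrow> 'm set \<Rightarrow> (nat \<Rightarrow> 'm set) \<Rightarrow> bool" where
  "submodule_chain R M B W A \<longleftrightarrow>
     (\<forall>i. submodule (A i) R M \<and> B \<subseteq> A i \<and> A i \<subseteq> W \<and> A i \<subseteq> A (Suc i))"

lemma submodule_chainI:
  assumes "\<And>i. submodule (A i) R M" "\<And>i. B \<subseteq> A i" "\<And>i. A i \<subseteq> W" "\<And>i. A i \<subseteq> A (Suc i)"
  shows "submodule_chain R M B W A"
  using assms by (simp add: submodule_chain_def)

lemma submodule_chainD:
  assumes "submodule_chain R M B W A"
  shows "submodule (A i) R M" "B \<subseteq> A i" "A i \<subseteq> W" "A i \<subseteq> A (Suc i)"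
  using assms by (simp_all add: submodule_chain_def)

definition jumps ::
    "('r, 'a) ring_scheme \<Rightarrow> ('r, 'm, 'b) module_scheme \<Rightarrow> 'r set set \<Rightarrow> (nat \<Rightarrow> 'm set) \<Rightarrow> nat set" where
  "jumps R M F A = {i. \<exists>z\<in>A (Suc i). colon R M (A i) z \<notin> F}"

definition length_le ::
    "('r, 'a) ring_scheme \<Rightarrow> ('r, 'm, 'b) module_scheme \<Rightarrow> 'r set set \<Rightarrow> 'm set \<Rightarrow> 'm set \<Rightarrow> nat \<Rightarrow> bool" where
  "length_le R M F B W n \<longleftrightarrow>
     (\<forall>A. submodule_chain R M B W A \<longrightarrow> finite (jumps R M F A) \<and> card (jumps R M F A) \<le> n)"

text \<open>
  All comparisons of lengths transport chains from one module to another. The transport \<open>t\<close> is a map of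
  chains, which may be preimage, image or sum.
\<close>

lemma length_leI_transfer:
  assumes "length_le R' M' F' B' W' n"
    and "\<And>A. submodule_chain R M B W A \<Longrightarrow>
      submodule_chain R' M' B' W' (t A) \<and> jumps R M F A \<subseteq> jumps R' M' F' (t A)"
  shows "length_le R M F B W n"
  unfolding length_le_def
proof (intro allI impI)
  fix A assume "submodule_chain R M B W A"
  then have "submodule_chain R' M' B' W' (t A)" and sub: "jumps R M F A \<subseteq> jumps R' M' F' (t A)"
    using assms(2) by blast+
  then have "finite (jumps R' M' F' (t A))" "card (jumps R' M' F' (t A)) \<le> n"
    using assms(1) unfolding length_le_def by blast+
  then show "finite (jumps R M F A) \<and> card (jumps R M F A) \<le> n"
    using finite_subset[OF sub] card_mono[OF _ sub] by (meson le_trans)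
qed

lemma length_le_mono:
  assumes "length_le R M F B W n" "B \<subseteq> B'" "W' \<subseteq> W" "n \<le> m"
  shows "length_le R M F B' W' m"
proof -
  have "length_le R M F B' W' n"
    using assms(2,3) by (intro length_leI_transfer[OF assms(1), of _ _ _ _ "\<lambda>A. A"])
      (unfold submodule_chain_def, blast)
  then show ?thesis
    using assms(4) unfolding length_le_def by fastforce
qed

context left_module
begin

lemma torsion_modulo_submodule:
  assumes "gabriel_filter R F" and N: "submodule N R M"
  shows "submodule {x \<in> carrier M. colon R M N x \<in> F} R M" (is "submodule ?T R M")
proof (rule submoduleI)
  interpret gabriel_filter R F by fact
  show "?T \<subseteq> carrier M"
    by auto
  show "\<zero>\<^bsub>M\<^esub> \<in> ?T"
    using carrier_mem colon_self[OF N submoduleD(2)[OF N]] by simp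
  fix x y assume "x \<in> ?T" "y \<in> ?T"
  then have x: "x \<in> carrier M" "colon R M N x \<in> F" and y: "y \<in> carrier M" "colon R M N y \<in> F"
    by auto
  have "colon R M N x \<inter> colon R M N y \<subseteq> colon R M N (x \<oplus>\<^bsub>M\<^esub> y)"
    using x(1) y(1) submoduleD(3)[OF N] by (auto simp: colon_def smult_r_distr)
  then show "x \<oplus>\<^bsub>M\<^esub> y \<in> ?T"
    using upward[OF inter_mem[OF x(2) y(2)]] colon_left_ideal[OF N] x(1) y(1) by simp
next
  interpret gabriel_filter R F by fact
  fix a x assume "a \<in> carrier R" "x \<in> ?T"
  then show "a \<odot>\<^bsub>M\<^esub> x \<in> ?T"
    using colon_mem[of "colon R M N x" a] by (simp add: colon_smult)
qed

lemma torsion_submodule: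
  assumes "gabriel_filter R F"
  shows "submodule (torsion R M F) R M"
  using torsion_modulo_submodule[OF assms submodule_zero] by (simp add: torsion_def)

lemma submodule_sum:
  assumes N: "submodule N R M" and P: "submodule P R M"
  shows "submodule {a \<oplus>\<^bsub>M\<^esub> x | a x. a \<in> N \<and> x \<in> P} R M" (is "submodule ?S R M")
    and "N \<subseteq> {a \<oplus>\<^bsub>M\<^esub> x | a x. a \<in> N \<and> x \<in> P}" "P \<subseteq> {a \<oplus>\<^bsub>M\<^esub> x | a x. a \<in> N \<and> x \<in> P}"
proof -
  note D = submoduleD[OF N] and E = submoduleD[OF P]
  show "N \<subseteq> ?S"
  proof
    fix y assume y: "y \<in> N"
    then have "y = y \<oplus>\<^bsub>M\<^esub> \<zero>\<^bsub>M\<^esub>"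
      using D(1) by simp
    then show "y \<in> ?S"
      using y E(2) by blast
  qed
  show "P \<subseteq> ?S"
  proof
    fix y assume y: "y \<in> P"
    then have "y = \<zero>\<^bsub>M\<^esub> \<oplus>\<^bsub>M\<^esub> y"
      using E(1) by simp
    then show "y \<in> ?S"
      using y D(2) by blast
  qed
  show "submodule ?S R M"
  proof (rule submoduleI)
    show "?S \<subseteq> carrier M"
      using D(1) E(1) by blast
    show "\<zero>\<^bsub>M\<^esub> \<in> ?S"
      using D(2) \<open>N \<subseteq> ?S\<close> by blast
    fix u v assume "u \<in> ?S" "v \<in> ?S"
    then obtain a x b y where *: "u = a \<oplus>\<^bsub>M\<^esub> x" "v = b \<oplus>\<^bsub>M\<^esub> y" "a \<in> N" "b \<in> N" "x \<in> P" "y \<in> P"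
      by blast
    then have "a \<in> carrier M" "b \<in> carrier M" "x \<in> carrier M" "y \<in> carrier M"
      using D(1) E(1) by blast+
    then have "u \<oplus>\<^bsub>M\<^esub> v = (a \<oplus>\<^bsub>M\<^esub> b) \<oplus>\<^bsub>M\<^esub> (x \<oplus>\<^bsub>M\<^esub> y)"
      unfolding * by (simp add: M.add.m_ac)
    then show "u \<oplus>\<^bsub>M\<^esub> v \<in> ?S"
      using * D(3) E(3) by blast
  next
    fix r u assume r: "r \<in> carrier R" and "u \<in> ?S"
    then obtain a x where *: "u = a \<oplus>\<^bsub>M\<^esub> x" "a \<in> N" "x \<in> P"
      by blast
    then have "r \<odot>\<^bsub>M\<^esub> u = r \<odot>\<^bsub>M\<^esub> a \<oplus>\<^bsub>M\<^esub> r \<odot>\<^bsub>M\<^esub> x"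
      using r D(1)[of a] E(1)[of x] by (simp add: smult_r_distr)
    then show "r \<odot>\<^bsub>M\<^esub> u \<in> ?S"
      using * r D(4) E(4) by blast
  qed
qed

text \<open>
  A chain between \<open>B\<close> and \<open>Y\<close> gives rise to its intersections with \<open>W\<close> and its sums with \<open>W\<close>. A step that
  is torsion in both of these is an extension of torsion by torsion, hence not a jump.
\<close>

lemma length_le_trans:
  assumes gf: "gabriel_filter R F" and W: "submodule W R M" and "B \<subseteq> W" "W \<subseteq> Y"
    and Y: "submodule Y R M"
    and n: "length_le R M F B W n" and m: "length_le R M F W Y m"
  shows "length_le R M F B Y (n + m)"
  unfolding length_le_def
proof (intro allI impI)
  interpret gabriel_filter R F by fact
  fix A assume A: "submodule_chain R M B Y A"
  then have Ai: "\<And>i. submodule (A i) R M" and AB: "\<And>i. B \<subseteq> A i" "\<And>i. A i \<subseteq> Y" "\<And>i. A i \<subseteq> A (Suc i)"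
    unfolding submodule_chain_def by simp_all
  define A1 where "A1 i = A i \<inter> W" for i
  define A2 where "A2 i = {a \<oplus>\<^bsub>M\<^esub> x | a x. a \<in> A i \<and> x \<in> W}" for i
  have "submodule_chain R M B W A1"
    unfolding submodule_chain_def A1_def using submodule_inter[OF Ai W] AB \<open>B \<subseteq> W\<close> by blast
  then have j1: "finite (jumps R M F A1)" "card (jumps R M F A1) \<le> n"
    using n unfolding length_le_def by blast+
  have "A2 i \<subseteq> Y" for i
    unfolding A2_def using AB(2)[of i] \<open>W \<subseteq> Y\<close> submoduleD(3)[OF Y] by blast
  moreover have "A2 i \<subseteq> A2 (Suc i)" for i
    unfolding A2_def using AB(3)[of i] by blast
  ultimately have "submodule_chain R M W Y A2"
    unfolding submodule_chain_def using submodule_sum[OF Ai W] by (simp add: A2_def)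
  then have j2: "finite (jumps R M F A2)" "card (jumps R M F A2) \<le> m"
    using m unfolding length_le_def by blast+
  have "jumps R M F A \<subseteq> jumps R M F A1 \<union> jumps R M F A2"
  proof
    fix i assume "i \<in> jumps R M F A"
    then obtain z where z: "z \<in> A (Suc i)" "colon R M (A i) z \<notin> F"
      unfolding jumps_def by blast
    have zM: "z \<in> carrier M"
      using submoduleD(1)[OF Ai z(1)] .
    show "i \<in> jumps R M F A1 \<union> jumps R M F A2"
    proof (rule ccontr)
      assume no: "i \<notin> jumps R M F A1 \<union> jumps R M F A2"
      have "z \<in> A2 (Suc i)"
        using z(1) submodule_sum(2)[OF Ai W] unfolding A2_def by blast
      then have J: "colon R M (A2 i) z \<in> F"
        using no unfolding jumps_def by blast
      have "colon R M (A i) z \<in> F"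
      proof (rule extension[OF J])
        show "left_ideal R (colon R M (A i) z)"
          by (rule colon_left_ideal[OF Ai zM])
        fix a assume "a \<in> colon R M (A2 i) z"
        then obtain b y where a: "a \<in> carrier R" and az: "a \<odot>\<^bsub>M\<^esub> z = b \<oplus>\<^bsub>M\<^esub> y" "b \<in> A i" "y \<in> W"
          unfolding colon_def A2_def by blast
        have bM: "b \<in> carrier M" "y \<in> carrier M"
          using submoduleD(1)[OF Ai az(2)] submoduleD(1)[OF W az(3)] .
        have "\<ominus>\<^bsub>M\<^esub> b \<in> A (Suc i)" "a \<odot>\<^bsub>M\<^esub> z \<in> A (Suc i)"
          using submoduleD(5)[OF Ai az(2)] submoduleD(4)[OF Ai a z(1)] AB(3) by blast+
        then have "\<ominus>\<^bsub>M\<^esub> b \<oplus>\<^bsub>M\<^esub> a \<odot>\<^bsub>M\<^esub> z \<in> A (Suc i)"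
          by (rule submoduleD(3)[OF Ai])
        moreover have "\<ominus>\<^bsub>M\<^esub> b \<oplus>\<^bsub>M\<^esub> a \<odot>\<^bsub>M\<^esub> z = y"
          unfolding az(1) using bM by (simp add: M.r_neg1)
        ultimately have "y \<in> A1 (Suc i)"
          using az(3) unfolding A1_def by blast
        then have "colon R M (A1 i) y \<in> F"
          using no unfolding jumps_def by blast
        moreover have "colon R M (A1 i) y \<subseteq> colon R M (A i) y"
          unfolding A1_def by (rule colon_mono) blast
        ultimately have "colon R M (A i) y \<in> F"
          using upward colon_left_ideal[OF Ai bM(2)] by blast
        then have "colon R M (A i) (a \<odot>\<^bsub>M\<^esub> z) \<in> F"
          unfolding az(1) using colon_add_submodule[OF Ai az(2) bM(2)] by simp
        then show "colon R (regular_module R) (colon R M (A i) z) a \<in> F"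
          using colon_smult[OF zM a] by simp
      qed
      with z(2) show False by contradiction
    qed
  qed
  moreover have "finite (jumps R M F A1 \<union> jumps R M F A2)"
    using j1 j2 by simp
  ultimately show "finite (jumps R M F A) \<and> card (jumps R M F A) \<le> n + m"
    using j1(2) j2(2) card_Un_le[of "jumps R M F A1" "jumps R M F A2"]
      card_mono[of "jumps R M F A1 \<union> jumps R M F A2" "jumps R M F A"] finite_subset
    by fastforce
qed

lemma length_le_self:
  assumes gf: "gabriel_filter R F"
  shows "length_le R M F W W 0"
proof -
  interpret gabriel_filter R F by fact
  have "jumps R M F A = {}" if A: "submodule_chain R M W W A" for A
  proof -
    have "A i = W" "submodule (A i) R M" for i
      using submodule_chainD[OF A] by blast+
    then show ?thesis
      using colon_self carrier_mem unfolding jumps_def by force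
  qed
  then show ?thesis
    unfolding length_le_def by simp
qed

text \<open>
  A cyclic extension by \<open>x\<close> is no longer than the cyclic module \<open>R/I\<close>, for any left ideal \<open>I\<close> that
  carries \<open>x\<close> into \<open>N\<close>: chains pull back along \<open>r \<mapsto> rx\<close>, and a jump at \<open>y + rx\<close> becomes one at \<open>r\<close>.
\<close>

lemma length_le_adjoin:
  assumes N: "submodule N R M" and x: "x \<in> carrier M" and I: "I \<subseteq> colon R M N x"
    and n: "length_le R (regular_module R) F I (carrier R) n"
  shows "length_le R M F N (submodule_adjoin R M N x) n"
proof (rule length_leI_transfer[OF n, of _ _ _ _ "\<lambda>A i. colon R M (A i) x"])
  fix A assume "submodule_chain R M N (submodule_adjoin R M N x) A"
  then have Ai: "\<And>i. submodule (A i) R M"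
    and AB: "\<And>i. N \<subseteq> A i" "\<And>i. A i \<subseteq> submodule_adjoin R M N x" "\<And>i. A i \<subseteq> A (Suc i)"
    unfolding submodule_chain_def by simp_all
  have chain: "submodule_chain R (regular_module R) I (carrier R) (\<lambda>i. colon R M (A i) x)"
  proof (rule submodule_chainI)
    show "left_ideal R (colon R M (A i) x)" for i
      by (rule colon_left_ideal[OF Ai x])
    show "I \<subseteq> colon R M (A i) x" for i
      using I colon_mono[OF AB(1)] by (rule subset_trans)
    show "colon R M (A i) x \<subseteq> carrier R" for i
      by (auto simp: colon_def)
    show "colon R M (A i) x \<subseteq> colon R M (A (Suc i)) x" for i
      by (rule colon_mono[OF AB(3)])
  qed
  have "jumps R M F A \<subseteq> jumps R (regular_module R) F (\<lambda>i. colon R M (A i) x)"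
  proof
    fix i assume "i \<in> jumps R M F A"
    then obtain z where z: "z \<in> A (Suc i)" "colon R M (A i) z \<notin> F"
      unfolding jumps_def by blast
    then obtain y r where y: "z = y \<oplus>\<^bsub>M\<^esub> r \<odot>\<^bsub>M\<^esub> x" "y \<in> N" "r \<in> carrier R"
      using AB(2) unfolding submodule_adjoin_def by blast
    have yA: "y \<in> A i" "y \<in> A (Suc i)"
      using y(2) AB(1) by blast+
    have c: "y \<in> carrier M" "r \<odot>\<^bsub>M\<^esub> x \<in> carrier M"
      using submoduleD(1)[OF N y(2)] x y(3) by auto
    have "\<ominus>\<^bsub>M\<^esub> y \<oplus>\<^bsub>M\<^esub> z \<in> A (Suc i)"
      using submoduleD(3,5)[OF Ai] yA(2) z(1) by blast
    moreover have "\<ominus>\<^bsub>M\<^esub> y \<oplus>\<^bsub>M\<^esub> z = r \<odot>\<^bsub>M\<^esub> x"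
      unfolding y(1) using c by (simp add: M.r_neg1)
    ultimately have "r \<in> colon R M (A (Suc i)) x"
      using y(3) unfolding colon_def by simp
    moreover have "colon R M (A i) z = colon R (regular_module R) (colon R M (A i) x) r"
      unfolding y(1) colon_add_submodule[OF Ai yA(1) c(2)] using colon_smult[OF x y(3)] .
    ultimately show "i \<in> jumps R (regular_module R) F (\<lambda>i. colon R M (A i) x)"
      using z(2) unfolding jumps_def by auto
  qed
  with chain show "submodule_chain R (regular_module R) I (carrier R) (\<lambda>i. colon R M (A i) x) \<and>
      jumps R M F A \<subseteq> jumps R (regular_module R) F (\<lambda>i. colon R M (A i) x)" ..
qed

lemma length_le_span:
  assumes gf: "gabriel_filter R F" and "finite J" "x ` J \<subseteq> carrier M"
    and "\<And>j. j \<in> J \<Longrightarrow> length_le R (regular_module R) F (annihilator R M (x j)) (carrier R) (n j)"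
  shows "length_le R M F {\<zero>\<^bsub>M\<^esub>} (submodule_span R M (x ` J)) (sum n J)"
  using assms(2-)
proof (induction J rule: finite_induct)
  case empty
  then show ?case
    using length_le_self[OF gf] by (simp add: submodule_span_empty)
next
  case (insert j J)
  let ?N = "submodule_span R M (x ` J)"
  have c: "x ` J \<subseteq> carrier M" "x j \<in> carrier M"
    using insert.prems by auto
  note N = submodule_span_submodule[OF c(1)]
  have z: "{\<zero>\<^bsub>M\<^esub>} \<subseteq> ?N"
    using submoduleD(2)[OF N] by simp
  have "length_le R M F ?N (submodule_adjoin R M ?N (x j)) (n j)"
    using colon_mono[OF z] insert.prems(2)[of j] by (intro length_le_adjoin[OF N c(2)]) auto
  moreover have "length_le R M F {\<zero>\<^bsub>M\<^esub>} ?N (sum n J)"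
    using insert.IH[OF c(1)] insert.prems(2) by simp
  ultimately have "length_le R M F {\<zero>\<^bsub>M\<^esub>} (submodule_adjoin R M ?N (x j)) (sum n J + n j)"
    by (intro length_le_trans[OF gf N z]
        submodule_adjoin_superset(1)[OF N c(2)] submodule_adjoin_submodule[OF N c(2)])
  then show ?case
    using insert.hyps submodule_span_insert[OF c] by (simp add: add.commute)
qed

end

section \<open>The filter of left ideals of finite colength\<close>

text \<open>
  For left Noetherian \<open>R\<close> this is one step of the Gabriel filtration: the torsion theory generated by \<open>F\<close>
  and by the modules that are simple modulo \<open>F\<close>-torsion.
\<close>

definition finite_length_filter :: "('r, 'a) ring_scheme \<Rightarrow> 'r set set \<Rightarrow> 'r set set" where
  "finite_length_filter R F =
     {I. left_ideal R I \<and> (\<exists>n. length_le R (regular_module R) F I (carrier R) n)}"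

lemma (in gabriel_filter) subset_finite_length_filter: "F \<subseteq> finite_length_filter R F"
proof
  interpret reg: left_module R "regular_module R"
    by (rule left_module_regular) (rule R.ring_axioms)
  fix I assume I: "I \<in> F"
  have "jumps R (regular_module R) F A = {}"
    if A: "submodule_chain R (regular_module R) I (carrier R) A" for A
  proof -
    have Ai: "submodule (A i) R (regular_module R)" "I \<subseteq> A i" for i
      using submodule_chainD[OF A] by blast+
    have "colon R (regular_module R) (A i) z \<in> F" if "z \<in> A (Suc i)" for i z
    proof (rule upward)
      have z: "z \<in> carrier R"
        using reg.submoduleD(1)[OF Ai(1) that] by simp
      show "colon R (regular_module R) I z \<in> F"
        by (rule colon_mem[OF I z])
      show "left_ideal R (colon R (regular_module R) (A i) z)"
        using reg.colon_left_ideal[OF Ai(1)] z by simp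
    qed (rule reg.colon_mono[OF Ai(2)])
    then show ?thesis
      unfolding jumps_def by blast
  qed
  then show "I \<in> finite_length_filter R F"
    using left_ideal[OF I] unfolding finite_length_filter_def length_le_def by auto
qed

text \<open>
  Right multiplication by \<open>a\<close> embeds \<open>R/(I : a)\<close> into \<open>R/I\<close>, so chains above \<open>I : a\<close> can be pushed forward to
  chains above \<open>I\<close>. For the extension axiom, \<open>J\<close> is finitely generated. Adjoining its generators \<open>a\<close> to \<open>I\<close> one
  after the other costs at most the length of \<open>R/(I : a)\<close> each time and leads to an ideal that contains \<open>J\<close>.
\<close>

lemma (in gabriel_filter) gabriel_filter_finite_length_filter:
  assumes noeth: "left_noetherian R"
  shows "gabriel_filter R (finite_length_filter R F)"
proof -
  interpret reg: left_module R "regular_module R"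
    by (rule left_module_regular) (rule R.ring_axioms)
  have gf: "gabriel_filter R F"
    by unfold_locales
  have c: "left_ideal R (carrier R)"
    using reg.submodule_carrier by simp
  show ?thesis
  proof (intro gabriel_filter.intro gabriel_filter_axioms.intro)
    show "ring R"
      by (rule R.ring_axioms)
  next
    fix I assume "I \<in> finite_length_filter R F"
    then show "left_ideal R I"
      by (simp add: finite_length_filter_def)
  next
    show "carrier R \<in> finite_length_filter R F"
      using c reg.length_le_self[OF gf] unfolding finite_length_filter_def by blast
  next
    fix I J assume "I \<in> finite_length_filter R F" "left_ideal R J" "I \<subseteq> J"
    then show "J \<in> finite_length_filter R F"
      unfolding finite_length_filter_def using length_le_mono[of R _ F I "carrier R" _ J "carrier R"] by blast
  next
    fix I a assume "I \<in> finite_length_filter R F" and a: "a \<in> carrier R"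
    then obtain n where I: "left_ideal R I" and n: "length_le R (regular_module R) F I (carrier R) n"
      unfolding finite_length_filter_def by blast
    let ?I = "colon R (regular_module R) I a"
    let ?t = "\<lambda>A i. {s \<oplus>\<^bsub>R\<^esub> r \<otimes>\<^bsub>R\<^esub> a | s r. s \<in> I \<and> r \<in> A i}"
    have Ia: "left_ideal R ?I"
      using reg.colon_left_ideal[OF I] a by simp
    have "length_le R (regular_module R) F ?I (carrier R) n"
    proof (rule length_leI_transfer[OF n, of _ _ _ _ ?t])
      fix A assume "submodule_chain R (regular_module R) ?I (carrier R) A"
      then have Ai: "\<And>i. left_ideal R (A i)"
        and AB: "\<And>i. ?I \<subseteq> A i" "\<And>i. A i \<subseteq> carrier R" "\<And>i. A i \<subseteq> A (Suc i)"
        unfolding submodule_chain_def by simp_all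
      note D = reg.submoduleD[OF I, unfolded regular_module_simps]
      note E = reg.submoduleD[OF Ai, unfolded regular_module_simps]
      \<comment> \<open>\<open>?t A i\<close> is the sum of \<open>I\<close> and the left ideal \<open>A i a\<close>.\<close>
      have P: "left_ideal R ((\<lambda>r. r \<otimes>\<^bsub>R\<^esub> a) ` A i)" for i
        unfolding reg.left_ideal_iff
      proof (intro conjI ballI)
        show "(\<lambda>r. r \<otimes>\<^bsub>R\<^esub> a) ` A i \<subseteq> carrier R"
          using E(1) a by blast
        show "\<zero>\<^bsub>R\<^esub> \<in> (\<lambda>r. r \<otimes>\<^bsub>R\<^esub> a) ` A i"
          using imageI[OF E(2), of "\<lambda>r. r \<otimes>\<^bsub>R\<^esub> a"] a by simp
        fix u v assume "u \<in> (\<lambda>r. r \<otimes>\<^bsub>R\<^esub> a) ` A i" "v \<in> (\<lambda>r. r \<otimes>\<^bsub>R\<^esub> a) ` A i"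
        then obtain r r' where r: "u = r \<otimes>\<^bsub>R\<^esub> a" "v = r' \<otimes>\<^bsub>R\<^esub> a" "r \<in> A i" "r' \<in> A i"
          by blast
        show "u \<oplus>\<^bsub>R\<^esub> v \<in> (\<lambda>r. r \<otimes>\<^bsub>R\<^esub> a) ` A i"
          using imageI[OF E(3)[OF r(3,4)], of "\<lambda>r. r \<otimes>\<^bsub>R\<^esub> a"] E(1)[OF r(3)] E(1)[OF r(4)] a r(1,2)
          by (simp add: R.l_distr)
      next
        fix b u assume b: "b \<in> carrier R" and "u \<in> (\<lambda>r. r \<otimes>\<^bsub>R\<^esub> a) ` A i"
        then obtain r where r: "u = r \<otimes>\<^bsub>R\<^esub> a" "r \<in> A i"
          by blast
        show "b \<otimes>\<^bsub>R\<^esub> u \<in> (\<lambda>r. r \<otimes>\<^bsub>R\<^esub> a) ` A i"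
          using imageI[OF E(4)[OF b r(2)], of "\<lambda>r. r \<otimes>\<^bsub>R\<^esub> a"] E(1)[OF r(2)] a b r(1)
          by (simp add: R.m_assoc)
      qed
      have t: "?t A i = {s \<oplus>\<^bsub>R\<^esub> u | s u. s \<in> I \<and> u \<in> (\<lambda>r. r \<otimes>\<^bsub>R\<^esub> a) ` A i}" for i
        by blast
      have ideal: "left_ideal R (?t A i)" and "I \<subseteq> ?t A i" for i
        unfolding t using reg.submodule_sum(1,2)[OF I P] by simp_all
      moreover have "?t A i \<subseteq> carrier R" for i
        using D(1) E(1) a by blast
      moreover have "?t A i \<subseteq> ?t A (Suc i)" for i
        using AB(3)[of i] by blast
      ultimately have chain: "submodule_chain R (regular_module R) I (carrier R) (?t A)"
        unfolding submodule_chain_def using ideal by blast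
      \<comment> \<open>As \<open>A i\<close> contains \<open>I : a\<close>, it is recovered as \<open>(I + A i a) : a\<close>.\<close>
      have recover: "colon R (regular_module R) (?t A i) (z \<otimes>\<^bsub>R\<^esub> a) \<subseteq> colon R (regular_module R) (A i) z"
        if z: "z \<in> carrier R" for i z
      proof
        fix b assume "b \<in> colon R (regular_module R) (?t A i) (z \<otimes>\<^bsub>R\<^esub> a)"
        then obtain s r where b: "b \<in> carrier R" and *: "b \<otimes>\<^bsub>R\<^esub> (z \<otimes>\<^bsub>R\<^esub> a) = s \<oplus>\<^bsub>R\<^esub> r \<otimes>\<^bsub>R\<^esub> a" "s \<in> I" "r \<in> A i"
          unfolding colon_def by auto
        have c: "s \<in> carrier R" "r \<in> carrier R"
          using * D(1) E(1) by blast+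
        have "(b \<otimes>\<^bsub>R\<^esub> z \<oplus>\<^bsub>R\<^esub> \<ominus>\<^bsub>R\<^esub> r) \<otimes>\<^bsub>R\<^esub> a = (s \<oplus>\<^bsub>R\<^esub> r \<otimes>\<^bsub>R\<^esub> a) \<oplus>\<^bsub>R\<^esub> \<ominus>\<^bsub>R\<^esub> (r \<otimes>\<^bsub>R\<^esub> a)"
          using *(1) a b c z by (simp add: R.l_distr R.m_assoc R.l_minus)
        also have "\<dots> = s"
          using c a by (simp add: R.add.m_assoc R.r_neg)
        finally have "b \<otimes>\<^bsub>R\<^esub> z \<oplus>\<^bsub>R\<^esub> \<ominus>\<^bsub>R\<^esub> r \<in> ?I"
          using b c z *(2) unfolding colon_def by simp
        then have "(b \<otimes>\<^bsub>R\<^esub> z \<oplus>\<^bsub>R\<^esub> \<ominus>\<^bsub>R\<^esub> r) \<oplus>\<^bsub>R\<^esub> r \<in> A i"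
          using AB(1)[of i] *(3) E(3) by blast
        moreover have "(b \<otimes>\<^bsub>R\<^esub> z \<oplus>\<^bsub>R\<^esub> \<ominus>\<^bsub>R\<^esub> r) \<oplus>\<^bsub>R\<^esub> r = b \<otimes>\<^bsub>R\<^esub> z"
          using b c z by (simp add: R.add.m_assoc R.l_neg)
        ultimately show "b \<in> colon R (regular_module R) (A i) z"
          using b unfolding colon_def by simp
      qed
      have "jumps R (regular_module R) F A \<subseteq> jumps R (regular_module R) F (?t A)"
      proof
        fix i assume "i \<in> jumps R (regular_module R) F A"
        then obtain z where z: "z \<in> A (Suc i)" "colon R (regular_module R) (A i) z \<notin> F"
          unfolding jumps_def by blast
        have zR: "z \<in> carrier R"
          using E(1) z(1) by blast
        have "z \<otimes>\<^bsub>R\<^esub> a = \<zero>\<^bsub>R\<^esub> \<oplus>\<^bsub>R\<^esub> z \<otimes>\<^bsub>R\<^esub> a"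
          using zR a by simp
        then have "z \<otimes>\<^bsub>R\<^esub> a \<in> ?t A (Suc i)"
          using D(2) z(1) by blast
        moreover have "colon R (regular_module R) (?t A i) (z \<otimes>\<^bsub>R\<^esub> a) \<notin> F"
          using z(2) upward[OF _ _ recover[OF zR]] reg.colon_left_ideal[OF Ai] zR by auto
        ultimately show "i \<in> jumps R (regular_module R) F (?t A)"
          unfolding jumps_def by blast
      qed
      with chain show "submodule_chain R (regular_module R) I (carrier R) (?t A) \<and>
          jumps R (regular_module R) F A \<subseteq> jumps R (regular_module R) F (?t A)" ..
    qed
    then show "?I \<in> finite_length_filter R F"
      unfolding finite_length_filter_def using Ia by blast
  next
    fix J I assume J: "J \<in> finite_length_filter R F" and I: "left_ideal R I"
      and col: "\<And>a. a \<in> J \<Longrightarrow> colon R (regular_module R) I a \<in> finite_length_filter R F"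
    obtain m where J': "left_ideal R J" and m: "length_le R (regular_module R) F J (carrier R) m"
      using J unfolding finite_length_filter_def by blast
    obtain C where C: "finite C" "C \<subseteq> carrier R" "J = submodule_span R (regular_module R) C"
      using noeth J' unfolding left_noetherian_def by blast
    have CJ: "C \<subseteq> J"
      unfolding C(3) by (rule reg.submodule_span_superset)
    have "\<exists>N n. left_ideal R N \<and> I \<subseteq> N \<and> C \<subseteq> N \<and> length_le R (regular_module R) F I N n"
      using C(1) CJ
    proof (induction C rule: finite_induct)
      case empty
      then show ?case
        using I reg.length_le_self[OF gf] by blast
    next
      case (insert a C)
      then obtain N n where N: "left_ideal R N" "I \<subseteq> N" "C \<subseteq> N"
          and n: "length_le R (regular_module R) F I N n"
        by blast
      have a: "a \<in> carrier (regular_module R)"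
        using insert.prems reg.submoduleD(1)[OF J'] by blast
      obtain k where k: "length_le R (regular_module R) F (colon R (regular_module R) I a) (carrier R) k"
        using col[of a] insert.prems unfolding finite_length_filter_def by blast
      let ?N = "submodule_adjoin R (regular_module R) N a"
      note N' = reg.submodule_adjoin_submodule[OF N(1) a]
      note sup = reg.submodule_adjoin_superset[OF N(1) a]
      have "length_le R (regular_module R) F N ?N k"
        by (rule reg.length_le_adjoin[OF N(1) a reg.colon_mono[OF N(2)] k])
      then have "length_le R (regular_module R) F I ?N (n + k)"
        by (rule reg.length_le_trans[OF gf N(1,2) sup(1) N' n])
      then show ?case
        using N' N sup by blast
    qed
    then obtain N n where N: "left_ideal R N" "I \<subseteq> N" "C \<subseteq> N"
        and n: "length_le R (regular_module R) F I N n"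
      by blast
    have JN: "J \<subseteq> N"
      unfolding C(3) by (rule reg.submodule_span_minimal[OF N(1,3)])
    have Nc: "N \<subseteq> carrier R"
      using reg.submoduleD(1)[OF N(1)] by auto
    have "length_le R (regular_module R) F N (carrier R) m"
      by (rule length_le_mono[OF m JN]) auto
    then have "length_le R (regular_module R) F I (carrier R) (n + m)"
      by (rule reg.length_le_trans[OF gf N(1,2) Nc c n])
    then show "I \<in> finite_length_filter R F"
      unfolding finite_length_filter_def using I by blast
  qed
qed

text \<open>
  A left ideal \<open>I\<close> that is maximal among those outside \<open>F\<close> has colength at most one: a chain above
  \<open>I\<close> can only jump when it leaves \<open>I\<close>.
\<close>

lemma (in gabriel_filter) finite_length_filter_proper:
  assumes noeth: "left_noetherian R" and I: "left_ideal R I" "I \<notin> F"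
  shows "finite_length_filter R F \<noteq> F"
proof -
  interpret reg: left_module R "regular_module R"
    by (rule left_module_regular) (rule R.ring_axioms)
  have "{I. left_ideal R I \<and> I \<notin> F} \<noteq> {}"
    using I by blast
  then obtain I where I: "left_ideal R I" "I \<notin> F"
    and max: "\<And>J. left_ideal R J \<Longrightarrow> J \<notin> F \<Longrightarrow> I \<subseteq> J \<Longrightarrow> J = I"
    using left_noetherian_maximal[OF noeth, of "{I. left_ideal R I \<and> I \<notin> F}"] by blast
  have "finite (jumps R (regular_module R) F A) \<and> card (jumps R (regular_module R) F A) \<le> 1"
    if A: "submodule_chain R (regular_module R) I (carrier R) A" for A
  proof -
    have Ai: "\<And>i. left_ideal R (A i)" and AB: "\<And>i. I \<subseteq> A i" "\<And>i. A i \<subseteq> A (Suc i)"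
      using submodule_chainD[OF A] by blast+
    have jump: "A i = I \<and> A (Suc i) \<noteq> I" if i: "i \<in> jumps R (regular_module R) F A" for i
    proof -
      obtain z where z: "z \<in> A (Suc i)" "colon R (regular_module R) (A i) z \<notin> F"
        using i unfolding jumps_def by blast
      have zR: "z \<in> carrier R"
        using reg.submoduleD(1)[OF Ai z(1)] by simp
      have "A i \<notin> F"
        using colon_mem[OF _ zR] z(2) by blast
      then have "A i = I"
        using max[OF Ai _ AB(1)] by blast
      moreover have "z \<notin> A i"
        using reg.colon_self[OF Ai, of z i] z(2) carrier_mem by auto
      ultimately show ?thesis
        using z(1) by blast
    qed
    have "i = j" if ij: "i \<in> jumps R (regular_module R) F A" "j \<in> jumps R (regular_module R) F A" "i \<le> j" for i j
    proof (rule ccontr)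
      assume "i \<noteq> j"
      then have "A (Suc i) \<subseteq> A j"
        using ij(3) by (intro lift_Suc_mono_le[of A, OF AB(2)]) simp
      then show False
        using jump[OF ij(1)] jump[OF ij(2)] AB(1)[of "Suc i"] by blast
    qed
    then have "i = j" if "i \<in> jumps R (regular_module R) F A" "j \<in> jumps R (regular_module R) F A" for i j
      using that nat_le_linear by metis
    then obtain i where i: "jumps R (regular_module R) F A \<subseteq> {i}"
      by blast
    show ?thesis
      using finite_subset[OF i] card_mono[OF _ i] by simp
  qed
  then have "I \<in> finite_length_filter R F"
    unfolding finite_length_filter_def length_le_def using I(1) by blast
  then show ?thesis
    using I(2) by blast
qed

subsection \<open>Filters that are invariant under ring automorphisms\<close>

definition filter_invariant :: "('r, 'a) ring_scheme \<Rightarrow> 'r set set \<Rightarrow> ('r \<Rightarrow> 'r) \<Rightarrow> bool" where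
  "filter_invariant R F s \<longleftrightarrow> (\<forall>I. left_ideal R I \<longrightarrow> (s ` I \<in> F \<longleftrightarrow> I \<in> F))"

lemma ring_iso_left_ideal:
  assumes R: "ring R" and s: "s \<in> ring_iso R R" and I: "left_ideal R I"
  shows "left_ideal R (s ` I)" "left_ideal R {r \<in> carrier R. s r \<in> I}"
proof -
  interpret R: ring R by fact
  interpret reg: left_module R "regular_module R"
    by (rule left_module_regular) (rule R.ring_axioms)
  have h: "s \<in> ring_hom R R" and bij: "bij_betw s (carrier R) (carrier R)"
    using s unfolding ring_iso_def by auto
  interpret s: ring_hom_ring R R s
    by (rule ring_hom_ringI2[OF R R h])
  note D = reg.submoduleD[OF I, unfolded regular_module_simps]
  show "left_ideal R (s ` I)"
    unfolding reg.left_ideal_iff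
  proof (intro conjI ballI)
    show "s ` I \<subseteq> carrier R"
      using D(1) s.hom_closed by blast
    show "\<zero>\<^bsub>R\<^esub> \<in> s ` I"
      using D(2) s.hom_zero by (metis imageI)
    fix x y assume "x \<in> s ` I" "y \<in> s ` I"
    then obtain a b where ab: "a \<in> I" "b \<in> I" "x = s a" "y = s b"
      by blast
    then have "x \<oplus>\<^bsub>R\<^esub> y = s (a \<oplus>\<^bsub>R\<^esub> b)"
      using D(1) by simp
    then show "x \<oplus>\<^bsub>R\<^esub> y \<in> s ` I"
      using ab D(3) by blast
  next
    fix a x assume "a \<in> carrier R" "x \<in> s ` I"
    moreover have "s ` carrier R = carrier R"
      using bij by (rule bij_betw_imp_surj_on)
    ultimately obtain b c where bc: "b \<in> carrier R" "s b = a" "c \<in> I" "x = s c"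
      by (metis imageE)
    moreover have "c \<in> carrier R"
      by (rule D(1)[OF bc(3)])
    ultimately have "a \<otimes>\<^bsub>R\<^esub> x = s (b \<otimes>\<^bsub>R\<^esub> c)"
      by simp
    then show "a \<otimes>\<^bsub>R\<^esub> x \<in> s ` I"
      using bc D(4) by blast
  qed
  show "left_ideal R {r \<in> carrier R. s r \<in> I}"
    using reg.submodule_carrier
    by (intro reg.submodule_vimage[OF _ reg.left_module_axioms I, of "carrier R" s s]) simp_all
qed

lemma length_le_ring_iso:
  assumes R: "ring R" and s: "s \<in> ring_iso R R" and inv: "filter_invariant R F s"
    and I: "left_ideal R I"
    and n: "length_le R (regular_module R) F I (carrier R) n"
  shows "length_le R (regular_module R) F (s ` I) (carrier R) n"
proof (rule length_leI_transfer[OF n, of _ _ _ _ "\<lambda>A i. {r \<in> carrier R. s r \<in> A i}"])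
  interpret R: ring R by fact
  interpret reg: left_module R "regular_module R"
    by (rule left_module_regular) (rule R.ring_axioms)
  have h: "s \<in> ring_hom R R" and bij: "bij_betw s (carrier R) (carrier R)"
    using s unfolding ring_iso_def by auto
  interpret s: ring_hom_ring R R s
    by (rule ring_hom_ringI2[OF R R h])
  fix A assume "submodule_chain R (regular_module R) (s ` I) (carrier R) A"
  then have Ai: "\<And>i. left_ideal R (A i)"
    and AB: "\<And>i. s ` I \<subseteq> A i" "\<And>i. A i \<subseteq> carrier R" "\<And>i. A i \<subseteq> A (Suc i)"
    unfolding submodule_chain_def by simp_all
  let ?A = "\<lambda>i. {r \<in> carrier R. s r \<in> A i}"
  have "I \<subseteq> ?A i" for i
    using AB(1) reg.submoduleD(1)[OF I] by auto
  then have "submodule_chain R (regular_module R) I (carrier R) ?A"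
    unfolding submodule_chain_def using ring_iso_left_ideal(2)[OF R s Ai] AB(3) by blast
  moreover have "jumps R (regular_module R) F A \<subseteq> jumps R (regular_module R) F ?A"
  proof
    fix i assume "i \<in> jumps R (regular_module R) F A"
    then obtain z where z: "z \<in> A (Suc i)" "colon R (regular_module R) (A i) z \<notin> F"
      unfolding jumps_def by blast
    then obtain w where w: "w \<in> carrier R" "z = s w"
      using AB(2) bij unfolding bij_betw_def by blast
    have id: "left_ideal R (colon R (regular_module R) (?A i) w)"
      using reg.colon_left_ideal[OF ring_iso_left_ideal(2)[OF R s Ai]] w(1) by simp
    have "s ` colon R (regular_module R) (?A i) w = colon R (regular_module R) (A i) z"
    proof
      show "s ` colon R (regular_module R) (?A i) w \<subseteq> colon R (regular_module R) (A i) z"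
        using w by (auto simp: colon_def s.hom_mult)
      show "colon R (regular_module R) (A i) z \<subseteq> s ` colon R (regular_module R) (?A i) w"
      proof
        fix r assume r: "r \<in> colon R (regular_module R) (A i) z"
        then obtain q where "q \<in> carrier R" "r = s q"
          using bij unfolding bij_betw_def colon_def by blast
        then show "r \<in> s ` colon R (regular_module R) (?A i) w"
          using r w by (auto simp: colon_def s.hom_mult)
      qed
    qed
    then have "colon R (regular_module R) (?A i) w \<notin> F"
      using inv id z(2) unfolding filter_invariant_def by metis
    moreover have "w \<in> ?A (Suc i)"
      using w z by simp
    ultimately show "i \<in> jumps R (regular_module R) F ?A"
      unfolding jumps_def by blast
  qed
  ultimately show "submodule_chain R (regular_module R) I (carrier R) ?A \<and>
      jumps R (regular_module R) F A \<subseteq> jumps R (regular_module R) F ?A" ..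
qed

lemma filter_invariant_finite_length_filter:
  assumes R: "ring R" and s: "s \<in> ring_iso R R" and inv: "filter_invariant R F s"
  shows "filter_invariant R (finite_length_filter R F) s"
  unfolding filter_invariant_def
proof (intro allI impI iffI)
  interpret R: ring R by fact
  fix I assume I: "left_ideal R I"
  note sI = ring_iso_left_ideal(1)[OF R s I]
  {
    assume "I \<in> finite_length_filter R F"
    then show "s ` I \<in> finite_length_filter R F"
      unfolding finite_length_filter_def using length_le_ring_iso[OF R s inv I] sI by blast
  }
  let ?t = "inv_into (carrier R) s"
  have bij: "bij_betw s (carrier R) (carrier R)"
    using s unfolding ring_iso_def by auto
  have t: "?t \<in> ring_iso R R"
    using ring_iso_set_sym[OF R s] .
  have sub: "J \<subseteq> carrier R" if "left_ideal R J" for J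
    using left_module.submoduleD(1)[OF left_module_regular[OF R] that] by auto
  have "filter_invariant R F ?t"
    unfolding filter_invariant_def
  proof (intro allI impI)
    fix J assume J: "left_ideal R J"
    have "s ` ?t ` J = J"
      using sub[OF J] bij by (simp add: bij_betw_def image_inv_into_cancel)
    then show "?t ` J \<in> F \<longleftrightarrow> J \<in> F"
      using inv ring_iso_left_ideal(1)[OF R t J] unfolding filter_invariant_def by metis
  qed
  then have "length_le R (regular_module R) F (?t ` s ` I) (carrier R) n"
    if "length_le R (regular_module R) F (s ` I) (carrier R) n" for n
    using length_le_ring_iso[OF R t _ sI] that by blast
  moreover have "?t ` s ` I = I"
    using sub[OF I] bij by (auto simp: bij_betw_def inv_into_image_cancel)
  moreover assume "s ` I \<in> finite_length_filter R F"
  ultimately show "I \<in> finite_length_filter R F"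
    unfolding finite_length_filter_def using I by auto
qed

section \<open>Folner sets\<close>

text \<open>
  The factor 2 stands for any bound that does not depend on \<open>D\<close>: the length estimate compares it with a
  quantity that can be made arbitrarily large by enlarging \<open>D\<close>.
\<close>

definition has_folner_sets :: "('g, 'b) monoid_scheme \<Rightarrow> bool" where
  "has_folner_sets G \<longleftrightarrow> (\<forall>D. finite D \<longrightarrow> D \<subseteq> carrier G \<longrightarrow>
     (\<exists>F. finite F \<and> F \<noteq> {} \<and> F \<subseteq> carrier G \<and> card (F <#>\<^bsub>G\<^esub> D) \<le> 2 * card F))"

lemma eventually_tails:
  assumes "directed_set I leq"
  shows "eventually P (tails I leq) \<longleftrightarrow> (\<exists>i\<in>I. \<forall>j\<in>I. leq i j \<longrightarrow> P j)"
  unfolding tails_def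
proof (subst eventually_INF_base)
  have trans: "\<And>i j k. i \<in> I \<Longrightarrow> j \<in> I \<Longrightarrow> k \<in> I \<Longrightarrow> leq i j \<Longrightarrow> leq j k \<Longrightarrow> leq i k"
    and dir: "\<And>i j. i \<in> I \<Longrightarrow> j \<in> I \<Longrightarrow> \<exists>k\<in>I. leq i k \<and> leq j k"
    using assms unfolding directed_set_def by blast+
  show "I \<noteq> {}"
    using assms unfolding directed_set_def by blast
  fix i j assume ij: "i \<in> I" "j \<in> I"
  then obtain k where k: "k \<in> I" "leq i k" "leq j k"
    using dir by blast
  then have "{l \<in> I. leq k l} \<subseteq> {l \<in> I. leq i l} \<inter> {l \<in> I. leq j l}"
    using trans[OF ij(1) k(1)] trans[OF ij(2) k(1)] by blast
  then show "\<exists>x\<in>I. principal {l \<in> I. leq x l} \<le> inf (principal {l \<in> I. leq i l}) (principal {l \<in> I. leq j l})"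
    using k(1) by auto
qed (auto simp: eventually_principal)

text \<open>
  With \<open>C = D\<^sup>-\<^sup>1 \<union> {1}\<close>, a point of \<open>FD\<close> outside \<open>F\<close> lies in the \<open>C\<close>-boundary of \<open>F\<close>, so a boundary of
  size at most \<open>|F|\<close> suffices.
\<close>

lemma amenable_has_folner_sets:
  assumes "amenable TYPE('i) G"
  shows "has_folner_sets G"
  unfolding has_folner_sets_def
proof (intro allI impI)
  interpret group G
    using assms unfolding amenable_def by blast
  obtain I :: "'i set" and leq F where net: "directed_set I leq \<and>
      (\<forall>i\<in>I. finite (F i) \<and> F i \<noteq> {} \<and> F i \<subseteq> carrier G) \<and>
      (\<forall>C. finite C \<and> C \<subseteq> carrier G \<longrightarrow>
         ((\<lambda>i. real (card (boundary G C (F i))) / real (card (F i))) \<longlongrightarrow> 0) (tails I leq))"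
    using assms[unfolded amenable_def, THEN conjunct2] by (elim exE)
  then have dir: "directed_set I leq"
    by (elim conjE)
  have F: "finite (F i) \<and> F i \<noteq> {} \<and> F i \<subseteq> carrier G" if "i \<in> I" for i
    using net that by simp
  have lim: "((\<lambda>i. real (card (boundary G C (F i))) / real (card (F i))) \<longlongrightarrow> 0) (tails I leq)"
    if "finite C" "C \<subseteq> carrier G" for C
    using net that by simp
  fix D assume D: "finite D" "D \<subseteq> carrier G"
  define C where "C = insert \<one>\<^bsub>G\<^esub> (m_inv G ` D)"
  have C: "finite C" "C \<subseteq> carrier G"
    using D by (auto simp: C_def)
  have "eventually (\<lambda>i. real (card (boundary G C (F i))) / real (card (F i)) < 1) (tails I leq)"
    by (rule order_tendstoD(2)[OF lim[OF C]]) simp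
  then obtain i where i: "i \<in> I" and lt: "real (card (boundary G C (F i))) / real (card (F i)) < 1"
    using dir unfolding eventually_tails[OF dir] directed_set_def by blast
  have Fi: "finite (F i)" "F i \<noteq> {}" "F i \<subseteq> carrier G"
    using F[OF i] by auto
  have le: "card (boundary G C (F i)) \<le> card (F i)"
    using lt Fi by (simp add: divide_less_eq card_gt_0_iff split: if_splits)
  have FD: "F i <#>\<^bsub>G\<^esub> D \<subseteq> F i \<union> boundary G C (F i)"
  proof
    fix x assume "x \<in> F i <#>\<^bsub>G\<^esub> D"
    then obtain f d where fd: "f \<in> F i" "d \<in> D" "x = f \<otimes>\<^bsub>G\<^esub> d"
      unfolding set_mult_def by blast
    have c: "f \<in> carrier G" "d \<in> carrier G" "x \<in> carrier G"
      using fd Fi(3) D(2) by auto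
    have "f = x \<otimes>\<^bsub>G\<^esub> inv\<^bsub>G\<^esub> d"
      using c fd(3) by (simp add: m_assoc)
    then have "f \<in> x <#\<^bsub>G\<^esub> C"
      using fd(2) unfolding l_coset_def C_def by blast
    then have "(x <#\<^bsub>G\<^esub> C) \<inter> F i \<noteq> {}"
      using fd(1) by blast
    moreover have "x \<in> x <#\<^bsub>G\<^esub> C"
      using c(3) unfolding l_coset_def C_def by force
    ultimately show "x \<in> F i \<union> boundary G C (F i)"
      using c(3) unfolding boundary_def by blast
  qed
  have "finite (boundary G C (F i))"
  proof (rule finite_subset)
    show "boundary G C (F i) \<subseteq> (\<lambda>(f, c). f \<otimes>\<^bsub>G\<^esub> inv\<^bsub>G\<^esub> c) ` (F i \<times> C)"
    proof
      fix x assume "x \<in> boundary G C (F i)"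
      then obtain c where x: "x \<in> carrier G" "c \<in> C" "x \<otimes>\<^bsub>G\<^esub> c \<in> F i"
        unfolding boundary_def l_coset_def by blast
      moreover have "c \<in> carrier G"
        using x(2) C(2) by blast
      ultimately have "x = (x \<otimes>\<^bsub>G\<^esub> c) \<otimes>\<^bsub>G\<^esub> inv\<^bsub>G\<^esub> c"
        by (simp add: m_assoc)
      then show "x \<in> (\<lambda>(f, c). f \<otimes>\<^bsub>G\<^esub> inv\<^bsub>G\<^esub> c) ` (F i \<times> C)"
        using x by (intro image_eqI[of _ _ "(x \<otimes>\<^bsub>G\<^esub> c, c)"]) auto
    qed
  qed (use Fi(1) C(1) in auto)
  then have "card (F i <#>\<^bsub>G\<^esub> D) \<le> card (F i \<union> boundary G C (F i))"
    using FD Fi(1) by (intro card_mono) auto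
  also have "\<dots> \<le> 2 * card (F i)"
    using card_Un_le[of "F i" "boundary G C (F i)"] le by linarith
  finally show "\<exists>F. finite F \<and> F \<noteq> {} \<and> F \<subseteq> carrier G \<and> card (F <#>\<^bsub>G\<^esub> D) \<le> 2 * card F"
    using Fi by blast
qed

text \<open>
  In a maximal family \<open>P\<close> of disjoint translates, every \<open>gC\<close> with \<open>g \<in> F\<close> meets some \<open>hC\<close> with \<open>h \<in> P\<close>.
  Therefore \<open>F \<subseteq> P C C\<^sup>-\<^sup>1\<close>.
\<close>

lemma (in group) disjoint_translates:
  assumes F: "finite F" "F \<subseteq> carrier G" and C: "finite C" "C \<subseteq> carrier G" "C \<noteq> {}"
  shows "\<exists>P\<subseteq>F. (\<forall>g\<in>P. \<forall>h\<in>P. g \<noteq> h \<longrightarrow> (g <# C) \<inter> (h <# C) = {}) \<and>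
    card F \<le> card P * (card C * card C)"
proof -
  define D where "D = {P. P \<subseteq> F \<and> (\<forall>g\<in>P. \<forall>h\<in>P. g \<noteq> h \<longrightarrow> (g <# C) \<inter> (h <# C) = {})}"
  have "finite D"
    using F(1) by (auto simp: D_def)
  moreover have "D \<noteq> {}"
    unfolding D_def by blast
  ultimately obtain P where P: "P \<in> D" and max: "\<And>Q. Q \<in> D \<Longrightarrow> P \<subseteq> Q \<Longrightarrow> P = Q"
    using finite_has_maximal[of D] by metis
  have PF: "P \<subseteq> F" and disj: "\<And>g h. g \<in> P \<Longrightarrow> h \<in> P \<Longrightarrow> g \<noteq> h \<Longrightarrow> (g <# C) \<inter> (h <# C) = {}"
    using P unfolding D_def by blast+
  have finP: "finite P"
    using PF F(1) by (rule finite_subset)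
  have meets: "\<exists>h\<in>P. (g <# C) \<inter> (h <# C) \<noteq> {}" if g: "g \<in> F" for g
  proof (rule ccontr)
    assume no: "\<not> ?thesis"
    have "insert g P \<in> D"
      unfolding D_def using PF disj no g by (auto simp: Int_commute)
    then have "g \<in> P"
      using max[of "insert g P"] by blast
    moreover have "g <# C \<noteq> {}"
      using C(3) unfolding l_coset_def by blast
    ultimately show False
      using no by blast
  qed
  have "F \<subseteq> (\<lambda>(h, x, y). h \<otimes> x \<otimes> inv y) ` (P \<times> C \<times> C)"
  proof
    fix g assume g: "g \<in> F"
    then obtain h x y where h: "h \<in> P" "x \<in> C" "y \<in> C" "g \<otimes> y = h \<otimes> x"
      using meets[OF g] unfolding l_coset_def by blast
    have "g \<in> carrier G" "y \<in> carrier G"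
      using g h F(2) C(2) by auto
    then have "g = h \<otimes> x \<otimes> inv y"
      using h(4) by (metis inv_closed inv_solve_right m_closed)
    then show "g \<in> (\<lambda>(h, x, y). h \<otimes> x \<otimes> inv y) ` (P \<times> C \<times> C)"
      using h(1-3) by force
  qed
  then have "card F \<le> card ((\<lambda>(h, x, y). h \<otimes> x \<otimes> inv y) ` (P \<times> C \<times> C))"
    using finP C(1) by (intro card_mono) auto
  also have "\<dots> \<le> card (P \<times> C \<times> C)"
    using finP C(1) by (intro card_image_le) auto
  finally have "card F \<le> card P * (card C * card C)"
    by (simp add: card_cartesian_product)
  with PF disj show ?thesis
    by blast
qed

section \<open>Twisted graded modules\<close>

text \<open>
  The picture is that of a direct sum \<open>V\<close> of submodules \<open>V\<^sub>g\<close>, where \<open>\<gamma> g\<close> carries \<open>V\<^sub>h\<close> onto \<open>V\<^sub>g\<^sub>h\<close>. The coordinate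
  \<open>c g v\<close> is the component of \<open>v\<close> in \<open>V\<^sub>g\<close>, moved back to the finitely generated summand at the identity by
  the inverse of \<open>\<gamma> g\<close>; the component itself is \<open>\<gamma> g (c g v)\<close>. Over a crossed product, \<open>c (gh) (\<gamma> g v)\<close> and
  \<open>c h v\<close> differ by a unit coming from the cocycle \<open>\<rho>\<close>; the last axiom records that they vanish together.
\<close>

locale twisted_graded_module = left_module R V + G: group G
  for R :: "('r, 'a) ring_scheme" (structure) and V :: "('r, 'v, 'c) module_scheme" (structure)
    and G :: "('g, 'b) monoid_scheme" (structure) +
  fixes \<sigma> :: "'g \<Rightarrow> 'r \<Rightarrow> 'r" and \<gamma> :: "'g \<Rightarrow> 'v \<Rightarrow> 'v" and c :: "'g \<Rightarrow> 'v \<Rightarrow> 'v" and B :: "'v set"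
  assumes aut: "g \<in> carrier G \<Longrightarrow> \<sigma> g \<in> ring_iso R R"
    and gamma_closed: "g \<in> carrier G \<Longrightarrow> v \<in> carrier V \<Longrightarrow> \<gamma> g v \<in> carrier V"
    and gamma_add: "g \<in> carrier G \<Longrightarrow> v \<in> carrier V \<Longrightarrow> w \<in> carrier V \<Longrightarrow>
      \<gamma> g (v \<oplus>\<^bsub>V\<^esub> w) = \<gamma> g v \<oplus>\<^bsub>V\<^esub> \<gamma> g w"
    and gamma_smult: "g \<in> carrier G \<Longrightarrow> r \<in> carrier R \<Longrightarrow> v \<in> carrier V \<Longrightarrow>
      \<gamma> g (r \<odot>\<^bsub>V\<^esub> v) = \<sigma> g r \<odot>\<^bsub>V\<^esub> \<gamma> g v"
    and coord_closed: "g \<in> carrier G \<Longrightarrow> v \<in> carrier V \<Longrightarrow> c g v \<in> carrier V"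
    and coord_add: "g \<in> carrier G \<Longrightarrow> v \<in> carrier V \<Longrightarrow> w \<in> carrier V \<Longrightarrow>
      c g (v \<oplus>\<^bsub>V\<^esub> w) = c g v \<oplus>\<^bsub>V\<^esub> c g w"
    and coord_smult: "g \<in> carrier G \<Longrightarrow> r \<in> carrier R \<Longrightarrow> v \<in> carrier V \<Longrightarrow>
      c g (\<sigma> g r \<odot>\<^bsub>V\<^esub> v) = r \<odot>\<^bsub>V\<^esub> c g v"
    and base_finite: "finite B" and base_closed: "B \<subseteq> carrier V"
    and coord_base: "g \<in> carrier G \<Longrightarrow> v \<in> carrier V \<Longrightarrow> c g v \<in> submodule_span R V B"
    and coord_finite: "v \<in> carrier V \<Longrightarrow> finite {g \<in> carrier G. c g v \<noteq> \<zero>\<^bsub>V\<^esub>}"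
    and coord_expansion: "v \<in> carrier V \<Longrightarrow> finite E \<Longrightarrow> E \<subseteq> carrier G \<Longrightarrow>
      {g \<in> carrier G. c g v \<noteq> \<zero>\<^bsub>V\<^esub>} \<subseteq> E \<Longrightarrow> v = (\<Oplus>\<^bsub>V\<^esub>g\<in>E. \<gamma> g (c g v))"
    and coord_gamma: "g \<in> carrier G \<Longrightarrow> h \<in> carrier G \<Longrightarrow> v \<in> carrier V \<Longrightarrow>
      c (g \<otimes>\<^bsub>G\<^esub> h) (\<gamma> g v) = \<zero>\<^bsub>V\<^esub> \<longleftrightarrow> c h v = \<zero>\<^bsub>V\<^esub>"
begin

definition gsupp :: "'v \<Rightarrow> 'g set" where
  "gsupp v = {g \<in> carrier G. c g v \<noteq> \<zero>\<^bsub>V\<^esub>}"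

definition equivariant_surjection :: "'v set \<Rightarrow> ('v \<Rightarrow> 'v) \<Rightarrow> bool" where
  "equivariant_surjection W \<phi> \<longleftrightarrow> submodule W R V \<and> (\<forall>g\<in>carrier G. \<forall>v\<in>W. \<gamma> g v \<in> W) \<and>
     \<phi> ` W = W \<and> (\<forall>v\<in>W. \<forall>w\<in>W. \<phi> (v \<oplus>\<^bsub>V\<^esub> w) = \<phi> v \<oplus>\<^bsub>V\<^esub> \<phi> w) \<and>
     (\<forall>r\<in>carrier R. \<forall>v\<in>W. \<phi> (r \<odot>\<^bsub>V\<^esub> v) = r \<odot>\<^bsub>V\<^esub> \<phi> v) \<and>
     (\<forall>g\<in>carrier G. \<forall>v\<in>W. \<phi> (\<gamma> g v) = \<gamma> g (\<phi> v))"

lemma sigma_hom: "g \<in> carrier G \<Longrightarrow> ring_hom_ring R R (\<sigma> g)"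
  using aut by (intro ring_hom_ringI2) (auto simp: ring_iso_def R.ring_axioms)

lemma sigma_image: "g \<in> carrier G \<Longrightarrow> \<sigma> g ` carrier R = carrier R"
  using aut by (auto simp: ring_iso_def bij_betw_def)

lemma gamma_zero [simp]:
  assumes "g \<in> carrier G"
  shows "\<gamma> g \<zero>\<^bsub>V\<^esub> = \<zero>\<^bsub>V\<^esub>"
proof -
  have "\<gamma> g \<zero>\<^bsub>V\<^esub> \<oplus>\<^bsub>V\<^esub> \<gamma> g \<zero>\<^bsub>V\<^esub> = \<gamma> g \<zero>\<^bsub>V\<^esub>"
    using gamma_add[of g "\<zero>\<^bsub>V\<^esub>" "\<zero>\<^bsub>V\<^esub>"] assms by simp
  then show ?thesis
    using gamma_closed[OF assms M.zero_closed] by (metis M.add.r_cancel_one')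
qed

lemma coord_zero [simp]:
  assumes "g \<in> carrier G"
  shows "c g \<zero>\<^bsub>V\<^esub> = \<zero>\<^bsub>V\<^esub>"
proof -
  have "c g \<zero>\<^bsub>V\<^esub> \<oplus>\<^bsub>V\<^esub> c g \<zero>\<^bsub>V\<^esub> = c g \<zero>\<^bsub>V\<^esub>"
    using coord_add[of g "\<zero>\<^bsub>V\<^esub>" "\<zero>\<^bsub>V\<^esub>"] assms by simp
  then show ?thesis
    using coord_closed[OF assms M.zero_closed] by (metis M.add.r_cancel_one')
qed

lemma gsupp_zero [simp]: "gsupp \<zero>\<^bsub>V\<^esub> = {}"
  by (auto simp: gsupp_def)

lemma gsupp_finite: "v \<in> carrier V \<Longrightarrow> finite (gsupp v)"
  unfolding gsupp_def by (rule coord_finite)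

lemma gsupp_carrier: "gsupp v \<subseteq> carrier G"
  by (auto simp: gsupp_def)

lemma gsupp_empty:
  assumes "v \<in> carrier V" "gsupp v = {}"
  shows "v = \<zero>\<^bsub>V\<^esub>"
  using coord_expansion[of v "{}"] assms by (simp add: gsupp_def)

lemma gsupp_add:
  assumes "v \<in> carrier V" "w \<in> carrier V"
  shows "gsupp (v \<oplus>\<^bsub>V\<^esub> w) \<subseteq> gsupp v \<union> gsupp w"
  using assms by (auto simp: gsupp_def coord_add)

lemma gsupp_smult:
  assumes "r \<in> carrier R" "v \<in> carrier V"
  shows "gsupp (r \<odot>\<^bsub>V\<^esub> v) \<subseteq> gsupp v"
proof -
  have "c g (r \<odot>\<^bsub>V\<^esub> v) = \<zero>\<^bsub>V\<^esub>" if g: "g \<in> carrier G" and z: "c g v = \<zero>\<^bsub>V\<^esub>" for g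
  proof -
    obtain s where "s \<in> carrier R" "r = \<sigma> g s"
      using sigma_image[OF g] assms(1) by blast
    then show ?thesis
      using coord_smult[OF g _ assms(2), of s] z by simp
  qed
  then show ?thesis
    by (auto simp: gsupp_def)
qed

lemma gsupp_gamma:
  assumes g: "g \<in> carrier G" and v: "v \<in> carrier V"
  shows "gsupp (\<gamma> g v) \<subseteq> g <#\<^bsub>G\<^esub> gsupp v"
proof
  fix k assume "k \<in> gsupp (\<gamma> g v)"
  then have k: "k \<in> carrier G" "c k (\<gamma> g v) \<noteq> \<zero>\<^bsub>V\<^esub>"
    by (auto simp: gsupp_def)
  let ?h = "inv\<^bsub>G\<^esub> g \<otimes>\<^bsub>G\<^esub> k"
  have h: "?h \<in> carrier G" and eq: "g \<otimes>\<^bsub>G\<^esub> ?h = k"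
    using g k(1) by (simp_all add: G.m_assoc[symmetric])
  then have "?h \<in> gsupp v"
    using coord_gamma[OF g h v] k(2) by (simp add: gsupp_def)
  then show "k \<in> g <#\<^bsub>G\<^esub> gsupp v"
    using eq unfolding l_coset_def by force
qed

lemma gamma_eq_zero:
  assumes g: "g \<in> carrier G" and v: "v \<in> carrier V" and z: "\<gamma> g v = \<zero>\<^bsub>V\<^esub>"
  shows "v = \<zero>\<^bsub>V\<^esub>"
proof (rule gsupp_empty[OF v])
  have "c h v = \<zero>\<^bsub>V\<^esub>" if "h \<in> carrier G" for h
    using coord_gamma[OF g that v] z g that by simp
  then show "gsupp v = {}"
    by (auto simp: gsupp_def)
qed

lemma annihilator_gamma:
  assumes g: "g \<in> carrier G" and v: "v \<in> carrier V"
  shows "annihilator R V (\<gamma> g v) = \<sigma> g ` annihilator R V v"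
proof
  interpret s: ring_hom_ring R R "\<sigma> g"
    by (rule sigma_hom[OF g])
  show "\<sigma> g ` annihilator R V v \<subseteq> annihilator R V (\<gamma> g v)"
  proof
    fix r assume "r \<in> \<sigma> g ` annihilator R V v"
    then obtain s where s: "s \<in> carrier R" "s \<odot>\<^bsub>V\<^esub> v = \<zero>\<^bsub>V\<^esub>" "r = \<sigma> g s"
      unfolding colon_def by blast
    then have "r \<odot>\<^bsub>V\<^esub> \<gamma> g v = \<zero>\<^bsub>V\<^esub>"
      using gamma_smult[OF g s(1) v] g by simp
    then show "r \<in> annihilator R V (\<gamma> g v)"
      using s unfolding colon_def by simp
  qed
  show "annihilator R V (\<gamma> g v) \<subseteq> \<sigma> g ` annihilator R V v"
  proof
    fix r assume "r \<in> annihilator R V (\<gamma> g v)"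
    then have r: "r \<in> carrier R" "r \<odot>\<^bsub>V\<^esub> \<gamma> g v = \<zero>\<^bsub>V\<^esub>"
      unfolding colon_def by auto
    then obtain s where s: "s \<in> carrier R" "r = \<sigma> g s"
      using sigma_image[OF g] by blast
    then have "\<gamma> g (s \<odot>\<^bsub>V\<^esub> v) = \<zero>\<^bsub>V\<^esub>"
      using gamma_smult[OF g s(1) v] r(2) by simp
    then have "s \<odot>\<^bsub>V\<^esub> v = \<zero>\<^bsub>V\<^esub>"
      using gamma_eq_zero[OF g] s(1) v by simp
    then show "r \<in> \<sigma> g ` annihilator R V v"
      using s unfolding colon_def by simp
  qed
qed

lemma gamma_torsion:
  assumes inv: "filter_invariant R F (\<sigma> g)" and g: "g \<in> carrier G" and v: "v \<in> carrier V"
  shows "\<gamma> g v \<in> torsion R V F \<longleftrightarrow> v \<in> torsion R V F"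
  using inv colon_left_ideal[OF submodule_zero v] annihilator_gamma[OF g v] gamma_closed[OF g v] v
  unfolding filter_invariant_def torsion_def by simp

text \<open>
  The \<open>F\<close>-torsion of the whole module is generated by the translates of a finite set: its coordinates
  are torsion elements of the finitely generated module spanned by \<open>B\<close>.
\<close>

lemma torsion_generators:
  assumes noeth: "left_noetherian R" and gf: "gabriel_filter R F"
    and inv: "\<And>g. g \<in> carrier G \<Longrightarrow> filter_invariant R F (\<sigma> g)"
  obtains A where "finite A" "A \<subseteq> torsion R V F"
    "\<And>v E. v \<in> torsion R V F \<Longrightarrow> finite E \<Longrightarrow> E \<subseteq> carrier G \<Longrightarrow> gsupp v \<subseteq> E \<Longrightarrow>
      v \<in> submodule_span R V ((\<lambda>(g, a). \<gamma> g a) ` (E \<times> A))"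
proof -
  interpret gabriel_filter R F by fact
  note T = torsion_submodule[OF gf]
  note sB = submodule_span_submodule[OF base_closed]
  obtain A where A: "finite A" "A \<subseteq> carrier V" "torsion R V F \<inter> submodule_span R V B = submodule_span R V A"
    using noetherian_submodule_fin_gen[OF noeth base_finite base_closed submodule_inter[OF T sB]] by blast
  have AT: "A \<subseteq> torsion R V F"
    using submodule_span_superset[of A] A(3) by blast
  show thesis
  proof (rule that[OF A(1) AT])
    fix v E assume v: "v \<in> torsion R V F" and E: "finite E" "E \<subseteq> carrier G" "gsupp v \<subseteq> E"
    have vV: "v \<in> carrier V"
      using v by (simp add: torsion_def)
    let ?S = "submodule_span R V ((\<lambda>(g, a). \<gamma> g a) ` (E \<times> A))"
    have "(\<lambda>(g, a). \<gamma> g a) ` (E \<times> A) \<subseteq> carrier V"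
      using E(2) A(2) gamma_closed by auto
    note S = submodule_span_submodule[OF this]
    have "\<gamma> g (c g v) \<in> ?S" if gE: "g \<in> E" for g
    proof -
      have g: "g \<in> carrier G"
        using gE E(2) by blast
      note cV = coord_closed[OF g vV]
      interpret s: ring_hom_ring R R "\<sigma> g"
        by (rule sigma_hom[OF g])
      note ann = colon_left_ideal[OF submodule_zero cV]
      have "annihilator R V v \<subseteq> \<sigma> g ` annihilator R V (c g v)"
      proof
        fix r assume "r \<in> annihilator R V v"
        then have r: "r \<in> carrier R" "r \<odot>\<^bsub>V\<^esub> v = \<zero>\<^bsub>V\<^esub>"
          unfolding colon_def by auto
        then obtain s where s: "s \<in> carrier R" "r = \<sigma> g s"
          using sigma_image[OF g] by blast
        then have "s \<odot>\<^bsub>V\<^esub> c g v = \<zero>\<^bsub>V\<^esub>"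
          using coord_smult[OF g s(1) vV] r(2) g by simp
        then show "r \<in> \<sigma> g ` annihilator R V (c g v)"
          using s unfolding colon_def by simp
      qed
      moreover have "annihilator R V v \<in> F"
        using v by (simp add: torsion_def)
      ultimately have "\<sigma> g ` annihilator R V (c g v) \<in> F"
        using upward ring_iso_left_ideal(1)[OF R.ring_axioms aut[OF g] ann] by blast
      then have "annihilator R V (c g v) \<in> F"
        using inv[OF g] ann unfolding filter_invariant_def by blast
      then have cA: "c g v \<in> submodule_span R V A"
        using coord_base[OF g vV] cV A(3) unfolding torsion_def by blast
      have "submodule {w \<in> carrier V. \<gamma> g w \<in> ?S} R V"
        using g gamma_closed gamma_add gamma_smult s.hom_closed
        by (intro submodule_vimage[OF submodule_carrier left_module_axioms S, of _ "\<sigma> g"]) simp_all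
      moreover have "A \<subseteq> {w \<in> carrier V. \<gamma> g w \<in> ?S}"
      proof
        fix a assume a: "a \<in> A"
        then have "(\<lambda>(g, a). \<gamma> g a) (g, a) \<in> (\<lambda>(g, a). \<gamma> g a) ` (E \<times> A)"
          using gE by (intro imageI) simp
        then show "a \<in> {w \<in> carrier V. \<gamma> g w \<in> ?S}"
          using a A(2) submodule_span_superset[of "(\<lambda>(g, a). \<gamma> g a) ` (E \<times> A)"] by auto
      qed
      ultimately show ?thesis
        using submodule_span_minimal cA by blast
    qed
    then have "(\<Oplus>\<^bsub>V\<^esub>g\<in>E. \<gamma> g (c g v)) \<in> ?S"
      by (intro submodule_finsum[OF S])
    then show "v \<in> ?S"
      using coord_expansion[OF vV E(1,2)] E(3) by (simp add: gsupp_def)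
  qed
qed

end

section \<open>Surjective equivariant endomorphisms\<close>

context twisted_graded_module
begin

lemma equivariant_surjectionD:
  assumes "equivariant_surjection W \<phi>"
  shows "submodule W R V" "g \<in> carrier G \<Longrightarrow> v \<in> W \<Longrightarrow> \<gamma> g v \<in> W" "\<phi> ` W = W"
    "v \<in> W \<Longrightarrow> w \<in> W \<Longrightarrow> \<phi> (v \<oplus>\<^bsub>V\<^esub> w) = \<phi> v \<oplus>\<^bsub>V\<^esub> \<phi> w"
    "r \<in> carrier R \<Longrightarrow> v \<in> W \<Longrightarrow> \<phi> (r \<odot>\<^bsub>V\<^esub> v) = r \<odot>\<^bsub>V\<^esub> \<phi> v"
    "g \<in> carrier G \<Longrightarrow> v \<in> W \<Longrightarrow> \<phi> (\<gamma> g v) = \<gamma> g (\<phi> v)"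
    "v \<in> W \<Longrightarrow> \<phi> v \<in> W" "\<phi> \<zero>\<^bsub>V\<^esub> = \<zero>\<^bsub>V\<^esub>"
proof -
  show W: "submodule W R V" and im: "\<phi> ` W = W"
    and "g \<in> carrier G \<Longrightarrow> v \<in> W \<Longrightarrow> \<gamma> g v \<in> W"
    and "v \<in> W \<Longrightarrow> w \<in> W \<Longrightarrow> \<phi> (v \<oplus>\<^bsub>V\<^esub> w) = \<phi> v \<oplus>\<^bsub>V\<^esub> \<phi> w"
    and "g \<in> carrier G \<Longrightarrow> v \<in> W \<Longrightarrow> \<phi> (\<gamma> g v) = \<gamma> g (\<phi> v)"
    and lin: "r \<in> carrier R \<Longrightarrow> v \<in> W \<Longrightarrow> \<phi> (r \<odot>\<^bsub>V\<^esub> v) = r \<odot>\<^bsub>V\<^esub> \<phi> v" for r v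
    using assms unfolding equivariant_surjection_def by simp_all
  show cl: "v \<in> W \<Longrightarrow> \<phi> v \<in> W" for v
    using im by blast
  have z: "\<zero>\<^bsub>V\<^esub> \<in> W"
    by (rule submoduleD(2)[OF W])
  have "\<phi> \<zero>\<^bsub>V\<^esub> \<in> carrier V"
    by (rule submoduleD(1)[OF W cl[OF z]])
  then show "\<phi> \<zero>\<^bsub>V\<^esub> = \<zero>\<^bsub>V\<^esub>"
    using lin[OF R.zero_closed z] by simp
qed

lemma equivariant_surjection_funpow:
  assumes es: "equivariant_surjection W \<phi>"
  shows "equivariant_surjection W (\<phi> ^^ k)"
proof (induction k)
  case 0
  then show ?case
    using es by (simp add: equivariant_surjection_def)
next
  case (Suc k)
  note D = equivariant_surjectionD[OF es] and E = equivariant_surjectionD[OF Suc.IH]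
  have "(\<phi> ^^ Suc k) ` W = W"
    unfolding funpow.simps image_comp[symmetric] E(3) D(3) ..
  then show ?case
    unfolding equivariant_surjection_def using D(1) by (simp add: D(2,4-6) E(4-7))
qed

definition supported :: "'g set \<Rightarrow> 'v set" where
  "supported E = {v \<in> carrier V. gsupp v \<subseteq> E}"

lemma supported_submodule: "submodule (supported E) R V"
proof (rule submoduleI)
  show "x \<oplus>\<^bsub>V\<^esub> y \<in> supported E" if "x \<in> supported E" "y \<in> supported E" for x y
    using that gsupp_add[of x y] unfolding supported_def by auto
  show "a \<odot>\<^bsub>V\<^esub> x \<in> supported E" if "a \<in> carrier R" "x \<in> supported E" for a x
    using that gsupp_smult[of a x] unfolding supported_def by auto
qed (auto simp: supported_def)

lemma submodule_preimage:
  assumes es: "equivariant_surjection W \<phi>" and N: "submodule N R V"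
  shows "submodule {v \<in> W. \<phi> v \<in> N} R V"
  using equivariant_surjectionD[OF es] submoduleD(1)[OF equivariant_surjectionD(1)[OF es]]
  by (intro submodule_vimage[OF _ left_module_axioms N, of _ _ "\<lambda>r. r"]) auto

text \<open>
  This is where amenability enters. A kernel element \<open>x\<close> that is not torsion is pulled back along \<open>\<phi>\<close>
  again and again. Disjoint translates of these preimages force a chain that is too long for the part of
  \<open>W\<close> supported on a Folner set.
\<close>

lemma kernel_torsion:
  assumes noeth: "left_noetherian R" and folner: "has_folner_sets G"
    and gf: "gabriel_filter R F" and inv: "\<And>g. g \<in> carrier G \<Longrightarrow> filter_invariant R F (\<sigma> g)"
    and es: "equivariant_surjection W \<phi>" and tors: "W \<subseteq> torsion R V (finite_length_filter R F)"
    and x: "x \<in> W" "\<phi> x = \<zero>\<^bsub>V\<^esub>"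
  shows "x \<in> torsion R V F"
proof (rule ccontr)
  assume nt: "x \<notin> torsion R V F"
  interpret gabriel_filter R F by fact
  note D = equivariant_surjectionD[OF es] and W = submoduleD[OF equivariant_surjectionD(1)[OF es]]
  note P = equivariant_surjectionD[OF equivariant_surjection_funpow[OF es]]
  have xV: "x \<in> carrier V"
    by (rule W(1)[OF x(1)])
  let ?F' = "finite_length_filter R F"
  have gf': "gabriel_filter R ?F'"
    by (rule gabriel_filter_finite_length_filter[OF noeth])
  have inv': "filter_invariant R ?F' (\<sigma> g)" if "g \<in> carrier G" for g
    by (rule filter_invariant_finite_length_filter[OF R.ring_axioms aut[OF that] inv[OF that]])
  obtain A where A: "finite A" "A \<subseteq> torsion R V ?F'"
    and gen: "\<And>v E. v \<in> torsion R V ?F' \<Longrightarrow> finite E \<Longrightarrow> E \<subseteq> carrier G \<Longrightarrow> gsupp v \<subseteq> E \<Longrightarrow>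
      v \<in> submodule_span R V ((\<lambda>(g, a). \<gamma> g a) ` (E \<times> A))"
    using torsion_generators[OF noeth gf' inv'] by blast
  have AV: "A \<subseteq> carrier V"
    using A(2) by (auto simp: torsion_def)
  have "\<exists>n. length_le R (regular_module R) F (annihilator R V a) (carrier R) n" if "a \<in> A" for a
    using A(2) that unfolding torsion_def finite_length_filter_def by blast
  then obtain l where l: "\<And>a. a \<in> A \<Longrightarrow> length_le R (regular_module R) F (annihilator R V a) (carrier R) (l a)"
    by metis
  \<comment> \<open>The annihilator of \<open>\<gamma> g a\<close> is the image of that of \<open>a\<close> under \<open>\<sigma> g\<close>, so all translates of \<open>a\<close> share
    the bound \<open>l a\<close>.\<close>
  have upper: "length_le R V F {\<zero>\<^bsub>V\<^esub>} (submodule_span R V ((\<lambda>(g, a). \<gamma> g a) ` (E \<times> A))) (card E * sum l A)"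
    if E: "finite E" "E \<subseteq> carrier G" for E
  proof -
    have "length_le R V F {\<zero>\<^bsub>V\<^esub>} (submodule_span R V ((\<lambda>(g, a). \<gamma> g a) ` (E \<times> A)))
        (\<Sum>(g, a)\<in>E \<times> A. l a)"
    proof (rule length_le_span[OF gf])
      show "finite (E \<times> A)"
        using E A by simp
      show "(\<lambda>(g, a). \<gamma> g a) ` (E \<times> A) \<subseteq> carrier V"
        using E(2) AV gamma_closed by auto
      fix p assume "p \<in> E \<times> A"
      then obtain g a where p: "p = (g, a)" "g \<in> carrier G" "a \<in> A" "a \<in> carrier V"
        using E(2) AV by blast
      have "length_le R (regular_module R) F (\<sigma> g ` annihilator R V a) (carrier R) (l a)"
        by (rule length_le_ring_iso[OF R.ring_axioms aut[OF p(2)] inv[OF p(2)]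
              colon_left_ideal[OF submodule_zero p(4)] l[OF p(3)]])
      then show "length_le R (regular_module R) F (annihilator R V ((\<lambda>(g, a). \<gamma> g a) p)) (carrier R)
          ((\<lambda>(g, a). l a) p)"
        by (simp add: p annihilator_gamma)
    qed
    moreover have "(\<Sum>(g, a)\<in>E \<times> A. l a) = card E * sum l A"
      by (simp add: sum.cartesian_product[symmetric])
    ultimately show ?thesis
      by simp
  qed
  have "\<exists>v. v \<in> W \<and> \<phi> v = w" if "w \<in> W" for w
    using D(3) that by (metis imageE)
  then obtain pre where pre: "\<And>w. w \<in> W \<Longrightarrow> pre w \<in> W \<and> \<phi> (pre w) = w"
    by metis
  define xs where "xs k = (pre ^^ k) x" for k
  have xsW: "xs k \<in> W" for k
    unfolding xs_def by (induction k) (use x(1) pre in auto)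
  have funpow_xs: "(\<phi> ^^ k) (xs k) = x" for k
  proof (induction k)
    case (Suc k)
    have "\<phi> (xs (Suc k)) = xs k"
      using pre[OF xsW[of k]] by (simp add: xs_def)
    then show ?case
      using Suc by (simp add: funpow_Suc_right del: funpow.simps)
  qed (simp add: xs_def)
  define C where "C = gsupp x"
  have "x \<noteq> \<zero>\<^bsub>V\<^esub>"
    using nt submoduleD(2)[OF torsion_submodule[OF gf]] by auto
  then have C: "finite C" "C \<subseteq> carrier G" "C \<noteq> {}"
    using gsupp_finite[OF xV] gsupp_carrier gsupp_empty[OF xV] unfolding C_def by auto
  \<comment> \<open>The chain below has \<open>n |T|\<close> jumps, while its length is at most \<open>2 |Q| \<Sum>l\<close> with
    \<open>|Q| \<le> |T| |C|\<^sup>2\<close>; this choice of \<open>n\<close> makes the former exceed the latter.\<close>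
  define n where "n = 2 * (card C * card C) * sum l A + 1"
  define D' where "D' = (\<Union>k<n. gsupp (xs k))"
  have D': "finite D'" "D' \<subseteq> carrier G"
    unfolding D'_def using gsupp_finite[OF W(1)[OF xsW]] gsupp_carrier by auto
  obtain Q where Q: "finite Q" "Q \<noteq> {}" "Q \<subseteq> carrier G" "card (Q <#>\<^bsub>G\<^esub> D') \<le> 2 * card Q"
    using folner[unfolded has_folner_sets_def, rule_format, OF D'] by blast
  obtain T where T: "T \<subseteq> Q"
    and disj: "\<And>g h. g \<in> T \<Longrightarrow> h \<in> T \<Longrightarrow> g \<noteq> h \<Longrightarrow> (g <#\<^bsub>G\<^esub> C) \<inter> (h <#\<^bsub>G\<^esub> C) = {}"
    and cardT: "card Q \<le> card T * (card C * card C)"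
    using G.disjoint_translates[OF Q(1,3) C] by (elim exE conjE) simp
  define m where "m = card T"
  have finT: "finite T"
    using T Q(1) by (rule finite_subset)
  have m: "m > 0"
    using cardT Q(1,2) by (auto simp: m_def intro!: gr0I)
  obtain t where t: "bij_betw t {..<m} T"
    using ex_bij_betw_nat_finite[OF finT] unfolding m_def by (auto simp: atLeast0LessThan)
  have tT: "t j \<in> T" "t j \<in> carrier G" "t j \<in> Q" if "j < m" for j
    using t that T Q(3) unfolding bij_betw_def by auto
  define S where "S j = (\<Union>i<j. t i <#\<^bsub>G\<^esub> C)" for j
  define E where "E = Q <#>\<^bsub>G\<^esub> D'"
  have E: "finite E" "E \<subseteq> carrier G"
    unfolding E_def set_mult_def using Q D' by auto
  \<comment> \<open>The index \<open>i = k m + j\<close> stands for the pair \<open>(k, j)\<close>: stage \<open>i\<close> consists of the elements that \<open>\<phi>\<^sup>k\<close> moves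
    into the kernel of \<open>\<phi>\<close> and onto the first \<open>j\<close> translates of \<open>C\<close>.\<close>
  define chain where "chain i = {v \<in> W. (\<phi> ^^ Suc (i div m)) v = \<zero>\<^bsub>V\<^esub>} \<inter>
      {v \<in> W. (\<phi> ^^ (i div m)) v \<in> supported (S (i mod m))} \<inter> supported E" for i
  have "submodule_chain R V {\<zero>\<^bsub>V\<^esub>} (submodule_span R V ((\<lambda>(g, a). \<gamma> g a) ` (E \<times> A))) chain"
  proof (rule submodule_chainI)
    show sub: "submodule (chain i) R V" for i
      unfolding chain_def
      using submodule_preimage[OF equivariant_surjection_funpow[OF es, of "Suc (i div m)"] submodule_zero]
        submodule_preimage[OF equivariant_surjection_funpow[OF es, of "i div m"] supported_submodule]
      by (intro submodule_inter supported_submodule) auto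
    show "{\<zero>\<^bsub>V\<^esub>} \<subseteq> chain i" for i
      using submoduleD(2)[OF sub] by blast
    show "chain i \<subseteq> submodule_span R V ((\<lambda>(g, a). \<gamma> g a) ` (E \<times> A))" for i
    proof
      fix v assume "v \<in> chain i"
      then have "v \<in> W" "gsupp v \<subseteq> E"
        unfolding chain_def supported_def by blast+
      then show "v \<in> submodule_span R V ((\<lambda>(g, a). \<gamma> g a) ` (E \<times> A))"
        using gen[OF _ E] tors by blast
    qed
    show "chain i \<subseteq> chain (Suc i)" for i
    proof
      fix v assume v: "v \<in> chain i"
      show "v \<in> chain (Suc i)"
      proof (cases "Suc (i mod m) = m")
        case True
        then have "Suc i div m = Suc (i div m)" "Suc i mod m = 0"
          by (simp_all add: div_Suc mod_Suc)
        moreover have "(\<phi> ^^ Suc (Suc (i div m))) v = \<zero>\<^bsub>V\<^esub>"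
          using v D(8) unfolding chain_def by simp
        moreover have "\<zero>\<^bsub>V\<^esub> \<in> supported (S 0)"
          by (rule submoduleD(2)[OF supported_submodule])
        ultimately show ?thesis
          using v unfolding chain_def by auto
      next
        case False
        then have "Suc i div m = i div m" "Suc i mod m = Suc (i mod m)"
          by (simp_all add: div_Suc mod_Suc)
        moreover have "supported (S (i mod m)) \<subseteq> supported (S (Suc (i mod m)))"
          unfolding supported_def S_def lessThan_Suc by blast
        ultimately show ?thesis
          using v unfolding chain_def by auto
      qed
    qed
  qed
  then have fin: "finite (jumps R V F chain)" and bound: "card (jumps R V F chain) \<le> card E * sum l A"
    using upper[OF E] unfolding length_le_def by blast+
  have "{..<n * m} \<subseteq> jumps R V F chain"
  proof
    fix i assume "i \<in> {..<n * m}"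
    define k j where "k = i div m" and "j = i mod m"
    have k: "k < n" and j: "j < m"
      using \<open>i \<in> {..<n * m}\<close> m unfolding k_def j_def by (simp_all add: less_mult_imp_div_less)
    note tj = tT[OF j]
    define z y where "z = \<gamma> (t j) (xs k)" and "y = \<gamma> (t j) x"
    have zW: "z \<in> W" and yW: "y \<in> W"
      unfolding z_def y_def using D(2)[OF tj(2)] xsW x(1) by blast+
    note zV = W(1)[OF zW] and yV = W(1)[OF yW]
    have zy: "(\<phi> ^^ k) z = y"
      unfolding z_def y_def P(6)[OF tj(2) xsW] funpow_xs ..
    have y0: "\<phi> y = \<zero>\<^bsub>V\<^esub>"
      unfolding y_def D(6)[OF tj(2) x(1)] x(2) using tj(2) by simp
    have ysupp: "gsupp y \<subseteq> t j <#\<^bsub>G\<^esub> C"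
      unfolding y_def C_def by (rule gsupp_gamma[OF tj(2) xV])
    have "gsupp z \<subseteq> t j <#\<^bsub>G\<^esub> gsupp (xs k)"
      unfolding z_def by (rule gsupp_gamma[OF tj(2) W(1)[OF xsW]])
    also have "\<dots> \<subseteq> E"
      unfolding E_def D'_def set_mult_def l_coset_def using tj(3) k by blast
    finally have zE: "z \<in> supported E"
      using zV by (simp add: supported_def)
    have "z \<in> chain (Suc i)"
    proof (cases "Suc j = m")
      case True
      then have "Suc i div m = Suc k" "Suc i mod m = 0"
        unfolding k_def j_def by (simp_all add: div_Suc mod_Suc)
      moreover have "(\<phi> ^^ Suc k) z = \<zero>\<^bsub>V\<^esub>"
        using zy y0 by simp
      moreover have "\<zero>\<^bsub>V\<^esub> \<in> supported (S 0)"
        by (rule submoduleD(2)[OF supported_submodule])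
      ultimately show ?thesis
        unfolding chain_def using zW zE D(8) by simp
    next
      case False
      then have "Suc i div m = k" "Suc i mod m = Suc j"
        unfolding k_def j_def by (simp_all add: div_Suc mod_Suc)
      moreover have "y \<in> supported (S (Suc j))"
        unfolding supported_def S_def using ysupp yV by auto
      ultimately show ?thesis
        unfolding chain_def using zW zE zy y0 by simp
    qed
    \<comment> \<open>If \<open>r z\<close> is in stage \<open>i\<close>, then \<open>r y = \<phi>\<^sup>k(r z)\<close> is supported on \<open>S j\<close> and on the translate of \<open>C\<close> by
      \<open>t j\<close>. These are disjoint, so \<open>r\<close> annihilates \<open>y\<close>, which is not torsion.\<close>
    moreover have "colon R V (chain i) z \<notin> F"
    proof
      assume "colon R V (chain i) z \<in> F"
      moreover have "colon R V (chain i) z \<subseteq> annihilator R V y"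
      proof
        fix r assume "r \<in> colon R V (chain i) z"
        then have r: "r \<in> carrier R" "(\<phi> ^^ k) (r \<odot>\<^bsub>V\<^esub> z) \<in> supported (S j)"
          unfolding colon_def chain_def k_def j_def by auto
        then have "gsupp (r \<odot>\<^bsub>V\<^esub> y) \<subseteq> S j"
          unfolding P(5)[OF r(1) zW] zy supported_def by blast
        moreover have "gsupp (r \<odot>\<^bsub>V\<^esub> y) \<subseteq> t j <#\<^bsub>G\<^esub> C"
          using gsupp_smult[OF r(1) yV] ysupp by blast
        moreover have "S j \<inter> (t j <#\<^bsub>G\<^esub> C) = {}"
        proof -
          have "(t i <#\<^bsub>G\<^esub> C) \<inter> (t j <#\<^bsub>G\<^esub> C) = {}" if "i < j" for i
          proof (rule disj)
            show "t i \<noteq> t j"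
              using t that j unfolding bij_betw_def by (auto dest: inj_onD)
          qed (use tT that j in auto)
          then show ?thesis
            unfolding S_def by blast
        qed
        ultimately have "gsupp (r \<odot>\<^bsub>V\<^esub> y) = {}"
          by blast
        then show "r \<in> annihilator R V y"
          using gsupp_empty r(1) yV unfolding colon_def by simp
      qed
      ultimately have "annihilator R V y \<in> F"
        using upward colon_left_ideal[OF submodule_zero yV] by blast
      then have "y \<in> torsion R V F"
        using yV by (simp add: torsion_def)
      then show False
        using nt gamma_torsion[OF inv[OF tj(2)] tj(2) xV] unfolding y_def by blast
    qed
    ultimately show "i \<in> jumps R V F chain"
      unfolding jumps_def by blast
  qed
  from card_mono[OF fin this] have "n * m \<le> card (jumps R V F chain)"
    by simp
  also note bound
  also have "card E * sum l A \<le> (2 * card Q) * sum l A"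
    using Q(4) unfolding E_def by (rule mult_le_mono1)
  also have "\<dots> \<le> (2 * (m * (card C * card C))) * sum l A"
    using cardT unfolding m_def by (intro mult_le_mono1 mult_le_mono2)
  also have "\<dots> = (n - 1) * m"
    by (simp add: n_def)
  finally show False
    using m by (simp add: n_def)
qed

definition hopfian_filter :: "'r set set \<Rightarrow> bool" where
  "hopfian_filter F \<longleftrightarrow> (\<forall>W \<phi>. equivariant_surjection W \<phi> \<longrightarrow> W \<subseteq> torsion R V F \<longrightarrow>
     (\<forall>v\<in>W. \<phi> v = \<zero>\<^bsub>V\<^esub> \<longrightarrow> v = \<zero>\<^bsub>V\<^esub>))"

text \<open>
  The kernel of \<open>\<phi>\<close> is \<open>F\<close>-torsion by \<open>kernel_torsion\<close>, so every preimage of an \<open>F\<close>-torsion element is an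
  extension of torsion by torsion and thus torsion. Hence \<open>\<phi>\<close> is still surjective on the \<open>F\<close>-torsion part
  of \<open>W\<close>, which contains the whole kernel.
\<close>

lemma hopfian_finite_length_filter:
  assumes noeth: "left_noetherian R" and folner: "has_folner_sets G"
    and gf: "gabriel_filter R F" and inv: "\<And>g. g \<in> carrier G \<Longrightarrow> filter_invariant R F (\<sigma> g)"
    and hopf: "hopfian_filter F"
  shows "hopfian_filter (finite_length_filter R F)"
  unfolding hopfian_filter_def
proof (intro allI impI ballI)
  interpret gabriel_filter R F by fact
  fix W \<phi> v
  assume es: "equivariant_surjection W \<phi>" and tors: "W \<subseteq> torsion R V (finite_length_filter R F)"
    and v: "v \<in> W" "\<phi> v = \<zero>\<^bsub>V\<^esub>"
  note D = equivariant_surjectionD[OF es] and W = submoduleD[OF equivariant_surjectionD(1)[OF es]]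
  have ker: "w \<in> torsion R V F" if "w \<in> W" "\<phi> w = \<zero>\<^bsub>V\<^esub>" for w
    by (rule kernel_torsion[OF noeth folner gf _ es tors that]) (rule inv)
  let ?T = "torsion R V F"
  let ?W = "W \<inter> ?T"
  have "\<phi> w \<in> ?T" if w: "w \<in> ?W" for w
  proof -
    have "annihilator R V w \<subseteq> annihilator R V (\<phi> w)"
    proof
      fix r assume "r \<in> annihilator R V w"
      then have r: "r \<in> carrier R" "r \<odot>\<^bsub>V\<^esub> w = \<zero>\<^bsub>V\<^esub>"
        unfolding colon_def by auto
      have wW: "w \<in> W"
        using w by blast
      have "r \<odot>\<^bsub>V\<^esub> \<phi> w = \<zero>\<^bsub>V\<^esub>"
        unfolding D(5)[OF r(1) wW, symmetric] r(2) by (rule D(8))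
      then show "r \<in> annihilator R V (\<phi> w)"
        using r(1) unfolding colon_def by simp
    qed
    moreover have "\<phi> w \<in> carrier V" "annihilator R V w \<in> F"
      using w D(7) W(1) unfolding torsion_def by blast+
    ultimately show ?thesis
      using upward colon_left_ideal[OF submodule_zero, of "\<phi> w"] unfolding torsion_def by blast
  qed
  then have "\<phi> ` ?W \<subseteq> ?W"
    using D(7) by blast
  moreover have "?W \<subseteq> \<phi> ` ?W"
  proof
    fix y assume y: "y \<in> ?W"
    then obtain w where w: "w \<in> W" "y = \<phi> w"
      using D(3) by blast
    note wV = W(1)[OF w(1)]
    have "annihilator R V w \<in> F"
    proof (rule extension)
      show "annihilator R V y \<in> F"
        using y by (simp add: torsion_def)
      show "left_ideal R (annihilator R V w)"
        by (rule colon_left_ideal[OF submodule_zero wV])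
      fix a assume "a \<in> annihilator R V y"
      then have a: "a \<in> carrier R" "a \<odot>\<^bsub>V\<^esub> y = \<zero>\<^bsub>V\<^esub>"
        unfolding colon_def by auto
      then have "a \<odot>\<^bsub>V\<^esub> w \<in> ?T"
        using ker[OF W(4)[OF a(1) w(1)]] D(5)[OF a(1) w(1)] w(2) by simp
      then show "colon R (regular_module R) (annihilator R V w) a \<in> F"
        unfolding torsion_def by (simp add: colon_smult[OF wV a(1)])
    qed
    then have "w \<in> ?W"
      using w(1) wV by (simp add: torsion_def)
    then show "y \<in> \<phi> ` ?W"
      using w(2) by blast
  qed
  ultimately have "equivariant_surjection ?W \<phi>"
    unfolding equivariant_surjection_def
    using submodule_inter[OF D(1) torsion_submodule[OF gf]] D(2,4-6) gamma_torsion[OF inv] W(1)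
    by auto
  then show "v = \<zero>\<^bsub>V\<^esub>"
    using hopf v ker unfolding hopfian_filter_def by blast
qed

end

lemma gabriel_filter_trivial:
  assumes "ring R"
  shows "gabriel_filter R {carrier R}"
proof -
  interpret R: ring R by fact
  interpret reg: left_module R "regular_module R"
    by (rule left_module_regular) (rule R.ring_axioms)
  have sub: "left_ideal R J \<Longrightarrow> J \<subseteq> carrier R" for J
    using reg.submoduleD(1)[of J] by auto
  show ?thesis
  proof (intro gabriel_filter.intro gabriel_filter_axioms.intro)
    show "ring R" by fact
    show "left_ideal R I" if "I \<in> {carrier R}" for I
      using reg.submodule_carrier that by simp
    show "J \<in> {carrier R}" if "I \<in> {carrier R}" "left_ideal R J" "I \<subseteq> J" for I J
      using that sub by blast
    show "colon R (regular_module R) I a \<in> {carrier R}" if "I \<in> {carrier R}" "a \<in> carrier R" for I a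
      using that by (auto simp: colon_def)
    fix I J
    assume J: "J \<in> {carrier R}" and I: "left_ideal R I"
      and col: "\<And>a. a \<in> J \<Longrightarrow> colon R (regular_module R) I a \<in> {carrier R}"
    have "colon R (regular_module R) I \<one>\<^bsub>R\<^esub> = carrier R"
      using col J by blast
    then have "r \<in> I" if "r \<in> carrier R" for r
      using that unfolding colon_def by (metis (no_types, lifting) R.r_one mem_Collect_eq regular_module_simps(4))
    then have "carrier R \<subseteq> I"
      by blast
    then show "I \<in> {carrier R}"
      using sub[OF I] by blast
  qed simp
qed

text \<open>
  Only the extension axiom needs an argument. As \<open>J\<close> is finitely generated, the conditions on its generators
  hold in a single member of the chain, and they extend to \<open>J\<close> because torsion elements form a submodule.
\<close>

lemma gabriel_filter_Union:
  assumes noeth: "left_noetherian R" and ne: "C \<noteq> {}"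
    and gf: "\<And>F. F \<in> C \<Longrightarrow> gabriel_filter R F"
    and total: "\<And>F F'. F \<in> C \<Longrightarrow> F' \<in> C \<Longrightarrow> F \<subseteq> F' \<or> F' \<subseteq> F"
  shows "gabriel_filter R (\<Union>C)"
proof -
  interpret R: ring R
    using noeth unfolding left_noetherian_def by blast
  interpret reg: left_module R "regular_module R"
    by (rule left_module_regular) (rule R.ring_axioms)
  show ?thesis
  proof (intro gabriel_filter.intro gabriel_filter_axioms.intro)
    show "ring R"
      by (rule R.ring_axioms)
    show "left_ideal R I" if "I \<in> \<Union>C" for I
      using that gabriel_filter.left_ideal[OF gf] by blast
    show "carrier R \<in> \<Union>C"
      using ne gabriel_filter.carrier_mem[OF gf] by blast
    show "J \<in> \<Union>C" if "I \<in> \<Union>C" "left_ideal R J" "I \<subseteq> J" for I J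
      using that gabriel_filter.upward[OF gf] by (meson UnionE UnionI)
    show "colon R (regular_module R) I a \<in> \<Union>C" if "I \<in> \<Union>C" "a \<in> carrier R" for I a
      using that gabriel_filter.colon_mem[OF gf] by (meson UnionE UnionI)
    fix I J
    assume "J \<in> \<Union>C" and I: "left_ideal R I"
      and col: "\<And>a. a \<in> J \<Longrightarrow> colon R (regular_module R) I a \<in> \<Union>C"
    then obtain F where F: "F \<in> C" "J \<in> F"
      by blast
    have J: "left_ideal R J"
      by (rule gabriel_filter.left_ideal[OF gf[OF F(1)] F(2)])
    then obtain A where A: "finite A" "A \<subseteq> carrier R" "J = submodule_span R (regular_module R) A"
      using noeth unfolding left_noetherian_def by blast
    have AJ: "A \<subseteq> J"
      unfolding A(3) by (rule reg.submodule_span_superset)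
    have "\<exists>F'\<in>C. F \<subseteq> F' \<and> (\<forall>a\<in>A. colon R (regular_module R) I a \<in> F')"
      using A(1) AJ
    proof (induction A rule: finite_induct)
      case empty
      then show ?case
        using F(1) by blast
    next
      case (insert a A)
      then obtain F1 where F1: "F1 \<in> C" "F \<subseteq> F1" "\<forall>a\<in>A. colon R (regular_module R) I a \<in> F1"
        by blast
      obtain F2 where F2: "F2 \<in> C" "colon R (regular_module R) I a \<in> F2"
        using col[of a] insert.prems by blast
      show ?case
        using total[OF F1(1) F2(1)] F1 F2 by blast
    qed
    then obtain F' where F': "F' \<in> C" "F \<subseteq> F'" "\<forall>a\<in>A. colon R (regular_module R) I a \<in> F'"
      by blast
    have "J \<subseteq> {x \<in> carrier (regular_module R). colon R (regular_module R) I x \<in> F'}"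
      unfolding A(3)
      by (rule reg.submodule_span_minimal[OF reg.torsion_modulo_submodule[OF gf[OF F'(1)] I]])
        (use A(2) F'(3) in auto)
    then have "I \<in> F'"
      using F F' by (intro gabriel_filter.extension[OF gf[OF F'(1)] _ I]) blast+
    then show "I \<in> \<Union>C"
      using F'(1) by blast
  qed
qed

context twisted_graded_module
begin

text \<open>
  A filter that is maximal among the invariant Gabriel filters with the Hopfian property agrees with its own
  \<open>finite_length_filter\<close>, hence contains all left ideals. The property survives unions of chains because the
  torsion part of \<open>V\<close> is generated by translates of finitely many elements, which are torsion with respect to
  one member of the chain.
\<close>

theorem equivariant_surjection_injective:
  assumes noeth: "left_noetherian R" and folner: "has_folner_sets G"
    and es: "equivariant_surjection W \<phi>" and v: "v \<in> W" "\<phi> v = \<zero>\<^bsub>V\<^esub>"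
  shows "v = \<zero>\<^bsub>V\<^esub>"
proof -
  interpret reg: left_module R "regular_module R"
    by (rule left_module_regular) (rule R.ring_axioms)
  define H where "H = {F. gabriel_filter R F \<and> (\<forall>g\<in>carrier G. filter_invariant R F (\<sigma> g)) \<and> hopfian_filter F}"
  have "\<exists>F\<in>H. \<forall>F'\<in>H. F \<subseteq> F' \<longrightarrow> F' = F"
  proof (rule subset_Zorn_nonempty)
    have "filter_invariant R {carrier R} (\<sigma> g)" if g: "g \<in> carrier G" for g
      unfolding filter_invariant_def
    proof (intro allI impI)
      fix I assume "left_ideal R I"
      then have "I \<subseteq> carrier R"
        using reg.submoduleD(1) by auto
      moreover have "inj_on (\<sigma> g) (carrier R)"
        using aut[OF g] by (auto simp: ring_iso_def bij_betw_def)
      ultimately have "\<sigma> g ` I = \<sigma> g ` carrier R \<longleftrightarrow> I = carrier R"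
        by (simp add: inj_on_image_eq_iff)
      then show "(\<sigma> g ` I \<in> {carrier R}) = (I \<in> {carrier R})"
        using sigma_image[OF g] by simp
    qed
    moreover have "hopfian_filter {carrier R}"
    proof -
      have "w = \<zero>\<^bsub>V\<^esub>" if "w \<in> torsion R V {carrier R}" for w
      proof -
        have "\<one> \<in> annihilator R V w" "w \<in> carrier V"
          using that unfolding torsion_def by auto
        then show ?thesis
          unfolding colon_def by simp
      qed
      then show ?thesis
        unfolding hopfian_filter_def by blast
    qed
    ultimately have "{carrier R} \<in> H"
      using gabriel_filter_trivial[OF R.ring_axioms] unfolding H_def by blast
    then show "H \<noteq> {}"
      by blast
  next
    fix C assume C: "C \<noteq> {}" "subset.chain H C"
    then have total: "\<And>F F'. F \<in> C \<Longrightarrow> F' \<in> C \<Longrightarrow> F \<subseteq> F' \<or> F' \<subseteq> F"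
      and CH: "\<And>F. F \<in> C \<Longrightarrow> F \<in> H"
      unfolding subset_chain_def by blast+
    have gfC: "\<And>F. F \<in> C \<Longrightarrow> gabriel_filter R F"
      and invC: "\<And>F g. F \<in> C \<Longrightarrow> g \<in> carrier G \<Longrightarrow> filter_invariant R F (\<sigma> g)"
      and hopfC: "\<And>F. F \<in> C \<Longrightarrow> hopfian_filter F"
      using CH unfolding H_def by blast+
    have gf: "gabriel_filter R (\<Union>C)"
      by (rule gabriel_filter_Union[OF noeth C(1) gfC total])
    have inv: "filter_invariant R (\<Union>C) (\<sigma> g)" if "g \<in> carrier G" for g
      using invC[OF _ that] unfolding filter_invariant_def by blast
    have "hopfian_filter (\<Union>C)"
      unfolding hopfian_filter_def
    proof (intro allI impI)
      fix W \<phi> assume es: "equivariant_surjection W \<phi>" and W: "W \<subseteq> torsion R V (\<Union>C)"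
      obtain A where A: "finite A" "A \<subseteq> torsion R V (\<Union>C)"
        and gen: "\<And>v E. v \<in> torsion R V (\<Union>C) \<Longrightarrow> finite E \<Longrightarrow> E \<subseteq> carrier G \<Longrightarrow> gsupp v \<subseteq> E \<Longrightarrow>
          v \<in> submodule_span R V ((\<lambda>(g, a). \<gamma> g a) ` (E \<times> A))"
        using torsion_generators[OF noeth gf inv] by blast
      have "\<exists>F\<in>C. A \<subseteq> torsion R V F"
        using A
      proof (induction A rule: finite_induct)
        case empty
        then show ?case
          using C(1) by blast
      next
        case (insert a A)
        then obtain F1 where F1: "F1 \<in> C" "A \<subseteq> torsion R V F1"
          by blast
        obtain F2 where F2: "F2 \<in> C" "a \<in> torsion R V F2"
          using insert.prems unfolding torsion_def by blast
        have "torsion R V F1 \<subseteq> torsion R V F2 \<or> torsion R V F2 \<subseteq> torsion R V F1"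
          using total[OF F1(1) F2(1)] unfolding torsion_def by blast
        then show ?case
          using F1 F2 by blast
      qed
      then obtain F where F: "F \<in> C" "A \<subseteq> torsion R V F"
        by blast
      note T = torsion_submodule[OF gfC[OF F(1)]]
      have "W \<subseteq> torsion R V F"
      proof
        fix v assume v: "v \<in> W"
        have "v \<in> torsion R V (\<Union>C)"
          using v W by blast
        moreover from this have "v \<in> carrier V"
          by (simp add: torsion_def)
        ultimately have "v \<in> submodule_span R V ((\<lambda>(g, a). \<gamma> g a) ` (gsupp v \<times> A))"
          by (intro gen gsupp_finite gsupp_carrier) auto
        moreover have "(\<lambda>(g, a). \<gamma> g a) ` (gsupp v \<times> A) \<subseteq> torsion R V F"
        proof (clarsimp)
          fix g a assume "g \<in> gsupp v" "a \<in> A"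
          then have "g \<in> carrier G" "a \<in> torsion R V F" "a \<in> carrier V"
            using gsupp_carrier F(2) submoduleD(1)[OF T] by blast+
          then show "\<gamma> g a \<in> torsion R V F"
            using gamma_torsion[OF invC[OF F(1)]] by blast
        qed
        ultimately show "v \<in> torsion R V F"
          using submodule_span_minimal[OF T] by blast
      qed
      then show "\<forall>v\<in>W. \<phi> v = \<zero>\<^bsub>V\<^esub> \<longrightarrow> v = \<zero>\<^bsub>V\<^esub>"
        using hopfC[OF F(1)] es unfolding hopfian_filter_def by blast
    qed
    then show "\<Union>C \<in> H"
      unfolding H_def using gf inv by blast
  qed
  then obtain F where FH: "F \<in> H" and max: "\<And>F'. F' \<in> H \<Longrightarrow> F \<subseteq> F' \<Longrightarrow> F' = F"
    by blast
  have gf: "gabriel_filter R F" and inv: "\<And>g. g \<in> carrier G \<Longrightarrow> filter_invariant R F (\<sigma> g)"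
    and hopf: "hopfian_filter F"
    using FH unfolding H_def by blast+
  interpret gabriel_filter R F by (rule gf)
  have "finite_length_filter R F \<in> H"
    unfolding H_def
    using gabriel_filter_finite_length_filter[OF noeth]
      filter_invariant_finite_length_filter[OF R.ring_axioms aut inv]
      hopfian_finite_length_filter[OF noeth folner gf inv hopf] by blast
  then have "finite_length_filter R F = F"
    by (rule max[OF _ subset_finite_length_filter])
  then have all: "I \<in> F" if "left_ideal R I" for I
    using finite_length_filter_proper[OF noeth that] by blast
  have W: "submodule W R V"
    by (rule equivariant_surjectionD(1)[OF es])
  have "W \<subseteq> torsion R V F"
    using submoduleD(1)[OF W] all[OF colon_left_ideal[OF submodule_zero]] unfolding torsion_def by blast
  then show ?thesis
    using hopf es v unfolding hopfian_filter_def by blast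
qed

lemma equivariant_surjection_inj_on:
  assumes noeth: "left_noetherian R" and folner: "has_folner_sets G"
    and es: "equivariant_surjection W \<phi>"
  shows "inj_on \<phi> W"
proof (rule inj_onI)
  note D = equivariant_surjectionD[OF es] and W = submoduleD[OF equivariant_surjectionD(1)[OF es]]
  fix v w assume v: "v \<in> W" and w: "w \<in> W" and eq: "\<phi> v = \<phi> w"
  note c = W(1)[OF v] W(1)[OF w] W(1)[OF D(7)[OF w]]
  have neg: "\<ominus>\<^bsub>V\<^esub> w = (\<ominus> \<one>) \<odot>\<^bsub>V\<^esub> w" "\<ominus>\<^bsub>V\<^esub> \<phi> w = (\<ominus> \<one>) \<odot>\<^bsub>V\<^esub> \<phi> w"
    using smult_minus_one c by simp_all
  have "\<phi> (v \<oplus>\<^bsub>V\<^esub> \<ominus>\<^bsub>V\<^esub> w) = \<phi> w \<oplus>\<^bsub>V\<^esub> \<ominus>\<^bsub>V\<^esub> \<phi> w"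
    using D(4)[OF v W(5)[OF w]] D(5)[OF R.a_inv_closed[OF R.one_closed] w] eq neg by simp
  also have "\<dots> = \<zero>\<^bsub>V\<^esub>"
    using c by (simp add: M.r_neg)
  finally have "v \<oplus>\<^bsub>V\<^esub> \<ominus>\<^bsub>V\<^esub> w = \<zero>\<^bsub>V\<^esub>"
    by (rule equivariant_surjection_injective[OF noeth folner es W(3)[OF v W(5)[OF w]]])
  then show "v = w"
    using c M.minus_equality[of v "\<ominus>\<^bsub>V\<^esub> w"] by simp
qed

end

section \<open>Functoriality of the tensor product\<close>

text \<open>
  This is the part of a ring extension \<open>\<phi> : R \<rightarrow> A\<close> to which the relators of \<open>A \<otimes> K\<close> refer.
\<close>

locale scalar_extension = K: left_module R K
  for R :: "('r, 'c) ring_scheme" (structure) and K :: "('r, 'k, 'b) module_scheme" (structure) +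
  fixes A :: "('s, 'a) ring_scheme" and \<phi> :: "'r \<Rightarrow> 's"
  assumes A_add: "a \<in> carrier A \<Longrightarrow> b \<in> carrier A \<Longrightarrow> a \<oplus>\<^bsub>A\<^esub> b \<in> carrier A"
    and A_mult: "a \<in> carrier A \<Longrightarrow> r \<in> carrier R \<Longrightarrow> a \<otimes>\<^bsub>A\<^esub> \<phi> r \<in> carrier A"
begin

abbreviation "T \<equiv> tensor_module R A \<phi> K"

definition free_carrier :: "('s \<times> 'k \<Rightarrow>\<^sub>0 int) set" where
  "free_carrier = {c. Poly_Mapping.keys c \<subseteq> carrier A \<times> carrier K}"

definition cls :: "('s \<times> 'k \<Rightarrow>\<^sub>0 int) \<Rightarrow> ('s \<times> 'k \<Rightarrow>\<^sub>0 int) set" where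
  "cls c = tensor_kernel R A \<phi> K #>\<^bsub>tensor_free A K\<^esub> c"

definition pure :: "'s \<Rightarrow> 'k \<Rightarrow> ('s \<times> 'k \<Rightarrow>\<^sub>0 int) set" where
  "pure a x = cls (frag_of (a, x))"

lemma free_carrier_closed:
  "0 \<in> free_carrier" "c \<in> free_carrier \<Longrightarrow> d \<in> free_carrier \<Longrightarrow> c + d \<in> free_carrier" "c \<in> free_carrier \<Longrightarrow> - c \<in> free_carrier"
  "c \<in> free_carrier \<Longrightarrow> d \<in> free_carrier \<Longrightarrow> c - d \<in> free_carrier"
  "a \<in> carrier A \<Longrightarrow> x \<in> carrier K \<Longrightarrow> frag_of (a, x) \<in> free_carrier"
  using keys_add[of c d] keys_diff[of c d] by (auto simp: free_carrier_def)

lemma tensor_free_simps: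
  "carrier (tensor_free A K) = free_carrier" "c \<otimes>\<^bsub>tensor_free A K\<^esub> d = c + d" "\<one>\<^bsub>tensor_free A K\<^esub> = 0"
  by (auto simp: tensor_free_def free_carrier_def)

lemma comm_group_tensor_free: "comm_group (tensor_free A K)"
  unfolding tensor_free_def by (rule abelian_free_Abelian_group)

lemma tensor_relators_subset: "tensor_relators R A \<phi> K \<subseteq> free_carrier"
proof
  fix c assume "c \<in> tensor_relators R A \<phi> K"
  then consider (l) a b x where "c = frag_of (a \<oplus>\<^bsub>A\<^esub> b, x) - frag_of (a, x) - frag_of (b, x)"
      "a \<in> carrier A" "b \<in> carrier A" "x \<in> carrier K"
    | (r) a x y where "c = frag_of (a, x \<oplus>\<^bsub>K\<^esub> y) - frag_of (a, x) - frag_of (a, y)"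
      "a \<in> carrier A" "x \<in> carrier K" "y \<in> carrier K"
    | (m) a r x where "c = frag_of (a \<otimes>\<^bsub>A\<^esub> \<phi> r, x) - frag_of (a, r \<odot>\<^bsub>K\<^esub> x)"
      "a \<in> carrier A" "r \<in> carrier R" "x \<in> carrier K"
    unfolding tensor_relators_def by blast
  then show "c \<in> free_carrier"
  proof cases
    case l
    then show ?thesis
      unfolding l(1) by (intro free_carrier_closed(4,5) A_add)
  next
    case r
    then show ?thesis
      unfolding r(1) by (intro free_carrier_closed(4,5) K.M.a_closed)
  next
    case m
    then show ?thesis
      unfolding m(1) by (intro free_carrier_closed(4,5) A_mult K.smult_closed)
  qed
qed

lemma tensor_kernel_normal: "tensor_kernel R A \<phi> K \<lhd> tensor_free A K"
proof -
  interpret F: comm_group "tensor_free A K"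
    by (rule comm_group_tensor_free)
  show ?thesis
    unfolding tensor_kernel_def using tensor_relators_subset
    by (intro F.subgroup_imp_normal F.generate_is_subgroup) (simp add: tensor_free_simps)
qed

lemma tensor_kernel_closed:
  "tensor_kernel R A \<phi> K \<subseteq> free_carrier" "0 \<in> tensor_kernel R A \<phi> K"
  "c \<in> tensor_kernel R A \<phi> K \<Longrightarrow> d \<in> tensor_kernel R A \<phi> K \<Longrightarrow> c + d \<in> tensor_kernel R A \<phi> K"
  "c \<in> tensor_kernel R A \<phi> K \<Longrightarrow> - c \<in> tensor_kernel R A \<phi> K"
proof -
  note H = normal_imp_subgroup[OF tensor_kernel_normal]
  show sub: "tensor_kernel R A \<phi> K \<subseteq> free_carrier" and "0 \<in> tensor_kernel R A \<phi> K"
    and "c \<in> tensor_kernel R A \<phi> K \<Longrightarrow> d \<in> tensor_kernel R A \<phi> K \<Longrightarrow> c + d \<in> tensor_kernel R A \<phi> K"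
    using subgroup.subset[OF H] subgroup.one_closed[OF H] subgroup.m_closed[OF H, of c d] by (simp_all add: tensor_free_simps)
  assume c: "c \<in> tensor_kernel R A \<phi> K"
  then have "inv\<^bsub>tensor_free A K\<^esub> c = - c"
    using sub unfolding tensor_free_def by (intro inv_free_Abelian_group) (auto simp: free_carrier_def)
  then show "- c \<in> tensor_kernel R A \<phi> K"
    using subgroup.m_inv_closed[OF H c] by simp
qed

lemma cls_conv: "cls c = (\<lambda>h. h + c) ` tensor_kernel R A \<phi> K"
  unfolding cls_def r_coset_def by (auto simp: tensor_free_simps)

lemma cls_eqI:
  assumes "c - d \<in> tensor_kernel R A \<phi> K"
  shows "cls c = cls d"
proof -
  have "(\<lambda>h. h + (c - d)) ` tensor_kernel R A \<phi> K = tensor_kernel R A \<phi> K"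
  proof
    show "(\<lambda>h. h + (c - d)) ` tensor_kernel R A \<phi> K \<subseteq> tensor_kernel R A \<phi> K"
      using tensor_kernel_closed(3)[OF _ assms] by blast
    show "tensor_kernel R A \<phi> K \<subseteq> (\<lambda>h. h + (c - d)) ` tensor_kernel R A \<phi> K"
    proof
      fix h assume "h \<in> tensor_kernel R A \<phi> K"
      then have "h + - (c - d) \<in> tensor_kernel R A \<phi> K"
        using tensor_kernel_closed(3,4) assms by blast
      moreover have "h = (h + - (c - d)) + (c - d)"
        by simp
      ultimately show "h \<in> (\<lambda>h. h + (c - d)) ` tensor_kernel R A \<phi> K"
        by blast
    qed
  qed
  then have "(\<lambda>h. h + d) ` (\<lambda>h. h + (c - d)) ` tensor_kernel R A \<phi> K = cls d"
    unfolding cls_conv by simp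
  then show ?thesis
    unfolding cls_conv image_image by (simp add: algebra_simps)
qed

lemma tensor_carrier: "carrier T = cls ` free_carrier"
  unfolding tensor_module_def Let_def FactGroup_def RCOSETS_def cls_def
  by (auto simp: tensor_free_simps)

lemma cls_add:
  assumes "c \<in> free_carrier" "d \<in> free_carrier"
  shows "cls c \<oplus>\<^bsub>T\<^esub> cls d = cls (c + d)"
  unfolding tensor_module_def Let_def FactGroup_def cls_def
  using normal.rcos_sum[OF tensor_kernel_normal] assms by (simp add: tensor_free_simps)

lemma cls_zero: "\<zero>\<^bsub>T\<^esub> = cls 0"
  unfolding tensor_module_def Let_def FactGroup_def by (simp add: cls_conv)

sublocale T: abelian_group T
proof (rule abelian_groupI)
  fix u assume "u \<in> carrier T"
  then obtain c where c: "c \<in> free_carrier" "u = cls c"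
    unfolding tensor_carrier by blast
  then show "\<zero>\<^bsub>T\<^esub> \<oplus>\<^bsub>T\<^esub> u = u"
    unfolding cls_zero by (simp add: cls_add free_carrier_closed)
  have "cls (- c) \<oplus>\<^bsub>T\<^esub> u = \<zero>\<^bsub>T\<^esub>"
    unfolding cls_zero c(2) by (simp add: cls_add free_carrier_closed c(1))
  then show "\<exists>v\<in>carrier T. v \<oplus>\<^bsub>T\<^esub> u = \<zero>\<^bsub>T\<^esub>"
    using free_carrier_closed(3)[OF c(1)] unfolding tensor_carrier by blast
qed (auto simp: tensor_carrier cls_add cls_zero free_carrier_closed add_ac)

lemma pure_closed: "a \<in> carrier A \<Longrightarrow> x \<in> carrier K \<Longrightarrow> pure a x \<in> carrier T"
  unfolding pure_def tensor_carrier by (simp add: free_carrier_closed)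

lemma relator_mem: "c \<in> tensor_relators R A \<phi> K \<Longrightarrow> c \<in> tensor_kernel R A \<phi> K"
  unfolding tensor_kernel_def by (rule generate.incl)

lemma pure_add_left:
  assumes "a \<in> carrier A" "b \<in> carrier A" "x \<in> carrier K"
  shows "pure (a \<oplus>\<^bsub>A\<^esub> b) x = pure a x \<oplus>\<^bsub>T\<^esub> pure b x"
proof -
  have "frag_of (a \<oplus>\<^bsub>A\<^esub> b, x) - (frag_of (a, x) + frag_of (b, x)) \<in> tensor_relators R A \<phi> K"
    unfolding tensor_relators_def diff_diff_eq[symmetric] using assms by blast
  from cls_eqI[OF relator_mem[OF this]] show ?thesis
    unfolding pure_def using assms by (simp add: cls_add free_carrier_closed)
qed

lemma pure_add_right:
  assumes "a \<in> carrier A" "x \<in> carrier K" "y \<in> carrier K"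
  shows "pure a (x \<oplus>\<^bsub>K\<^esub> y) = pure a x \<oplus>\<^bsub>T\<^esub> pure a y"
proof -
  have "frag_of (a, x \<oplus>\<^bsub>K\<^esub> y) - (frag_of (a, x) + frag_of (a, y)) \<in> tensor_relators R A \<phi> K"
    unfolding tensor_relators_def diff_diff_eq[symmetric] using assms by blast
  from cls_eqI[OF relator_mem[OF this]] show ?thesis
    unfolding pure_def using assms by (simp add: cls_add free_carrier_closed)
qed

lemma pure_balanced:
  assumes "a \<in> carrier A" "r \<in> carrier R" "x \<in> carrier K"
  shows "pure (a \<otimes>\<^bsub>A\<^esub> \<phi> r) x = pure a (r \<odot>\<^bsub>K\<^esub> x)"
proof -
  have "frag_of (a \<otimes>\<^bsub>A\<^esub> \<phi> r, x) - frag_of (a, r \<odot>\<^bsub>K\<^esub> x) \<in> tensor_relators R A \<phi> K"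
    unfolding tensor_relators_def using assms by blast
  from cls_eqI[OF relator_mem[OF this]] show ?thesis
    unfolding pure_def .
qed

lemma tensor_induct [consumes 1, case_names zero add minus pure]:
  assumes v: "v \<in> carrier T" and "P \<zero>\<^bsub>T\<^esub>"
    and add: "\<And>v w. v \<in> carrier T \<Longrightarrow> w \<in> carrier T \<Longrightarrow> P v \<Longrightarrow> P w \<Longrightarrow> P (v \<oplus>\<^bsub>T\<^esub> w)"
    and minus: "\<And>v. v \<in> carrier T \<Longrightarrow> P v \<Longrightarrow> P (\<ominus>\<^bsub>T\<^esub> v)"
    and pure: "\<And>a x. a \<in> carrier A \<Longrightarrow> x \<in> carrier K \<Longrightarrow> P (pure a x)"
  shows "P v"
proof -
  obtain c where c: "c \<in> free_carrier" "v = cls c"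
    using v unfolding tensor_carrier by blast
  have "P (cls c)"
  proof (rule free_Abelian_group_induct[of c "carrier A \<times> carrier K" "\<lambda>c. P (cls c)"])
    show "Poly_Mapping.keys c \<subseteq> carrier A \<times> carrier K"
      using c(1) by (simp add: free_carrier_def)
    show "P (cls 0)"
      using assms(2) by (simp add: cls_zero)
    show "P (cls (frag_of p))" if "p \<in> carrier A \<times> carrier K" for p
      using pure[of "fst p" "snd p"] that unfolding pure_def by auto
    fix d e assume "Poly_Mapping.keys d \<subseteq> carrier A \<times> carrier K" "Poly_Mapping.keys e \<subseteq> carrier A \<times> carrier K"
      and P: "P (cls d)" "P (cls e)"
    then have d: "d \<in> free_carrier" "e \<in> free_carrier"
      by (simp_all add: free_carrier_def)
    then have m: "cls (- e) \<in> carrier T" "cls d \<in> carrier T" "cls e \<in> carrier T"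
      unfolding tensor_carrier by (simp_all add: free_carrier_closed)
    have "cls (- e) \<oplus>\<^bsub>T\<^esub> cls e = \<zero>\<^bsub>T\<^esub>"
      unfolding cls_zero using d by (simp add: cls_add free_carrier_closed)
    then have "cls (- e) = \<ominus>\<^bsub>T\<^esub> cls e"
      using m by (metis T.minus_equality)
    then have "P (cls d \<oplus>\<^bsub>T\<^esub> cls (- e))"
      using add[OF m(2,1) P(1)] minus[OF m(3) P(2)] by simp
    then show "P (cls (d - e))"
      using d by (simp add: cls_add free_carrier_closed)
  qed
  then show ?thesis
    using c(2) by simp
qed

definition tensor_hom :: "(('s \<times> 'k \<Rightarrow>\<^sub>0 int) set \<Rightarrow> ('s \<times> 'k \<Rightarrow>\<^sub>0 int) set) \<Rightarrow> bool" where
  "tensor_hom f \<longleftrightarrow> (\<forall>v\<in>carrier T. f v \<in> carrier T) \<and>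
     (\<forall>v\<in>carrier T. \<forall>w\<in>carrier T. f (v \<oplus>\<^bsub>T\<^esub> w) = f v \<oplus>\<^bsub>T\<^esub> f w)"

lemma tensor_homD:
  assumes "tensor_hom f"
  shows "v \<in> carrier T \<Longrightarrow> f v \<in> carrier T"
    "v \<in> carrier T \<Longrightarrow> w \<in> carrier T \<Longrightarrow> f (v \<oplus>\<^bsub>T\<^esub> w) = f v \<oplus>\<^bsub>T\<^esub> f w"
    "f \<zero>\<^bsub>T\<^esub> = \<zero>\<^bsub>T\<^esub>" "v \<in> carrier T \<Longrightarrow> f (\<ominus>\<^bsub>T\<^esub> v) = \<ominus>\<^bsub>T\<^esub> f v"
proof -
  show cl: "v \<in> carrier T \<Longrightarrow> f v \<in> carrier T"
    and ad: "v \<in> carrier T \<Longrightarrow> w \<in> carrier T \<Longrightarrow> f (v \<oplus>\<^bsub>T\<^esub> w) = f v \<oplus>\<^bsub>T\<^esub> f w" for v w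
    using assms unfolding tensor_hom_def by blast+
  have "f \<zero>\<^bsub>T\<^esub> \<oplus>\<^bsub>T\<^esub> f \<zero>\<^bsub>T\<^esub> = f \<zero>\<^bsub>T\<^esub>"
    using ad[OF T.zero_closed T.zero_closed] by simp
  then show z: "f \<zero>\<^bsub>T\<^esub> = \<zero>\<^bsub>T\<^esub>"
    using cl[OF T.zero_closed] by (metis T.add.r_cancel_one')
  assume v: "v \<in> carrier T"
  have "f (\<ominus>\<^bsub>T\<^esub> v) \<oplus>\<^bsub>T\<^esub> f v = \<zero>\<^bsub>T\<^esub>"
    using ad[OF T.a_inv_closed[OF v] v] z v by (simp add: T.l_neg)
  then show "f (\<ominus>\<^bsub>T\<^esub> v) = \<ominus>\<^bsub>T\<^esub> f v"
    using cl[OF v] cl[OF T.a_inv_closed[OF v]] by (metis T.minus_equality)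
qed

lemma tensor_hom_eqI:
  assumes f: "tensor_hom f" and g: "tensor_hom g" and v: "v \<in> carrier T"
    and pure: "\<And>a x. a \<in> carrier A \<Longrightarrow> x \<in> carrier K \<Longrightarrow> f (pure a x) = g (pure a x)"
  shows "f v = g v"
  using v
  by (induction rule: tensor_induct) (simp_all add: tensor_homD[OF f] tensor_homD[OF g] pure)

lemma tensor_hom_comp:
  assumes "tensor_hom f" "tensor_hom g"
  shows "tensor_hom (\<lambda>v. f (g v))"
  unfolding tensor_hom_def using tensor_homD(1,2)[OF assms(1)] tensor_homD(1,2)[OF assms(2)] by simp

lemma tensor_hom_plus:
  assumes "tensor_hom f" "tensor_hom g"
  shows "tensor_hom (\<lambda>v. f v \<oplus>\<^bsub>T\<^esub> g v)"
  unfolding tensor_hom_def using tensor_homD(1,2)[OF assms(1)] tensor_homD(1,2)[OF assms(2)]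
  by (simp add: T.add.m_ac)

lemma tensor_hom_id: "tensor_hom (\<lambda>v. v)"
  unfolding tensor_hom_def by simp

definition right_linear :: "('s \<Rightarrow> 's) \<Rightarrow> bool" where
  "right_linear \<theta> \<longleftrightarrow> (\<forall>a\<in>carrier A. \<theta> a \<in> carrier A) \<and>
     (\<forall>a\<in>carrier A. \<forall>b\<in>carrier A. \<theta> (a \<oplus>\<^bsub>A\<^esub> b) = \<theta> a \<oplus>\<^bsub>A\<^esub> \<theta> b) \<and>
     (\<forall>a\<in>carrier A. \<forall>r\<in>carrier R. \<theta> (a \<otimes>\<^bsub>A\<^esub> \<phi> r) = \<theta> a \<otimes>\<^bsub>A\<^esub> \<phi> r)"

text \<open>
  A right \<open>R\<close>-linear map \<open>\<theta>\<close> of \<open>A\<close> into itself induces \<open>\<theta> \<otimes> id\<close>. Scalars, group elements and coordinate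
  maps are all of this form, which reduces the identities between them to identities in \<open>A\<close>. The union has the
  same shape as the scalar multiplication of \<open>tensor_module\<close>: it is taken over the representatives of a coset.
\<close>

definition tensor_map ::
    "('s \<Rightarrow> 's) \<Rightarrow> ('s \<times> 'k \<Rightarrow>\<^sub>0 int) set \<Rightarrow> ('s \<times> 'k \<Rightarrow>\<^sub>0 int) set" where
  "tensor_map \<theta> C = (\<Union>c\<in>C. cls (frag_extend (\<lambda>(b, x). frag_of (\<theta> b, x)) c))"

lemma tensor_smult: "a \<odot>\<^bsub>T\<^esub> C = tensor_map (\<lambda>b. a \<otimes>\<^bsub>A\<^esub> b) C"
  unfolding tensor_module_def Let_def tensor_map_def cls_def by simp

context
  fixes \<theta> :: "'s \<Rightarrow> 's"
  assumes rl: "right_linear \<theta>"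
begin

lemma right_linearD:
  "a \<in> carrier A \<Longrightarrow> \<theta> a \<in> carrier A"
  "a \<in> carrier A \<Longrightarrow> b \<in> carrier A \<Longrightarrow> \<theta> (a \<oplus>\<^bsub>A\<^esub> b) = \<theta> a \<oplus>\<^bsub>A\<^esub> \<theta> b"
  "a \<in> carrier A \<Longrightarrow> r \<in> carrier R \<Longrightarrow> \<theta> (a \<otimes>\<^bsub>A\<^esub> \<phi> r) = \<theta> a \<otimes>\<^bsub>A\<^esub> \<phi> r"
  using rl unfolding right_linear_def by blast+

abbreviation "push \<equiv> frag_extend (\<lambda>(b, x). frag_of (\<theta> b, x :: 'k))"

lemma push_closed:
  assumes "c \<in> free_carrier"
  shows "push c \<in> free_carrier"
proof (rule free_Abelian_group_induct[of c "carrier A \<times> carrier K" "\<lambda>c. push c \<in> free_carrier"])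
  show "Poly_Mapping.keys c \<subseteq> carrier A \<times> carrier K"
    using assms by (simp add: free_carrier_def)
  show "push 0 \<in> free_carrier"
    by (simp add: free_carrier_closed)
  show "push (d - e) \<in> free_carrier" if "push d \<in> free_carrier" "push e \<in> free_carrier" for d e
    using that by (simp add: frag_extend_diff free_carrier_closed)
  show "push (frag_of p) \<in> free_carrier" if "p \<in> carrier A \<times> carrier K" for p
    using that by (auto simp: free_carrier_closed right_linearD)
qed

lemma push_relators:
  assumes "c \<in> tensor_relators R A \<phi> K"
  shows "push c \<in> tensor_relators R A \<phi> K"
proof -
  from assms consider (l) a b x where "c = frag_of (a \<oplus>\<^bsub>A\<^esub> b, x) - frag_of (a, x) - frag_of (b, x)"
      "a \<in> carrier A" "b \<in> carrier A" "x \<in> carrier K"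
    | (r) a x y where "c = frag_of (a, x \<oplus>\<^bsub>K\<^esub> y) - frag_of (a, x) - frag_of (a, y)"
      "a \<in> carrier A" "x \<in> carrier K" "y \<in> carrier K"
    | (m) a r x where "c = frag_of (a \<otimes>\<^bsub>A\<^esub> \<phi> r, x) - frag_of (a, r \<odot>\<^bsub>K\<^esub> x)"
      "a \<in> carrier A" "r \<in> carrier R" "x \<in> carrier K"
    unfolding tensor_relators_def by blast
  then show ?thesis
  proof cases
    case l
    then have "push c = frag_of (\<theta> a \<oplus>\<^bsub>A\<^esub> \<theta> b, x) - frag_of (\<theta> a, x) - frag_of (\<theta> b, x)"
      by (simp add: frag_extend_diff right_linearD)
    then show ?thesis
      unfolding tensor_relators_def using l right_linearD(1) by blast
  next
    case r
    then have "push c = frag_of (\<theta> a, x \<oplus>\<^bsub>K\<^esub> y) - frag_of (\<theta> a, x) - frag_of (\<theta> a, y)"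
      by (simp add: frag_extend_diff)
    then show ?thesis
      unfolding tensor_relators_def using r right_linearD(1) by blast
  next
    case m
    then have "push c = frag_of (\<theta> a \<otimes>\<^bsub>A\<^esub> \<phi> r, x) - frag_of (\<theta> a, r \<odot>\<^bsub>K\<^esub> x)"
      by (simp add: frag_extend_diff right_linearD)
    then show ?thesis
      unfolding tensor_relators_def using m right_linearD(1) by blast
  qed
qed

lemma push_kernel:
  assumes "c \<in> tensor_kernel R A \<phi> K"
  shows "push c \<in> tensor_kernel R A \<phi> K"
  using assms unfolding tensor_kernel_def
proof (induction rule: generate.induct)
  case one
  then show ?case
    using tensor_kernel_closed(2) by (simp add: tensor_free_simps tensor_kernel_def)
next
  case (incl h)
  then show ?case
    by (intro generate.incl push_relators)
next
  case (inv h)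
  then have "h \<in> free_carrier"
    using tensor_relators_subset by blast
  then have "inv\<^bsub>tensor_free A K\<^esub> h = - h"
    unfolding tensor_free_def by (intro inv_free_Abelian_group) (simp add: free_carrier_def)
  moreover have "- push h \<in> tensor_kernel R A \<phi> K"
    by (intro tensor_kernel_closed(4) relator_mem push_relators inv)
  ultimately show ?case
    by (simp add: frag_extend_minus tensor_kernel_def)
next
  case (eng h1 h2)
  then show ?case
    using tensor_kernel_closed(3)[of "push h1" "push h2"]
    by (simp add: tensor_free_simps frag_extend_add tensor_kernel_def)
qed

lemma tensor_map_cls:
  assumes "c \<in> free_carrier"
  shows "tensor_map \<theta> (cls c) = cls (push c)"
proof -
  have "cls (push (h + c)) = cls (push c)" if "h \<in> tensor_kernel R A \<phi> K" for h
    by (rule cls_eqI) (simp add: frag_extend_add push_kernel[OF that])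
  then show ?thesis
    unfolding tensor_map_def cls_conv[of c] using tensor_kernel_closed(2) by auto
qed

lemma tensor_map_pure:
  assumes "a \<in> carrier A" "x \<in> carrier K"
  shows "tensor_map \<theta> (pure a x) = pure (\<theta> a) x"
  unfolding pure_def using assms by (simp add: tensor_map_cls free_carrier_closed)

lemma tensor_map_hom: "tensor_hom (tensor_map \<theta>)"
  unfolding tensor_hom_def tensor_carrier
  by (auto simp: tensor_map_cls cls_add frag_extend_add push_closed free_carrier_closed)

end

end

section \<open>Multiplication in the crossed product\<close>

definition restrict_scalars ::
    "('r \<Rightarrow> 's) \<Rightarrow> ('s, 'm, 'b) module_scheme \<Rightarrow> ('r, 'm) module" where
  "restrict_scalars \<phi> M =
     \<lparr>carrier = carrier M, monoid.mult = monoid.mult M, one = \<one>\<^bsub>M\<^esub>, ring.zero = \<zero>\<^bsub>M\<^esub>,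
      ring.add = ring.add M, smult = (\<lambda>r v. \<phi> r \<odot>\<^bsub>M\<^esub> v)\<rparr>"

lemma restrict_scalars_simps [simp]:
  "carrier (restrict_scalars \<phi> M) = carrier M" "\<zero>\<^bsub>restrict_scalars \<phi> M\<^esub> = \<zero>\<^bsub>M\<^esub>"
  "v \<oplus>\<^bsub>restrict_scalars \<phi> M\<^esub> w = v \<oplus>\<^bsub>M\<^esub> w" "r \<odot>\<^bsub>restrict_scalars \<phi> M\<^esub> v = \<phi> r \<odot>\<^bsub>M\<^esub> v"
  by (simp_all add: restrict_scalars_def)

definition monomial :: "('r, 'a) ring_scheme \<Rightarrow> 'r \<Rightarrow> 'g \<Rightarrow> 'g \<Rightarrow> 'r" where
  "monomial R r g = (\<lambda>x. if x = g then r else \<zero>\<^bsub>R\<^esub>)"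

context crossed_system
begin

abbreviation "A \<equiv> crossed_product R G \<sigma> \<rho>"

lemma sigma_hom: "g \<in> carrier G \<Longrightarrow> ring_hom_ring R R (\<sigma> g)"
  using aut by (intro ring_hom_ringI2) (auto simp: ring_iso_def R.ring_axioms)

lemma sigma_closed [simp]: "g \<in> carrier G \<Longrightarrow> r \<in> carrier R \<Longrightarrow> \<sigma> g r \<in> carrier R"
  using aut by (auto simp: ring_iso_def ring_hom_def)

lemma sigma_simps:
  assumes "g \<in> carrier G"
  shows "r \<in> carrier R \<Longrightarrow> s \<in> carrier R \<Longrightarrow> \<sigma> g (r \<oplus> s) = \<sigma> g r \<oplus> \<sigma> g s"
    "r \<in> carrier R \<Longrightarrow> s \<in> carrier R \<Longrightarrow> \<sigma> g (r \<otimes> s) = \<sigma> g r \<otimes> \<sigma> g s"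
    "\<sigma> g \<zero> = \<zero>" "\<sigma> g \<one> = \<one>"
proof -
  interpret s: ring_hom_ring R R "\<sigma> g"
    by (rule sigma_hom[OF assms])
  show "r \<in> carrier R \<Longrightarrow> s \<in> carrier R \<Longrightarrow> \<sigma> g (r \<oplus> s) = \<sigma> g r \<oplus> \<sigma> g s"
    "r \<in> carrier R \<Longrightarrow> s \<in> carrier R \<Longrightarrow> \<sigma> g (r \<otimes> s) = \<sigma> g r \<otimes> \<sigma> g s"
    "\<sigma> g \<zero> = \<zero>" "\<sigma> g \<one> = \<one>"
    by simp_all
qed

lemma rho_closed [simp]: "g \<in> carrier G \<Longrightarrow> h \<in> carrier G \<Longrightarrow> \<rho> g h \<in> carrier R"
  using unit R.Units_closed by blast

definition sigma_inv :: "'g \<Rightarrow> 'r \<Rightarrow> 'r" where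
  "sigma_inv g = inv_into (carrier R) (\<sigma> g)"

lemma sigma_inv_iso: "g \<in> carrier G \<Longrightarrow> sigma_inv g \<in> ring_iso R R"
  unfolding sigma_inv_def by (rule ring_iso_set_sym[OF R.ring_axioms aut])

lemma sigma_inv_closed [simp]: "g \<in> carrier G \<Longrightarrow> r \<in> carrier R \<Longrightarrow> sigma_inv g r \<in> carrier R"
  using sigma_inv_iso by (auto simp: ring_iso_def ring_hom_def)

lemma sigma_inv_simps:
  assumes "g \<in> carrier G"
  shows "r \<in> carrier R \<Longrightarrow> s \<in> carrier R \<Longrightarrow> sigma_inv g (r \<oplus> s) = sigma_inv g r \<oplus> sigma_inv g s"
    "r \<in> carrier R \<Longrightarrow> s \<in> carrier R \<Longrightarrow> sigma_inv g (r \<otimes> s) = sigma_inv g r \<otimes> sigma_inv g s"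
    "sigma_inv g \<zero> = \<zero>" "sigma_inv g \<one> = \<one>"
    "r \<in> carrier R \<Longrightarrow> sigma_inv g (\<sigma> g r) = r" "r \<in> carrier R \<Longrightarrow> \<sigma> g (sigma_inv g r) = r"
proof -
  interpret s: ring_hom_ring R R "sigma_inv g"
    using sigma_inv_iso[OF assms]
    by (intro ring_hom_ringI2) (auto simp: ring_iso_def R.ring_axioms)
  show "r \<in> carrier R \<Longrightarrow> s \<in> carrier R \<Longrightarrow> sigma_inv g (r \<oplus> s) = sigma_inv g r \<oplus> sigma_inv g s"
    "r \<in> carrier R \<Longrightarrow> s \<in> carrier R \<Longrightarrow> sigma_inv g (r \<otimes> s) = sigma_inv g r \<otimes> sigma_inv g s"
    "sigma_inv g \<zero> = \<zero>" "sigma_inv g \<one> = \<one>"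
    by simp_all
  have bij: "bij_betw (\<sigma> g) (carrier R) (carrier R)"
    using aut[OF assms] by (simp add: ring_iso_def)
  show "r \<in> carrier R \<Longrightarrow> sigma_inv g (\<sigma> g r) = r" "r \<in> carrier R \<Longrightarrow> \<sigma> g (sigma_inv g r) = r"
    unfolding sigma_inv_def
    using bij_betw_inv_into_left[OF bij] bij_betw_inv_into_right[OF bij] by blast+
qed

lemma crossed_product_carrier:
  "f \<in> carrier A \<longleftrightarrow> range f \<subseteq> carrier R \<and> finite (supp R f) \<and> supp R f \<subseteq> carrier G"
  by (simp add: crossed_product_def)

lemma crossed_product_coeff [simp]: "f \<in> carrier A \<Longrightarrow> f x \<in> carrier R"
  unfolding crossed_product_carrier by blast

lemma crossed_product_outside: "f \<in> carrier A \<Longrightarrow> x \<notin> carrier G \<Longrightarrow> f x = \<zero>"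
  unfolding crossed_product_carrier supp_def by blast

lemma crossed_product_add [simp]: "(f \<oplus>\<^bsub>A\<^esub> f') x = f x \<oplus> f' x"
  by (simp add: crossed_product_def)

lemma crossed_product_eqI:
  assumes "f \<in> carrier A" "f' \<in> carrier A" "\<And>x. x \<in> carrier G \<Longrightarrow> f x = f' x"
  shows "f = f'"
  using assms crossed_product_outside by (intro ext) metis

lemma crossed_product_closedI:
  assumes "\<And>x. f x \<in> carrier R" "\<And>x. x \<notin> carrier G \<Longrightarrow> f x = \<zero>" "finite S" "\<And>x. x \<notin> S \<Longrightarrow> f x = \<zero>"
  shows "f \<in> carrier A"
  unfolding crossed_product_carrier supp_def using assms finite_subset[of "{g. f g \<noteq> \<zero>}" S] by blast

lemma crossed_product_add_closed:
  assumes "f \<in> carrier A" "f' \<in> carrier A"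
  shows "f \<oplus>\<^bsub>A\<^esub> f' \<in> carrier A"
proof (rule crossed_product_closedI[of _ "supp R f \<union> supp R f'"])
  show "finite (supp R f \<union> supp R f')"
    using assms by (simp add: crossed_product_carrier)
qed (use assms crossed_product_outside[OF assms(1)] crossed_product_outside[OF assms(2)]
    in \<open>auto simp: supp_def\<close>)

lemma monomial_closed:
  assumes "r \<in> carrier R" "g \<in> carrier G"
  shows "monomial R r g \<in> carrier A"
  using assms by (intro crossed_product_closedI[of _ "{g}"]) (auto simp: monomial_def)

lemma coeff_embed_monomial: "coeff_embed R G r = monomial R r \<one>\<^bsub>G\<^esub>"
  by (simp add: coeff_embed_def monomial_def)

lemma crossed_product_mult:
  "(f \<otimes>\<^bsub>A\<^esub> f') x = finsum R (\<lambda>(g, h). f g \<otimes> \<sigma> g (f' h) \<otimes> \<rho> g h)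
     {(g, h) \<in> supp R f \<times> supp R f'. g \<otimes>\<^bsub>G\<^esub> h = x}"
  by (simp add: crossed_product_def)

lemma monomial_mult:
  assumes r: "r \<in> carrier R" and g: "g \<in> carrier G" and f: "f \<in> carrier A" and x: "x \<in> carrier G"
  shows "(monomial R r g \<otimes>\<^bsub>A\<^esub> f) x =
    r \<otimes> \<sigma> g (f (inv\<^bsub>G\<^esub> g \<otimes>\<^bsub>G\<^esub> x)) \<otimes> \<rho> g (inv\<^bsub>G\<^esub> g \<otimes>\<^bsub>G\<^esub> x)"
proof -
  let ?h = "inv\<^bsub>G\<^esub> g \<otimes>\<^bsub>G\<^esub> x"
  let ?S = "{(g', h) \<in> supp R (monomial R r g) \<times> supp R f. g' \<otimes>\<^bsub>G\<^esub> h = x}"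
  let ?t = "\<lambda>(g', h). monomial R r g g' \<otimes> \<sigma> g' (f h) \<otimes> \<rho> g' h"
  have h: "?h \<in> carrier G" "g \<otimes>\<^bsub>G\<^esub> ?h = x"
    using g x by (simp_all add: G.m_assoc[symmetric])
  have S: "?S \<subseteq> {(g, ?h)}"
  proof
    fix p assume "p \<in> ?S"
    then obtain k where k: "p = (g, k)" "k \<in> supp R f" "g \<otimes>\<^bsub>G\<^esub> k = x"
      unfolding supp_def monomial_def by (auto split: if_splits)
    have "k \<in> carrier G"
      using k(2) f unfolding crossed_product_carrier by blast
    then have "k = ?h"
      using g k(3) by (simp add: G.m_assoc[symmetric] flip: k(3))
    then show "p \<in> {(g, ?h)}"
      using k(1) by simp
  qed
  have c: "\<sigma> g (f ?h) \<in> carrier R" "\<rho> g ?h \<in> carrier R"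
    using f g h(1) by simp_all
  have "finsum R ?t ?S = finsum R ?t {(g, ?h)}"
  proof (rule R.add.finprod_mono_neutral_cong_left[OF _ S])
    fix p assume "p \<in> {(g, ?h)} - ?S"
    then have "p = (g, ?h)" "r = \<zero> \<or> f ?h = \<zero>"
      using h(2) by (auto simp: supp_def monomial_def)
    then show "?t p = \<zero>"
      using c r g sigma_simps(3)[OF g] by (auto simp: monomial_def)
  qed (use c r in \<open>auto simp: monomial_def\<close>)
  also have "\<dots> = r \<otimes> \<sigma> g (f ?h) \<otimes> \<rho> g ?h"
    using c r by (simp add: R.finsum_insert monomial_def)
  finally show ?thesis
    unfolding crossed_product_mult .
qed

lemma mult_outside:
  assumes f: "f \<in> carrier A" "f' \<in> carrier A" and x: "x \<notin> carrier G"
  shows "(f \<otimes>\<^bsub>A\<^esub> f') x = \<zero>"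
proof -
  have "{(g, h) \<in> supp R f \<times> supp R f'. g \<otimes>\<^bsub>G\<^esub> h = x} = {}"
    using assms unfolding crossed_product_carrier by blast
  then show ?thesis
    unfolding crossed_product_mult by (simp only: R.finsum_empty)
qed

lemma mult_coeff_embed:
  assumes f: "f \<in> carrier A" and s: "s \<in> carrier R" and x: "x \<in> carrier G"
  shows "(f \<otimes>\<^bsub>A\<^esub> coeff_embed R G s) x = f x \<otimes> \<sigma> x s"
proof -
  let ?S = "{(g', h) \<in> supp R f \<times> supp R (coeff_embed R G s). g' \<otimes>\<^bsub>G\<^esub> h = x}"
  let ?t = "\<lambda>(g', h). f g' \<otimes> \<sigma> g' (coeff_embed R G s h) \<otimes> \<rho> g' h"
  have S: "?S \<subseteq> {(x, \<one>\<^bsub>G\<^esub>)}"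
  proof
    fix p assume "p \<in> ?S"
    then obtain k where k: "p = (k, \<one>\<^bsub>G\<^esub>)" "k \<in> supp R f" "k \<otimes>\<^bsub>G\<^esub> \<one>\<^bsub>G\<^esub> = x"
      unfolding supp_def coeff_embed_def by (auto split: if_splits)
    have "k \<in> carrier G"
      using k(2) f unfolding crossed_product_carrier by blast
    then show "p \<in> {(x, \<one>\<^bsub>G\<^esub>)}"
      using k by simp
  qed
  have c: "f x \<in> carrier R" "\<sigma> x s \<in> carrier R"
    using f s x by simp_all
  have "finsum R ?t ?S = finsum R ?t {(x, \<one>\<^bsub>G\<^esub>)}"
  proof (rule R.add.finprod_mono_neutral_cong_left[OF _ S])
    fix p assume "p \<in> {(x, \<one>\<^bsub>G\<^esub>)} - ?S"
    then have "p = (x, \<one>\<^bsub>G\<^esub>)" "s = \<zero> \<or> f x = \<zero>"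
      using x by (auto simp: supp_def coeff_embed_def)
    then show "?t p = \<zero>"
      using c x sigma_simps(3)[OF x] by (auto simp: coeff_embed_def rho_one)
  qed (use c x in \<open>auto simp: coeff_embed_def rho_one\<close>)
  also have "\<dots> = f x \<otimes> \<sigma> x s"
    using c x by (simp add: R.finsum_insert coeff_embed_def rho_one)
  finally show ?thesis
    unfolding crossed_product_mult .
qed

lemma monomial_mult_closed:
  assumes r: "r \<in> carrier R" and g: "g \<in> carrier G" and f: "f \<in> carrier A"
  shows "monomial R r g \<otimes>\<^bsub>A\<^esub> f \<in> carrier A"
proof (rule crossed_product_closedI[of _ "(\<lambda>h. g \<otimes>\<^bsub>G\<^esub> h) ` supp R f"])
  note m = monomial_closed[OF r g]
  show out: "(monomial R r g \<otimes>\<^bsub>A\<^esub> f) x = \<zero>" if "x \<notin> carrier G" for x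
    by (rule mult_outside[OF m f that])
  show "(monomial R r g \<otimes>\<^bsub>A\<^esub> f) x \<in> carrier R" for x
  proof (cases "x \<in> carrier G")
    case True
    then show ?thesis
      using r g f by (simp add: monomial_mult)
  qed (simp add: out)
  show "finite ((\<lambda>h. g \<otimes>\<^bsub>G\<^esub> h) ` supp R f)"
    using f by (simp add: crossed_product_carrier)
  fix x assume x: "x \<notin> (\<lambda>h. g \<otimes>\<^bsub>G\<^esub> h) ` supp R f"
  show "(monomial R r g \<otimes>\<^bsub>A\<^esub> f) x = \<zero>"
  proof (cases "x \<in> carrier G")
    case True
    let ?h = "inv\<^bsub>G\<^esub> g \<otimes>\<^bsub>G\<^esub> x"
    have "g \<otimes>\<^bsub>G\<^esub> ?h = x" and h: "?h \<in> carrier G"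
      using g True by (simp_all add: G.m_assoc[symmetric])
    then have "f ?h = \<zero>"
      using x unfolding supp_def by force
    then show ?thesis
      using r g f True h by (simp add: monomial_mult sigma_simps)
  qed (rule out)
qed

lemma coeff_embed_mult:
  assumes r: "r \<in> carrier R" and f: "f \<in> carrier A"
  shows "(coeff_embed R G r \<otimes>\<^bsub>A\<^esub> f) x = r \<otimes> f x"
proof (cases "x \<in> carrier G")
  case True
  then show ?thesis
    using r f by (simp add: coeff_embed_monomial monomial_mult sigma_one rho_one)
next
  case False
  then show ?thesis
    using mult_outside[OF monomial_closed[OF r G.one_closed] f False] r
    by (simp add: coeff_embed_monomial crossed_product_outside[OF f False])
qed

lemma mult_coeff_embed_closed:
  assumes f: "f \<in> carrier A" and s: "s \<in> carrier R"
  shows "f \<otimes>\<^bsub>A\<^esub> coeff_embed R G s \<in> carrier A"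
proof (rule crossed_product_closedI[of _ "supp R f"])
  have m: "coeff_embed R G s \<in> carrier A"
    unfolding coeff_embed_monomial by (rule monomial_closed[OF s G.one_closed])
  show out: "(f \<otimes>\<^bsub>A\<^esub> coeff_embed R G s) x = \<zero>" if "x \<notin> carrier G" for x
    by (rule mult_outside[OF f m that])
  show "(f \<otimes>\<^bsub>A\<^esub> coeff_embed R G s) x \<in> carrier R" for x
    using out[of x] f s by (cases "x \<in> carrier G") (simp_all add: mult_coeff_embed)
  show "finite (supp R f)"
    using f by (simp add: crossed_product_carrier)
  fix x assume "x \<notin> supp R f"
  then show "(f \<otimes>\<^bsub>A\<^esub> coeff_embed R G s) x = \<zero>"
    using out[of x] f s by (cases "x \<in> carrier G") (simp_all add: mult_coeff_embed supp_def)
qed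

lemma mult_eq_finsum_monomials:
  assumes a: "a \<in> carrier A" and b: "b \<in> carrier A" and x: "x \<in> carrier G"
  shows "(a \<otimes>\<^bsub>A\<^esub> b) x = finsum R (\<lambda>g. (monomial R (a g) g \<otimes>\<^bsub>A\<^esub> b) x) (supp R a)"
proof -
  let ?q = "\<lambda>g. inv\<^bsub>G\<^esub> g \<otimes>\<^bsub>G\<^esub> x"
  let ?t = "\<lambda>(g, h). a g \<otimes> \<sigma> g (b h) \<otimes> \<rho> g h"
  let ?S' = "{g \<in> supp R a. b (?q g) \<noteq> \<zero>}"
  have sa: "supp R a \<subseteq> carrier G" "finite (supp R a)" and sb: "supp R b \<subseteq> carrier G"
    using a b by (simp_all add: crossed_product_carrier)
  have q: "?q g \<in> carrier G" "g \<otimes>\<^bsub>G\<^esub> ?q g = x" if "g \<in> supp R a" for g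
    using that sa(1) x by (auto simp: G.m_assoc[symmetric])
  have t: "?t (g, ?q g) \<in> carrier R" if "g \<in> supp R a" for g
    using that sa(1) q[OF that] a b by auto
  have "{(g, h) \<in> supp R a \<times> supp R b. g \<otimes>\<^bsub>G\<^esub> h = x} = (\<lambda>g. (g, ?q g)) ` ?S'"
  proof (intro equalityI subsetI)
    fix p assume "p \<in> {(g, h) \<in> supp R a \<times> supp R b. g \<otimes>\<^bsub>G\<^esub> h = x}"
    then obtain g h where p: "p = (g, h)" "g \<in> supp R a" "h \<in> supp R b" "g \<otimes>\<^bsub>G\<^esub> h = x"
      by blast
    then have "g \<in> carrier G" "h \<in> carrier G"
      using sa sb by auto
    then have "h = ?q g"
      unfolding p(4)[symmetric] by (simp add: G.m_assoc[symmetric])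
    then show "p \<in> (\<lambda>g. (g, ?q g)) ` ?S'"
      using p(1-3) by (auto simp: supp_def)
  next
    fix p assume "p \<in> (\<lambda>g. (g, ?q g)) ` ?S'"
    then obtain g where "p = (g, ?q g)" "g \<in> supp R a" "b (?q g) \<noteq> \<zero>"
      by blast
    then show "p \<in> {(g, h) \<in> supp R a \<times> supp R b. g \<otimes>\<^bsub>G\<^esub> h = x}"
      using q[of g] by (auto simp: supp_def)
  qed
  then have "(a \<otimes>\<^bsub>A\<^esub> b) x = finsum R ?t ((\<lambda>g. (g, ?q g)) ` ?S')"
    unfolding crossed_product_mult by simp
  also have "\<dots> = finsum R (\<lambda>g. ?t (g, ?q g)) ?S'"
    using t by (intro R.finsum_reindex) (auto simp: inj_on_def)
  also have "\<dots> = finsum R (\<lambda>g. (monomial R (a g) g \<otimes>\<^bsub>A\<^esub> b) x) (supp R a)"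
  proof (rule R.add.finprod_mono_neutral_cong_left)
    have eq: "(monomial R (a g) g \<otimes>\<^bsub>A\<^esub> b) x = ?t (g, ?q g)" if "g \<in> supp R a" for g
      using that sa(1) monomial_mult[OF _ _ b x, of "a g" g] a by auto
    show "?t (g, ?q g) = (monomial R (a g) g \<otimes>\<^bsub>A\<^esub> b) x" if "g \<in> ?S'" for g
      using eq that by simp
    show "(\<lambda>g. (monomial R (a g) g \<otimes>\<^bsub>A\<^esub> b) x) \<in> supp R a \<rightarrow> carrier R"
      using eq t by simp
    fix g assume "g \<in> supp R a - ?S'"
    then have g: "g \<in> supp R a" "b (?q g) = \<zero>"
      by auto
    then show "(monomial R (a g) g \<otimes>\<^bsub>A\<^esub> b) x = \<zero>"
      unfolding eq[OF g(1)] using sa(1) q[OF g(1)] a sigma_simps(3)[of g] by auto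
  qed (use sa in auto)
  finally show ?thesis .
qed

lemma mult_closed:
  assumes a: "a \<in> carrier A" and b: "b \<in> carrier A"
  shows "a \<otimes>\<^bsub>A\<^esub> b \<in> carrier A"
proof (rule crossed_product_closedI[of _ "(\<lambda>(g, h). g \<otimes>\<^bsub>G\<^esub> h) ` (supp R a \<times> supp R b)"])
  show "finite ((\<lambda>(g, h). g \<otimes>\<^bsub>G\<^esub> h) ` (supp R a \<times> supp R b))"
    using a b by (simp add: crossed_product_carrier)
  show "(a \<otimes>\<^bsub>A\<^esub> b) x = \<zero>" if "x \<notin> carrier G" for x
    by (rule mult_outside[OF a b that])
  show "(a \<otimes>\<^bsub>A\<^esub> b) x \<in> carrier R" for x
    unfolding crossed_product_mult
  proof (rule R.finsum_closed, rule Pi_I)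
    fix p assume "p \<in> {(g, h) \<in> supp R a \<times> supp R b. g \<otimes>\<^bsub>G\<^esub> h = x}"
    then obtain g h where "p = (g, h)" "g \<in> carrier G" "h \<in> carrier G"
      using a b unfolding crossed_product_carrier by blast
    then show "(case p of (g, h) \<Rightarrow> a g \<otimes> \<sigma> g (b h) \<otimes> \<rho> g h) \<in> carrier R"
      using a b by simp
  qed
  fix x assume x: "x \<notin> (\<lambda>(g, h). g \<otimes>\<^bsub>G\<^esub> h) ` (supp R a \<times> supp R b)"
  then have "{(g, h) \<in> supp R a \<times> supp R b. g \<otimes>\<^bsub>G\<^esub> h = x} = {}"
    by auto
  then show "(a \<otimes>\<^bsub>A\<^esub> b) x = \<zero>"
    unfolding crossed_product_mult by (simp only: R.finsum_empty)
qed

end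

section \<open>The induced module as a twisted graded module\<close>

locale crossed_extension = crossed_system R G \<sigma> \<rho> + K: left_module R K
  for R :: "('r, 'a) ring_scheme" (structure) and G :: "('g, 'b) monoid_scheme" (structure)
    and \<sigma> \<rho> and K :: "('r, 'k, 'c) module_scheme" (structure)
begin

sublocale E: scalar_extension R K A "coeff_embed R G"
  by unfold_locales (simp_all add: crossed_product_add_closed mult_coeff_embed_closed)

abbreviation "T \<equiv> induced_module R G \<sigma> \<rho> K"

abbreviation "V \<equiv> restrict_scalars (coeff_embed R G) T"

definition \<gamma> :: "'g \<Rightarrow> (('g \<Rightarrow> 'r) \<times> 'k \<Rightarrow>\<^sub>0 int) set \<Rightarrow> (('g \<Rightarrow> 'r) \<times> 'k \<Rightarrow>\<^sub>0 int) set" where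
  "\<gamma> g v = monomial R \<one> g \<odot>\<^bsub>T\<^esub> v"

text \<open>
  In the crossed product, \<open>b\<^sub>h h = h r\<close> with \<open>r = \<sigma>(h)\<^sup>-\<^sup>1(b\<^sub>h)\<close>. So this is the coefficient of \<open>b\<close> at \<open>h\<close> with respect
  to the basis \<open>G\<close> of \<open>R * G\<close> as a right \<open>R\<close>-module, placed at the identity.
\<close>

definition coord_coeff :: "'g \<Rightarrow> ('g \<Rightarrow> 'r) \<Rightarrow> 'g \<Rightarrow> 'r" where
  "coord_coeff h b = coeff_embed R G (sigma_inv h (b h))"

definition coord :: "'g \<Rightarrow> (('g \<Rightarrow> 'r) \<times> 'k \<Rightarrow>\<^sub>0 int) set \<Rightarrow> (('g \<Rightarrow> 'r) \<times> 'k \<Rightarrow>\<^sub>0 int) set" where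
  "coord h = E.tensor_map (coord_coeff h)"

lemma T_eq: "T = E.T"
  by (simp add: induced_module_def)

lemma coeff_embed_closed: "r \<in> carrier R \<Longrightarrow> coeff_embed R G r \<in> carrier A"
  unfolding coeff_embed_monomial by (rule monomial_closed) auto

lemma coeff_embed_apply [simp]:
  "coeff_embed R G r \<one>\<^bsub>G\<^esub> = r" "x \<noteq> \<one>\<^bsub>G\<^esub> \<Longrightarrow> coeff_embed R G r x = \<zero>"
  by (simp_all add: coeff_embed_def)

lemma coeff_embed_mult_closed: "r \<in> carrier R \<Longrightarrow> f \<in> carrier A \<Longrightarrow> coeff_embed R G r \<otimes>\<^bsub>A\<^esub> f \<in> carrier A"
  unfolding coeff_embed_monomial by (rule monomial_mult_closed) auto

lemma coeff_embed_add:
  "r \<in> carrier R \<Longrightarrow> s \<in> carrier R \<Longrightarrow> coeff_embed R G (r \<oplus> s) = coeff_embed R G r \<oplus>\<^bsub>A\<^esub> coeff_embed R G s"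
  by (intro crossed_product_eqI coeff_embed_closed crossed_product_add_closed)
    (auto simp: coeff_embed_def)

lemma coeff_embed_mult_coeff_embed:
  assumes "r \<in> carrier R" "s \<in> carrier R"
  shows "coeff_embed R G r \<otimes>\<^bsub>A\<^esub> coeff_embed R G s = coeff_embed R G (r \<otimes> s)"
proof
  fix x
  show "(coeff_embed R G r \<otimes>\<^bsub>A\<^esub> coeff_embed R G s) x = coeff_embed R G (r \<otimes> s) x"
    using assms by (simp add: coeff_embed_mult coeff_embed_closed) (simp add: coeff_embed_def)
qed

text \<open>
  Right linearity is the special case of associativity that expresses the axiom \<open>twisted\<close>: a scalar can be
  moved past \<open>g\<close> and \<open>h\<close> one at a time or past their product.
\<close>

lemma right_linear_monomial:
  assumes r: "r \<in> carrier R" and g: "g \<in> carrier G"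
  shows "E.right_linear (\<lambda>b. monomial R r g \<otimes>\<^bsub>A\<^esub> b)"
  unfolding E.right_linear_def
proof (intro conjI ballI)
  note closed = monomial_mult_closed[OF r g]
  show "monomial R r g \<otimes>\<^bsub>A\<^esub> b \<in> carrier A" if "b \<in> carrier A" for b
    by (rule closed[OF that])
  show "monomial R r g \<otimes>\<^bsub>A\<^esub> (b \<oplus>\<^bsub>A\<^esub> b') = monomial R r g \<otimes>\<^bsub>A\<^esub> b \<oplus>\<^bsub>A\<^esub> monomial R r g \<otimes>\<^bsub>A\<^esub> b'"
    if b: "b \<in> carrier A" "b' \<in> carrier A" for b b'
  proof (rule crossed_product_eqI)
    fix x assume x: "x \<in> carrier G"
    then have h: "inv\<^bsub>G\<^esub> g \<otimes>\<^bsub>G\<^esub> x \<in> carrier G"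
      using g by simp
    show "(monomial R r g \<otimes>\<^bsub>A\<^esub> (b \<oplus>\<^bsub>A\<^esub> b')) x = (monomial R r g \<otimes>\<^bsub>A\<^esub> b \<oplus>\<^bsub>A\<^esub> monomial R r g \<otimes>\<^bsub>A\<^esub> b') x"
      using r g b x h
      by (simp add: monomial_mult crossed_product_add_closed sigma_simps R.r_distr R.l_distr)
  qed (use b closed crossed_product_add_closed in blast)+
  show "monomial R r g \<otimes>\<^bsub>A\<^esub> (b \<otimes>\<^bsub>A\<^esub> coeff_embed R G s) = monomial R r g \<otimes>\<^bsub>A\<^esub> b \<otimes>\<^bsub>A\<^esub> coeff_embed R G s"
    if b: "b \<in> carrier A" and s: "s \<in> carrier R" for b s
  proof (rule crossed_product_eqI)
    fix x assume x: "x \<in> carrier G"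
    let ?h = "inv\<^bsub>G\<^esub> g \<otimes>\<^bsub>G\<^esub> x"
    have h: "?h \<in> carrier G" "g \<otimes>\<^bsub>G\<^esub> ?h = x"
      using g x by (simp_all add: G.m_assoc[symmetric])
    have u: "\<rho> g ?h \<in> Units R"
      by (rule unit[OF g h(1)])
    then have ui: "inv (\<rho> g ?h) \<in> carrier R" "inv (\<rho> g ?h) \<otimes> \<rho> g ?h = \<one>"
      by simp_all
    have c: "\<sigma> g (b ?h) \<in> carrier R" "\<rho> g ?h \<in> carrier R" "\<sigma> x s \<in> carrier R"
      using b g h(1) x s by simp_all
    have "\<sigma> g (\<sigma> ?h s) \<otimes> \<rho> g ?h = \<rho> g ?h \<otimes> \<sigma> x s \<otimes> inv (\<rho> g ?h) \<otimes> \<rho> g ?h"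
      using twisted[OF s g h(1)] h(2) by simp
    also have "\<dots> = \<rho> g ?h \<otimes> \<sigma> x s"
      using c ui by (simp add: R.m_assoc)
    finally have tw: "\<sigma> g (\<sigma> ?h s) \<otimes> \<rho> g ?h = \<rho> g ?h \<otimes> \<sigma> x s" .
    have "(monomial R r g \<otimes>\<^bsub>A\<^esub> (b \<otimes>\<^bsub>A\<^esub> coeff_embed R G s)) x =
        r \<otimes> (\<sigma> g (b ?h) \<otimes> \<sigma> g (\<sigma> ?h s)) \<otimes> \<rho> g ?h"
      using r g b s x h
      by (simp add: monomial_mult mult_coeff_embed mult_coeff_embed_closed sigma_simps)
    also have "\<dots> = r \<otimes> \<sigma> g (b ?h) \<otimes> (\<sigma> g (\<sigma> ?h s) \<otimes> \<rho> g ?h)"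
      using r c g h(1) s by (simp add: R.m_assoc)
    also have "\<dots> = r \<otimes> \<sigma> g (b ?h) \<otimes> \<rho> g ?h \<otimes> \<sigma> x s"
      unfolding tw using r c by (simp add: R.m_assoc)
    also have "\<dots> = (monomial R r g \<otimes>\<^bsub>A\<^esub> b \<otimes>\<^bsub>A\<^esub> coeff_embed R G s) x"
      using r g b s x by (simp add: monomial_mult mult_coeff_embed monomial_mult_closed)
    finally show "(monomial R r g \<otimes>\<^bsub>A\<^esub> (b \<otimes>\<^bsub>A\<^esub> coeff_embed R G s)) x =
        (monomial R r g \<otimes>\<^bsub>A\<^esub> b \<otimes>\<^bsub>A\<^esub> coeff_embed R G s) x" .
  qed (use b s closed mult_coeff_embed_closed in blast)+
qed

lemma right_linear_coord:
  assumes h: "h \<in> carrier G"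
  shows "E.right_linear (coord_coeff h)"
  unfolding E.right_linear_def coord_coeff_def
  using h by (auto simp: coeff_embed_closed sigma_inv_simps coeff_embed_add mult_coeff_embed
      coeff_embed_mult_coeff_embed)

lemma tensor_hom_smult:
  assumes "r \<in> carrier R" "g \<in> carrier G"
  shows "E.tensor_hom (\<lambda>v. monomial R r g \<odot>\<^bsub>T\<^esub> v)"
  unfolding T_eq E.tensor_smult by (rule E.tensor_map_hom[OF right_linear_monomial[OF assms]])

lemma smult_pure:
  assumes "r \<in> carrier R" "g \<in> carrier G" "b \<in> carrier A" "x \<in> carrier K"
  shows "monomial R r g \<odot>\<^bsub>T\<^esub> E.pure b x = E.pure (monomial R r g \<otimes>\<^bsub>A\<^esub> b) x"
  unfolding T_eq E.tensor_smult
  by (rule E.tensor_map_pure[OF right_linear_monomial[OF assms(1,2)] assms(3,4)])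

lemma tensor_hom_scalar: "r \<in> carrier R \<Longrightarrow> E.tensor_hom (\<lambda>v. coeff_embed R G r \<odot>\<^bsub>T\<^esub> v)"
  unfolding coeff_embed_monomial[of r] by (rule tensor_hom_smult) auto

lemma scalar_pure:
  assumes "r \<in> carrier R" "b \<in> carrier A" "x \<in> carrier K"
  shows "coeff_embed R G r \<odot>\<^bsub>T\<^esub> E.pure b x = E.pure (coeff_embed R G r \<otimes>\<^bsub>A\<^esub> b) x"
  unfolding coeff_embed_monomial[of r] using assms by (intro smult_pure) auto

lemma tensor_hom_gamma: "g \<in> carrier G \<Longrightarrow> E.tensor_hom (\<gamma> g)"
  unfolding \<gamma>_def by (rule tensor_hom_smult) auto

lemma gamma_pure:
  assumes "g \<in> carrier G" "b \<in> carrier A" "x \<in> carrier K"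
  shows "\<gamma> g (E.pure b x) = E.pure (monomial R \<one> g \<otimes>\<^bsub>A\<^esub> b) x"
  unfolding \<gamma>_def using assms by (intro smult_pure) auto

lemma tensor_hom_coord: "h \<in> carrier G \<Longrightarrow> E.tensor_hom (coord h)"
  unfolding coord_def by (rule E.tensor_map_hom[OF right_linear_coord])

lemma coord_pure:
  assumes "h \<in> carrier G" "b \<in> carrier A" "x \<in> carrier K"
  shows "coord h (E.pure b x) = E.pure (coord_coeff h b) x"
  unfolding coord_def by (rule E.tensor_map_pure[OF right_linear_coord[OF assms(1)] assms(2,3)])

lemma coord_coeff_closed: "h \<in> carrier G \<Longrightarrow> b \<in> carrier A \<Longrightarrow> coord_coeff h b \<in> carrier A"
  unfolding coord_coeff_def by (simp add: coeff_embed_closed)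

lemma left_module_V: "left_module R V"
proof -
  have hom: "E.tensor_hom (\<lambda>v. coeff_embed R G r \<odot>\<^bsub>T\<^esub> v)" if "r \<in> carrier R" for r
    by (rule tensor_hom_scalar[OF that])
  have ag: "abelian_group V"
  proof (rule abelian_groupI)
    fix v assume "v \<in> carrier V"
    then show "\<exists>w\<in>carrier V. w \<oplus>\<^bsub>V\<^esub> v = \<zero>\<^bsub>V\<^esub>"
      by (intro bexI[of _ "\<ominus>\<^bsub>E.T\<^esub> v"]) (simp_all add: T_eq E.T.l_neg)
  qed (simp_all add: T_eq E.T.add.m_ac)
  show ?thesis
  proof (intro left_module.intro left_module_axioms.intro)
    show "ring R" by (rule R.ring_axioms)
    show "abelian_group V" by (rule ag)
    show "r \<odot>\<^bsub>V\<^esub> v \<in> carrier V" if "r \<in> carrier R" "v \<in> carrier V" for r v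
      using E.tensor_homD(1)[OF hom[OF that(1)]] that(2) by (simp add: T_eq)
    show "(r \<oplus> s) \<odot>\<^bsub>V\<^esub> v = r \<odot>\<^bsub>V\<^esub> v \<oplus>\<^bsub>V\<^esub> s \<odot>\<^bsub>V\<^esub> v"
      if r: "r \<in> carrier R" "s \<in> carrier R" and "v \<in> carrier V" for r s v
    proof -
      have "coeff_embed R G (r \<oplus> s) \<odot>\<^bsub>T\<^esub> v = coeff_embed R G r \<odot>\<^bsub>T\<^esub> v \<oplus>\<^bsub>E.T\<^esub> coeff_embed R G s \<odot>\<^bsub>T\<^esub> v"
      proof (rule E.tensor_hom_eqI[OF hom E.tensor_hom_plus[OF hom hom]])
        fix b x assume b: "b \<in> carrier A" and x: "x \<in> carrier K"
        have "coeff_embed R G (r \<oplus> s) \<otimes>\<^bsub>A\<^esub> b = coeff_embed R G r \<otimes>\<^bsub>A\<^esub> b \<oplus>\<^bsub>A\<^esub> coeff_embed R G s \<otimes>\<^bsub>A\<^esub> b"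
          using r b by (intro ext) (simp add: coeff_embed_mult R.l_distr)
        then show "coeff_embed R G (r \<oplus> s) \<odot>\<^bsub>T\<^esub> E.pure b x =
            coeff_embed R G r \<odot>\<^bsub>T\<^esub> E.pure b x \<oplus>\<^bsub>E.T\<^esub> coeff_embed R G s \<odot>\<^bsub>T\<^esub> E.pure b x"
          using r b x by (simp add: scalar_pure E.pure_add_left coeff_embed_mult_closed)
      qed (use that in \<open>simp_all add: T_eq\<close>)
      then show ?thesis
        by (simp add: T_eq)
    qed
    show "r \<odot>\<^bsub>V\<^esub> (v \<oplus>\<^bsub>V\<^esub> w) = r \<odot>\<^bsub>V\<^esub> v \<oplus>\<^bsub>V\<^esub> r \<odot>\<^bsub>V\<^esub> w"
      if "r \<in> carrier R" "v \<in> carrier V" "w \<in> carrier V" for r v w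
      using E.tensor_homD(2)[OF hom[OF that(1)]] that(2,3) by (simp add: T_eq)
    show "(r \<otimes> s) \<odot>\<^bsub>V\<^esub> v = r \<odot>\<^bsub>V\<^esub> (s \<odot>\<^bsub>V\<^esub> v)"
      if r: "r \<in> carrier R" "s \<in> carrier R" and "v \<in> carrier V" for r s v
    proof -
      have "coeff_embed R G (r \<otimes> s) \<odot>\<^bsub>T\<^esub> v = coeff_embed R G r \<odot>\<^bsub>T\<^esub> (coeff_embed R G s \<odot>\<^bsub>T\<^esub> v)"
      proof (rule E.tensor_hom_eqI[OF hom E.tensor_hom_comp[OF hom hom]])
        fix b x assume b: "b \<in> carrier A" and x: "x \<in> carrier K"
        have "coeff_embed R G (r \<otimes> s) \<otimes>\<^bsub>A\<^esub> b = coeff_embed R G r \<otimes>\<^bsub>A\<^esub> (coeff_embed R G s \<otimes>\<^bsub>A\<^esub> b)"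
          using r b by (intro ext) (simp add: coeff_embed_mult coeff_embed_mult_closed R.m_assoc)
        then show "coeff_embed R G (r \<otimes> s) \<odot>\<^bsub>T\<^esub> E.pure b x =
            coeff_embed R G r \<odot>\<^bsub>T\<^esub> (coeff_embed R G s \<odot>\<^bsub>T\<^esub> E.pure b x)"
          using r b x by (simp add: scalar_pure coeff_embed_mult_closed)
      qed (use that in \<open>simp_all add: T_eq\<close>)
      then show ?thesis
        by simp
    qed
    show "\<one> \<odot>\<^bsub>V\<^esub> v = v" if "v \<in> carrier V" for v
    proof -
      have "coeff_embed R G \<one> \<odot>\<^bsub>T\<^esub> v = v"
      proof (rule E.tensor_hom_eqI[OF hom E.tensor_hom_id])
        fix b x assume b: "b \<in> carrier A" and x: "x \<in> carrier K"
        have "coeff_embed R G \<one> \<otimes>\<^bsub>A\<^esub> b = b"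
          using b by (intro ext) (simp add: coeff_embed_mult)
        then show "coeff_embed R G \<one> \<odot>\<^bsub>T\<^esub> E.pure b x = E.pure b x"
          using b x by (simp add: scalar_pure)
      qed (use that in \<open>simp_all add: T_eq\<close>)
      then show ?thesis
        by simp
    qed
  qed
qed

lemma gamma_scalar:
  assumes g: "g \<in> carrier G" and r: "r \<in> carrier R" and v: "v \<in> carrier V"
  shows "\<gamma> g (r \<odot>\<^bsub>V\<^esub> v) = \<sigma> g r \<odot>\<^bsub>V\<^esub> \<gamma> g v"
proof -
  have sr: "\<sigma> g r \<in> carrier R"
    using g r by simp
  have "\<gamma> g (coeff_embed R G r \<odot>\<^bsub>T\<^esub> v) = coeff_embed R G (\<sigma> g r) \<odot>\<^bsub>T\<^esub> \<gamma> g v"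
  proof (rule E.tensor_hom_eqI[OF E.tensor_hom_comp[OF tensor_hom_gamma[OF g] tensor_hom_scalar[OF r]]
        E.tensor_hom_comp[OF tensor_hom_scalar[OF sr] tensor_hom_gamma[OF g]]])
    show "v \<in> carrier E.T"
      using v by (simp add: T_eq)
    fix b x assume b: "b \<in> carrier A" and x: "x \<in> carrier K"
    have mb: "monomial R \<one> g \<otimes>\<^bsub>A\<^esub> b \<in> carrier A"
      using g b by (intro monomial_mult_closed) auto
    have "monomial R \<one> g \<otimes>\<^bsub>A\<^esub> (coeff_embed R G r \<otimes>\<^bsub>A\<^esub> b) =
        coeff_embed R G (\<sigma> g r) \<otimes>\<^bsub>A\<^esub> (monomial R \<one> g \<otimes>\<^bsub>A\<^esub> b)"
    proof (rule crossed_product_eqI)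
      show "monomial R \<one> g \<otimes>\<^bsub>A\<^esub> (coeff_embed R G r \<otimes>\<^bsub>A\<^esub> b) \<in> carrier A"
        using g r b by (intro monomial_mult_closed coeff_embed_mult_closed) auto
      show "coeff_embed R G (\<sigma> g r) \<otimes>\<^bsub>A\<^esub> (monomial R \<one> g \<otimes>\<^bsub>A\<^esub> b) \<in> carrier A"
        by (rule coeff_embed_mult_closed[OF sr mb])
      fix y assume y: "y \<in> carrier G"
      show "(monomial R \<one> g \<otimes>\<^bsub>A\<^esub> (coeff_embed R G r \<otimes>\<^bsub>A\<^esub> b)) y =
          (coeff_embed R G (\<sigma> g r) \<otimes>\<^bsub>A\<^esub> (monomial R \<one> g \<otimes>\<^bsub>A\<^esub> b)) y"
        using g r b y mb
        by (simp add: coeff_embed_mult coeff_embed_mult_closed monomial_mult sigma_simps R.m_assoc)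
    qed
    then show "\<gamma> g (coeff_embed R G r \<odot>\<^bsub>T\<^esub> E.pure b x) =
        coeff_embed R G (\<sigma> g r) \<odot>\<^bsub>T\<^esub> \<gamma> g (E.pure b x)"
      using g r b x sr mb by (simp add: scalar_pure gamma_pure coeff_embed_mult_closed)
  qed
  then show ?thesis
    by simp
qed

lemma coord_scalar:
  assumes g: "g \<in> carrier G" and r: "r \<in> carrier R" and v: "v \<in> carrier V"
  shows "coord g (\<sigma> g r \<odot>\<^bsub>V\<^esub> v) = r \<odot>\<^bsub>V\<^esub> coord g v"
proof -
  have sr: "\<sigma> g r \<in> carrier R"
    using g r by simp
  have "coord g (coeff_embed R G (\<sigma> g r) \<odot>\<^bsub>T\<^esub> v) = coeff_embed R G r \<odot>\<^bsub>T\<^esub> coord g v"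
  proof (rule E.tensor_hom_eqI[OF E.tensor_hom_comp[OF tensor_hom_coord[OF g] tensor_hom_scalar[OF sr]]
        E.tensor_hom_comp[OF tensor_hom_scalar[OF r] tensor_hom_coord[OF g]]])
    show "v \<in> carrier E.T"
      using v by (simp add: T_eq)
    fix b x assume b: "b \<in> carrier A" and x: "x \<in> carrier K"
    have "coord_coeff g (coeff_embed R G (\<sigma> g r) \<otimes>\<^bsub>A\<^esub> b) = coeff_embed R G r \<otimes>\<^bsub>A\<^esub> coord_coeff g b"
      unfolding coord_coeff_def using g r b sr
      by (simp add: coeff_embed_mult coeff_embed_mult_coeff_embed sigma_inv_simps)
    then show "coord g (coeff_embed R G (\<sigma> g r) \<odot>\<^bsub>T\<^esub> E.pure b x) =
        coeff_embed R G r \<odot>\<^bsub>T\<^esub> coord g (E.pure b x)"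
      using g r b x sr by (simp add: scalar_pure coord_pure coeff_embed_mult_closed coord_coeff_closed)
  qed
  then show ?thesis
    by simp
qed

text \<open>
  The group elements multiply by \<open>g h = \<rho>(g, h) gh\<close>, so multiplication by \<open>g\<close> moves the coordinate at \<open>h\<close> to
  \<open>gh\<close> up to the factor \<open>\<rho>(g, h)\<close>, written on the right of \<open>gh\<close>.
\<close>

lemma coord_gamma_scalar:
  assumes g: "g \<in> carrier G" and h: "h \<in> carrier G" and v: "v \<in> carrier V"
  shows "coord (g \<otimes>\<^bsub>G\<^esub> h) (\<gamma> g v) = sigma_inv (g \<otimes>\<^bsub>G\<^esub> h) (\<rho> g h) \<odot>\<^bsub>V\<^esub> coord h v"
proof -
  let ?k = "g \<otimes>\<^bsub>G\<^esub> h"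
  let ?s = "sigma_inv ?k (\<rho> g h)"
  have k: "?k \<in> carrier G" "inv\<^bsub>G\<^esub> g \<otimes>\<^bsub>G\<^esub> ?k = h"
    using g h by (simp_all add: G.m_assoc[symmetric])
  have s: "?s \<in> carrier R"
    using k g h by simp
  have "coord ?k (\<gamma> g v) = coeff_embed R G ?s \<odot>\<^bsub>T\<^esub> coord h v"
  proof (rule E.tensor_hom_eqI[OF E.tensor_hom_comp[OF tensor_hom_coord[OF k(1)] tensor_hom_gamma[OF g]]
        E.tensor_hom_comp[OF tensor_hom_scalar[OF s] tensor_hom_coord[OF h]]])
    show "v \<in> carrier E.T"
      using v by (simp add: T_eq)
    fix b x assume b: "b \<in> carrier A" and x: "x \<in> carrier K"
    let ?t = "sigma_inv h (b h)"
    have t: "?t \<in> carrier R" "\<sigma> h ?t = b h"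
      using h b by (simp_all add: sigma_inv_simps)
    have mb: "monomial R \<one> g \<otimes>\<^bsub>A\<^esub> b \<in> carrier A"
      using g b by (intro monomial_mult_closed) auto
    have u: "inv (\<rho> g h) \<in> carrier R" "inv (\<rho> g h) \<otimes> \<rho> g h = \<one>"
      using unit[OF g h] by simp_all
    have c: "\<sigma> ?k ?t \<in> carrier R" "\<rho> g h \<in> carrier R" "\<sigma> g (b h) \<in> carrier R"
      using k t g h b by simp_all
    have "(monomial R \<one> g \<otimes>\<^bsub>A\<^esub> b) ?k = \<sigma> g (\<sigma> h ?t) \<otimes> \<rho> g h"
      using g b k t(2) c by (simp add: monomial_mult)
    also have "\<dots> = \<rho> g h \<otimes> \<sigma> ?k ?t"
      unfolding twisted[OF t(1) g h] using c u by (simp add: R.m_assoc)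
    finally have "coord_coeff ?k (monomial R \<one> g \<otimes>\<^bsub>A\<^esub> b) = coeff_embed R G ?s \<otimes>\<^bsub>A\<^esub> coord_coeff h b"
      unfolding coord_coeff_def using k(1) t(1) s c
      by (simp add: sigma_inv_simps coeff_embed_mult_coeff_embed)
    then show "coord ?k (\<gamma> g (E.pure b x)) = coeff_embed R G ?s \<odot>\<^bsub>T\<^esub> coord h (E.pure b x)"
      using g h k(1) b x s mb by (simp add: gamma_pure coord_pure scalar_pure coord_coeff_closed)
  qed
  then show ?thesis
    by simp
qed

lemma coord_gamma_zero_iff:
  assumes g: "g \<in> carrier G" and h: "h \<in> carrier G" and v: "v \<in> carrier V"
  shows "coord (g \<otimes>\<^bsub>G\<^esub> h) (\<gamma> g v) = \<zero>\<^bsub>V\<^esub> \<longleftrightarrow> coord h v = \<zero>\<^bsub>V\<^esub>"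
proof -
  interpret V: left_module R V
    by (rule left_module_V)
  let ?k = "g \<otimes>\<^bsub>G\<^esub> h"
  let ?s = "sigma_inv ?k (\<rho> g h)" and ?s' = "sigma_inv ?k (inv (\<rho> g h))"
  have k: "?k \<in> carrier G"
    using g h by simp
  have u: "inv (\<rho> g h) \<in> carrier R" "inv (\<rho> g h) \<otimes> \<rho> g h = \<one>"
    using unit[OF g h] by simp_all
  have s: "?s \<in> carrier R" "?s' \<in> carrier R"
    using k g h u by simp_all
  have inv: "?s' \<otimes> ?s = \<one>"
    using sigma_inv_simps(2)[OF k u(1), of "\<rho> g h"] u g h k by (simp add: sigma_inv_simps)
  have cv: "coord h v \<in> carrier V"
    using E.tensor_homD(1)[OF tensor_hom_coord[OF h]] v by (simp add: T_eq)
  have "coord h v = ?s' \<odot>\<^bsub>V\<^esub> (?s \<odot>\<^bsub>V\<^esub> coord h v)"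
    using V.smult_assoc1[OF s(2,1) cv] inv V.smult_one[OF cv] by simp
  then show ?thesis
    unfolding coord_gamma_scalar[OF g h v] using V.smult_r_null s by metis
qed

lemma pure_sum_monomials:
  assumes "finite S" "S \<subseteq> carrier G" and b: "b \<in> carrier A" and x: "x \<in> carrier K"
  shows "finsum V (\<lambda>g. E.pure (monomial R (b g) g) x) S = E.pure (\<lambda>y. if y \<in> S then b y else \<zero>) x"
proof -
  interpret V: left_module R V
    by (rule left_module_V)
  have mem: "(\<lambda>y. if y \<in> S then b y else \<zero>) \<in> carrier A" if "finite S" "S \<subseteq> carrier G" for S
    using that b by (intro crossed_product_closedI[of _ S]) auto
  have m: "monomial R (b g) g \<in> carrier A" if "g \<in> carrier G" for g
    using b that by (intro monomial_closed) auto
  show ?thesis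
    using assms(1,2)
  proof (induction S rule: finite_induct)
    case empty
    have z: "(\<lambda>y. \<zero>) \<in> carrier A"
      using mem[of "{}"] by simp
    have "(\<lambda>y. \<zero>) \<oplus>\<^bsub>A\<^esub> (\<lambda>y. \<zero>) = (\<lambda>y. \<zero>)"
      by (rule ext) simp
    then have "E.pure (\<lambda>y. \<zero>) x \<oplus>\<^bsub>E.T\<^esub> E.pure (\<lambda>y. \<zero>) x = E.pure (\<lambda>y. \<zero>) x"
      using E.pure_add_left[OF z z x] by simp
    then have "E.pure (\<lambda>y. \<zero>) x = \<zero>\<^bsub>E.T\<^esub>"
      using E.pure_closed[OF z x] by (metis E.T.add.r_cancel_one')
    then show ?case
      by (simp add: T_eq V.M.finsum_empty[unfolded T_eq])
  next
    case (insert g S)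
    then have g: "g \<in> carrier G" and S: "S \<subseteq> carrier G"
      by auto
    have "finsum V (\<lambda>g. E.pure (monomial R (b g) g) x) (insert g S) =
        E.pure (monomial R (b g) g) x \<oplus>\<^bsub>V\<^esub> finsum V (\<lambda>g. E.pure (monomial R (b g) g) x) S"
      by (rule V.M.finsum_insert[OF insert.hyps])
        (use S g E.pure_closed[OF m x] in \<open>auto simp: T_eq\<close>)
    also have "\<dots> = E.pure (monomial R (b g) g \<oplus>\<^bsub>A\<^esub> (\<lambda>y. if y \<in> S then b y else \<zero>)) x"
      using insert.IH[OF S] E.pure_add_left[OF m[OF g] mem[OF insert.hyps(1) S] x] by (simp add: T_eq)
    also have "monomial R (b g) g \<oplus>\<^bsub>A\<^esub> (\<lambda>y. if y \<in> S then b y else \<zero>) =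
        (\<lambda>y. if y \<in> insert g S then b y else \<zero>)"
      using insert.hyps(2) b by (intro ext) (auto simp: monomial_def)
    finally show ?case .
  qed
qed

text \<open>
  The claim is made for some finite set \<open>S\<close> rather than for the exact support of \<open>v\<close>, as only this form is
  stable under addition.
\<close>

lemma coord_support:
  assumes v: "v \<in> carrier V"
  shows "\<exists>S. finite S \<and> S \<subseteq> carrier G \<and> (\<forall>g\<in>carrier G - S. coord g v = \<zero>\<^bsub>V\<^esub>) \<and>
    (\<forall>E. finite E \<longrightarrow> S \<subseteq> E \<longrightarrow> E \<subseteq> carrier G \<longrightarrow> v = finsum V (\<lambda>g. \<gamma> g (coord g v)) E)"
    (is "?P v")
proof -
  interpret V: left_module R V
    by (rule left_module_V)
  have hom: "E.tensor_hom (\<lambda>v. \<gamma> g (coord g v))" if "g \<in> carrier G" for g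
    by (rule E.tensor_hom_comp[OF tensor_hom_gamma[OF that] tensor_hom_coord[OF that]])
  have fin: "(\<lambda>g. \<gamma> g (coord g w)) \<in> E \<rightarrow> carrier V" if "w \<in> carrier V" "E \<subseteq> carrier G" for w E
    using E.tensor_homD(1)[OF hom] that by (auto simp: T_eq)
  have "v \<in> carrier E.T"
    using v by (simp add: T_eq)
  then show ?thesis
  proof (induction rule: E.tensor_induct)
    case zero
    have "finsum V (\<lambda>g. \<gamma> g (coord g \<zero>\<^bsub>E.T\<^esub>)) E = \<zero>\<^bsub>V\<^esub>" if "E \<subseteq> carrier G" for E
      using that E.tensor_homD(3)[OF hom] by (intro V.M.add.finprod_one_eqI) (auto simp: T_eq)
    then show ?case
      using E.tensor_homD(3)[OF tensor_hom_coord] by (intro exI[of _ "{}"]) (auto simp: T_eq)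
  next
    case (add v w)
    obtain S where S: "finite S" "S \<subseteq> carrier G" "\<forall>g\<in>carrier G - S. coord g v = \<zero>\<^bsub>V\<^esub>"
        "\<forall>E. finite E \<longrightarrow> S \<subseteq> E \<longrightarrow> E \<subseteq> carrier G \<longrightarrow> v = finsum V (\<lambda>g. \<gamma> g (coord g v)) E"
      using add.IH(1) by blast
    obtain S' where S': "finite S'" "S' \<subseteq> carrier G" "\<forall>g\<in>carrier G - S'. coord g w = \<zero>\<^bsub>V\<^esub>"
        "\<forall>E. finite E \<longrightarrow> S' \<subseteq> E \<longrightarrow> E \<subseteq> carrier G \<longrightarrow> w = finsum V (\<lambda>g. \<gamma> g (coord g w)) E"
      using add.IH(2) by blast
    have vw: "v \<in> carrier V" "w \<in> carrier V"
      using add by (simp_all add: T_eq)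
    show ?case
    proof (intro exI[of _ "S \<union> S'"] conjI ballI allI impI)
      show "coord g (v \<oplus>\<^bsub>E.T\<^esub> w) = \<zero>\<^bsub>V\<^esub>" if g: "g \<in> carrier G - (S \<union> S')" for g
        using S(3) S'(3) g E.tensor_homD(2)[OF tensor_hom_coord[of g] add.hyps] by (simp add: T_eq)
      fix E assume E: "finite E" "S \<union> S' \<subseteq> E" "E \<subseteq> carrier G"
      have "finsum V (\<lambda>g. \<gamma> g (coord g (v \<oplus>\<^bsub>E.T\<^esub> w))) E =
          finsum V (\<lambda>g. \<gamma> g (coord g v) \<oplus>\<^bsub>V\<^esub> \<gamma> g (coord g w)) E"
      proof (rule V.M.finsum_cong')
        show "(\<lambda>g. \<gamma> g (coord g v) \<oplus>\<^bsub>V\<^esub> \<gamma> g (coord g w)) \<in> E \<rightarrow> carrier V"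
          using fin[OF vw(1) E(3)] fin[OF vw(2) E(3)] by (intro Pi_I V.M.a_closed) auto
        fix g assume "g \<in> E"
        then show "\<gamma> g (coord g (v \<oplus>\<^bsub>E.T\<^esub> w)) = \<gamma> g (coord g v) \<oplus>\<^bsub>V\<^esub> \<gamma> g (coord g w)"
          using E.tensor_homD(2)[OF hom[of g] add.hyps] E(3) by (auto simp: T_eq)
      qed simp
      also have "\<dots> = finsum V (\<lambda>g. \<gamma> g (coord g v)) E \<oplus>\<^bsub>V\<^esub> finsum V (\<lambda>g. \<gamma> g (coord g w)) E"
        by (rule V.M.finsum_addf[OF fin[OF vw(1) E(3)] fin[OF vw(2) E(3)]])
      also have "\<dots> = v \<oplus>\<^bsub>E.T\<^esub> w"
        using S(4)[rule_format, of E, symmetric] S'(4)[rule_format, of E, symmetric] E by (simp add: T_eq)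
      finally show "v \<oplus>\<^bsub>E.T\<^esub> w = finsum V (\<lambda>g. \<gamma> g (coord g (v \<oplus>\<^bsub>E.T\<^esub> w))) E" ..
    qed (use S S' in auto)
  next
    case (minus v)
    obtain S where S: "finite S" "S \<subseteq> carrier G" "\<forall>g\<in>carrier G - S. coord g v = \<zero>\<^bsub>V\<^esub>"
        "\<forall>E. finite E \<longrightarrow> S \<subseteq> E \<longrightarrow> E \<subseteq> carrier G \<longrightarrow> v = finsum V (\<lambda>g. \<gamma> g (coord g v)) E"
      using minus.IH by blast
    have v: "v \<in> carrier V" "\<ominus>\<^bsub>E.T\<^esub> v \<in> carrier V"
      using minus by (simp_all add: T_eq)
    show ?case
    proof (intro exI[of _ S] conjI ballI allI impI)
      show "coord g (\<ominus>\<^bsub>E.T\<^esub> v) = \<zero>\<^bsub>V\<^esub>" if g: "g \<in> carrier G - S" for g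
        using S(3) g E.tensor_homD(4)[OF tensor_hom_coord[of g] minus.hyps] by (simp add: T_eq)
      fix E assume E: "finite E" "S \<subseteq> E" "E \<subseteq> carrier G"
      let ?s = "finsum V (\<lambda>g. \<gamma> g (coord g (\<ominus>\<^bsub>E.T\<^esub> v))) E"
      have "finsum V (\<lambda>g. \<gamma> g (coord g (\<ominus>\<^bsub>E.T\<^esub> v)) \<oplus>\<^bsub>V\<^esub> \<gamma> g (coord g v)) E = \<zero>\<^bsub>V\<^esub>"
      proof (rule V.M.add.finprod_one_eqI)
        fix g assume "g \<in> E"
        then have g: "g \<in> carrier G"
          using E(3) by blast
        show "\<gamma> g (coord g (\<ominus>\<^bsub>E.T\<^esub> v)) \<oplus>\<^bsub>V\<^esub> \<gamma> g (coord g v) = \<zero>\<^bsub>V\<^esub>"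
          using E.tensor_homD(4)[OF hom[OF g] minus.hyps] E.tensor_homD(1)[OF hom[OF g] minus.hyps]
          by (simp add: T_eq E.T.l_neg)
      qed
      then have "?s \<oplus>\<^bsub>V\<^esub> finsum V (\<lambda>g. \<gamma> g (coord g v)) E = \<zero>\<^bsub>V\<^esub>"
        using V.M.finsum_addf[OF fin[OF v(2) E(3)] fin[OF v(1) E(3)]] by simp
      then have "?s \<oplus>\<^bsub>E.T\<^esub> v = \<zero>\<^bsub>E.T\<^esub>"
        using S(4)[rule_format, OF E, symmetric] by (simp add: T_eq)
      moreover have "?s \<in> carrier E.T"
        using V.M.finsum_closed[OF fin[OF v(2) E(3)]] by (simp add: T_eq)
      ultimately show "\<ominus>\<^bsub>E.T\<^esub> v = ?s"
        by (rule E.T.minus_equality[OF _ minus.hyps])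
    qed (use S in auto)
  next
    case (pure b x)
    have S: "finite (supp R b)" "supp R b \<subseteq> carrier G"
      using pure(1) by (simp_all add: crossed_product_carrier)
    show ?case
    proof (intro exI[of _ "supp R b"] conjI ballI allI impI S)
      show "coord g (E.pure b x) = \<zero>\<^bsub>V\<^esub>" if g: "g \<in> carrier G - supp R b" for g
      proof -
        have "coord_coeff g b = (\<lambda>y. \<zero>)"
          using g unfolding coord_coeff_def supp_def by (auto simp: sigma_inv_simps coeff_embed_def)
        then show ?thesis
          using g pure coord_pure[of g b x] pure_sum_monomials[of "{}" b x] by simp
      qed
      fix E assume E: "finite E" "supp R b \<subseteq> E" "E \<subseteq> carrier G"
      have "finsum V (\<lambda>g. \<gamma> g (coord g (E.pure b x))) E = finsum V (\<lambda>g. E.pure (monomial R (b g) g) x) E"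
      proof (rule V.M.finsum_cong')
        show "(\<lambda>g. E.pure (monomial R (b g) g) x) \<in> E \<rightarrow> carrier V"
          using E.pure_closed[OF monomial_closed] pure E(3) by (auto simp: T_eq)
        fix g assume "g \<in> E"
        then have g: "g \<in> carrier G"
          using E(3) by blast
        have m: "monomial R (b g) g \<in> carrier A" "monomial R \<one> g \<otimes>\<^bsub>A\<^esub> coord_coeff g b \<in> carrier A"
          using g pure by (auto intro!: monomial_closed monomial_mult_closed coord_coeff_closed)
        have "monomial R \<one> g \<otimes>\<^bsub>A\<^esub> coord_coeff g b = monomial R (b g) g"
        proof (rule crossed_product_eqI[OF m(2,1)])
          fix y assume y: "y \<in> carrier G"
          show "(monomial R \<one> g \<otimes>\<^bsub>A\<^esub> coord_coeff g b) y = monomial R (b g) g y"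
          proof (cases "y = g")
            case True
            then show ?thesis
              using g pure(1) monomial_mult[OF R.one_closed g coord_coeff_closed[OF g pure(1)] y]
              by (simp add: coord_coeff_def rho_one sigma_inv_simps) (simp add: monomial_def)
          next
            case False
            have ne: "inv\<^bsub>G\<^esub> g \<otimes>\<^bsub>G\<^esub> y \<noteq> \<one>\<^bsub>G\<^esub>"
              using False g y by (metis G.inv_closed G.inv_equality G.inv_inv)
            then show ?thesis
              using False g y pure(1) monomial_mult[OF R.one_closed g coord_coeff_closed[OF g pure(1)] y]
              by (simp add: coord_coeff_def sigma_simps) (simp add: monomial_def)
          qed
        qed
        then show "\<gamma> g (coord g (E.pure b x)) = E.pure (monomial R (b g) g) x"
          using g pure by (simp add: coord_pure gamma_pure coord_coeff_closed)
      qed simp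
      also have "\<dots> = E.pure (\<lambda>y. if y \<in> E then b y else \<zero>) x"
        by (rule pure_sum_monomials[OF E(1,3) pure])
      also have "(\<lambda>y. if y \<in> E then b y else \<zero>) = b"
      proof
        have "b y = \<zero>" if "y \<notin> E" for y
          using E(2) that unfolding supp_def by blast
        then show "(if y \<in> E then b y else \<zero>) = b y" for y
          by simp
      qed
      finally show "E.pure b x = finsum V (\<lambda>g. \<gamma> g (coord g (E.pure b x))) E" ..
    qed
  qed
qed

lemma coord_mem_span:
  assumes B: "B \<subseteq> carrier K" "submodule_span R K B = carrier K"
    and g: "g \<in> carrier G" and v: "v \<in> carrier V"
  shows "coord g v \<in> submodule_span R V (E.pure (coeff_embed R G \<one>) ` B)"
proof -
  interpret V: left_module R V
    by (rule left_module_V)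
  let ?S = "submodule_span R V (E.pure (coeff_embed R G \<one>) ` B)"
  note e = coeff_embed_closed[OF R.one_closed]
  have "E.pure (coeff_embed R G \<one>) ` B \<subseteq> carrier V"
    using E.pure_closed[OF e] B(1) by (auto simp: T_eq)
  note S = V.submodule_span_submodule[OF this]
  note D = V.submoduleD[OF S]
  have scal: "r \<odot>\<^bsub>V\<^esub> E.pure (coeff_embed R G \<one>) x = E.pure (coeff_embed R G r) x"
    if "r \<in> carrier R" "x \<in> carrier K" for r x
    using that scalar_pure[OF that(1) e that(2)] by (simp add: coeff_embed_mult_coeff_embed)
  have "submodule {x \<in> carrier K. E.pure (coeff_embed R G \<one>) x \<in> ?S} R K" (is "submodule ?N R K")
  proof (rule K.submodule_vimage[OF K.submodule_carrier left_module_V S, of _ "\<lambda>r. r"])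
    show "E.pure (coeff_embed R G \<one>) x \<in> carrier V" if "x \<in> carrier K" for x
      using E.pure_closed[OF e that] by (simp add: T_eq)
    show "E.pure (coeff_embed R G \<one>) (x \<oplus>\<^bsub>K\<^esub> y) =
        E.pure (coeff_embed R G \<one>) x \<oplus>\<^bsub>V\<^esub> E.pure (coeff_embed R G \<one>) y"
      if "x \<in> carrier K" "y \<in> carrier K" for x y
      using E.pure_add_right[OF e that] by (simp add: T_eq)
    show "E.pure (coeff_embed R G \<one>) (r \<odot>\<^bsub>K\<^esub> x) = r \<odot>\<^bsub>V\<^esub> E.pure (coeff_embed R G \<one>) x"
      if "r \<in> carrier R" "x \<in> carrier K" for r x
      using E.pure_balanced[OF e that] scal[OF that] that by (simp add: coeff_embed_mult_coeff_embed)
  qed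
  moreover have "B \<subseteq> ?N"
    using B(1) V.submodule_span_superset[of "E.pure (coeff_embed R G \<one>) ` B"] by auto
  ultimately have "carrier K \<subseteq> ?N"
    using K.submodule_span_minimal B(2) by blast
  then have base: "E.pure (coeff_embed R G \<one>) x \<in> ?S" if "x \<in> carrier K" for x
    using that by blast
  note hom = E.tensor_homD[OF tensor_hom_coord[OF g]]
  have "v \<in> carrier E.T"
    using v by (simp add: T_eq)
  then show ?thesis
  proof (induction rule: E.tensor_induct)
    case zero
    then show ?case
      using hom(3) D(2) by (simp add: T_eq)
  next
    case (add v w)
    then show ?case
      using hom(2) D(3)[of "coord g v" "coord g w"] by (simp add: T_eq)
  next
    case (minus v)
    have "\<ominus>\<^bsub>V\<^esub> coord g v = \<ominus>\<^bsub>E.T\<^esub> coord g v"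
    proof (rule V.M.minus_equality)
      show "\<ominus>\<^bsub>E.T\<^esub> coord g v \<oplus>\<^bsub>V\<^esub> coord g v = \<zero>\<^bsub>V\<^esub>"
        using hom(1)[OF minus.hyps] by (simp add: T_eq E.T.l_neg)
    qed (use hom(1)[OF minus.hyps] in \<open>simp_all add: T_eq\<close>)
    then show ?case
      using hom(4)[OF minus.hyps] D(5)[OF minus.IH] by simp
  next
    case (pure b x)
    have "coord g (E.pure b x) = sigma_inv g (b g) \<odot>\<^bsub>V\<^esub> E.pure (coeff_embed R G \<one>) x"
      using coord_pure[OF g pure] scal[OF _ pure(2), of "sigma_inv g (b g)"] g pure(1)
      by (simp add: coord_coeff_def)
    then show ?case
      using D(4)[OF _ base[OF pure(2)], of "sigma_inv g (b g)"] g pure(1) by simp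
  qed
qed

theorem twisted_graded_module_V:
  assumes B: "finite B" "B \<subseteq> carrier K" "submodule_span R K B = carrier K"
  shows "twisted_graded_module R V G \<sigma> \<gamma> coord (E.pure (coeff_embed R G \<one>) ` B)"
proof -
  interpret V: left_module R V
    by (rule left_module_V)
  show ?thesis
  proof (intro twisted_graded_module.intro twisted_graded_module_axioms.intro)
    show "left_module R V" by (rule left_module_V)
    show "group G" by (rule G.is_group)
    show "\<sigma> g \<in> ring_iso R R" if "g \<in> carrier G" for g
      by (rule aut[OF that])
    show "\<gamma> g v \<in> carrier V" if "g \<in> carrier G" "v \<in> carrier V" for g v
      using E.tensor_homD(1)[OF tensor_hom_gamma[OF that(1)]] that(2) by (simp add: T_eq)
    show "\<gamma> g (v \<oplus>\<^bsub>V\<^esub> w) = \<gamma> g v \<oplus>\<^bsub>V\<^esub> \<gamma> g w"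
      if "g \<in> carrier G" "v \<in> carrier V" "w \<in> carrier V" for g v w
      using E.tensor_homD(2)[OF tensor_hom_gamma[OF that(1)]] that(2,3) by (simp add: T_eq)
    show "coord g v \<in> carrier V" if "g \<in> carrier G" "v \<in> carrier V" for g v
      using E.tensor_homD(1)[OF tensor_hom_coord[OF that(1)]] that(2) by (simp add: T_eq)
    show "coord g (v \<oplus>\<^bsub>V\<^esub> w) = coord g v \<oplus>\<^bsub>V\<^esub> coord g w"
      if "g \<in> carrier G" "v \<in> carrier V" "w \<in> carrier V" for g v w
      using E.tensor_homD(2)[OF tensor_hom_coord[OF that(1)]] that(2,3) by (simp add: T_eq)
    show "finite (E.pure (coeff_embed R G \<one>) ` B)"
      using B(1) by simp
    show "E.pure (coeff_embed R G \<one>) ` B \<subseteq> carrier V"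
      using E.pure_closed[OF coeff_embed_closed[OF R.one_closed]] B(2) by (auto simp: T_eq)
    show fin: "finite {g \<in> carrier G. coord g v \<noteq> \<zero>\<^bsub>V\<^esub>}" if v: "v \<in> carrier V" for v
    proof -
      obtain S where "finite S" "\<forall>g\<in>carrier G - S. coord g v = \<zero>\<^bsub>V\<^esub>"
        using coord_support[OF v] by blast
      then show ?thesis
        by (elim finite_subset[rotated]) auto
    qed
    fix v E assume v: "v \<in> carrier V" and E: "finite E" "E \<subseteq> carrier G"
      and sub: "{g \<in> carrier G. coord g v \<noteq> \<zero>\<^bsub>V\<^esub>} \<subseteq> E"
    obtain S where S: "finite S" "S \<subseteq> carrier G"
        "\<forall>E. finite E \<longrightarrow> S \<subseteq> E \<longrightarrow> E \<subseteq> carrier G \<longrightarrow> v = finsum V (\<lambda>g. \<gamma> g (coord g v)) E"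
      using coord_support[OF v] by blast
    have cl: "(\<lambda>g. \<gamma> g (coord g v)) \<in> E \<union> S \<rightarrow> carrier V"
      using E.tensor_homD(1)[OF tensor_hom_gamma E.tensor_homD(1)[OF tensor_hom_coord]] v E(2) S(2)
      by (auto simp: T_eq)
    have "finsum V (\<lambda>g. \<gamma> g (coord g v)) E = finsum V (\<lambda>g. \<gamma> g (coord g v)) (E \<union> S)"
    proof (rule V.M.add.finprod_mono_neutral_cong_left)
      fix g assume "g \<in> E \<union> S - E"
      then have "g \<in> carrier G" "coord g v = \<zero>\<^bsub>V\<^esub>"
        using S(2) sub by auto
      then show "\<gamma> g (coord g v) = \<zero>\<^bsub>V\<^esub>"
        using E.tensor_homD(3)[OF tensor_hom_gamma] by (simp add: T_eq)
    qed (use E S cl in auto)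
    then show "v = finsum V (\<lambda>g. \<gamma> g (coord g v)) E"
      using S(3)[rule_format, of "E \<union> S"] E S(1,2) by simp
  qed (fact gamma_scalar coord_scalar coord_gamma_zero_iff coord_mem_span[OF B(2,3)])+
qed

end

section \<open>Finite powers\<close>

definition power_module :: "nat \<Rightarrow> ('r, 'm, 'b) module_scheme \<Rightarrow> ('r, nat \<Rightarrow> 'm) module" where
  "power_module k M =
     \<lparr>carrier = {..<k} \<rightarrow>\<^sub>E carrier M, monoid.mult = undefined, one = undefined,
      ring.zero = (\<lambda>i\<in>{..<k}. \<zero>\<^bsub>M\<^esub>), ring.add = (\<lambda>v w. \<lambda>i\<in>{..<k}. v i \<oplus>\<^bsub>M\<^esub> w i),
      smult = (\<lambda>r v. \<lambda>i\<in>{..<k}. r \<odot>\<^bsub>M\<^esub> v i)\<rparr>"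

lemma power_module_simps [simp]:
  "carrier (power_module k M) = {..<k} \<rightarrow>\<^sub>E carrier M"
  "\<zero>\<^bsub>power_module k M\<^esub> = (\<lambda>i\<in>{..<k}. \<zero>\<^bsub>M\<^esub>)"
  "v \<oplus>\<^bsub>power_module k M\<^esub> w = (\<lambda>i\<in>{..<k}. v i \<oplus>\<^bsub>M\<^esub> w i)"
  "r \<odot>\<^bsub>power_module k M\<^esub> v = (\<lambda>i\<in>{..<k}. r \<odot>\<^bsub>M\<^esub> v i)"
  by (simp_all add: power_module_def)

lemma power_eqI:
  assumes "v \<in> {..<k} \<rightarrow>\<^sub>E S" "w \<in> {..<k} \<rightarrow>\<^sub>E S'" "\<And>i. i < k \<Longrightarrow> v i = w i"
  shows "v = (w :: nat \<Rightarrow> 'm)"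
  using assms by (intro extensionalityI[of v "{..<k}" w]) (auto simp: PiE_iff)

lemma power_component: "v \<in> {..<k} \<rightarrow>\<^sub>E W \<Longrightarrow> i < k \<Longrightarrow> v i \<in> W"
  by auto

lemma restrict_power: "(\<And>i. i < k \<Longrightarrow> f i \<in> W) \<Longrightarrow> (\<lambda>i\<in>{..<k}. f i) \<in> {..<k} \<rightarrow>\<^sub>E W"
  by auto

context left_module
begin

lemma left_module_power: "left_module R (power_module k M)"
proof (intro left_module.intro left_module_axioms.intro)
  show "ring R" by (rule R.ring_axioms)
  show "abelian_group (power_module k M)"
  proof (rule abelian_groupI)
    fix v assume v: "v \<in> carrier (power_module k M)"
    show "\<exists>w\<in>carrier (power_module k M). w \<oplus>\<^bsub>power_module k M\<^esub> v = \<zero>\<^bsub>power_module k M\<^esub>"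
    proof
      show "(\<lambda>i\<in>{..<k}. \<ominus>\<^bsub>M\<^esub> v i) \<in> carrier (power_module k M)"
        using v by auto
      show "(\<lambda>i\<in>{..<k}. \<ominus>\<^bsub>M\<^esub> v i) \<oplus>\<^bsub>power_module k M\<^esub> v = \<zero>\<^bsub>power_module k M\<^esub>"
        by (rule ext) (simp add: restrict_def M.l_neg power_component[OF v[simplified]])
    qed
    show "\<zero>\<^bsub>power_module k M\<^esub> \<oplus>\<^bsub>power_module k M\<^esub> v = v"
      by (rule power_eqI[OF _ v[simplified]]) (auto simp: power_component[OF v[simplified]])
  next
    fix u v w
    assume "u \<in> carrier (power_module k M)" "v \<in> carrier (power_module k M)" "w \<in> carrier (power_module k M)"
    then have "u i \<in> carrier M \<and> v i \<in> carrier M \<and> w i \<in> carrier M" if "i < k" for i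
      using that power_component[of _ k "carrier M" i] by simp
    then show "u \<oplus>\<^bsub>power_module k M\<^esub> v \<oplus>\<^bsub>power_module k M\<^esub> w =
        u \<oplus>\<^bsub>power_module k M\<^esub> (v \<oplus>\<^bsub>power_module k M\<^esub> w)"
      by (intro ext) (simp add: restrict_def M.a_assoc)
  next
    fix u v assume "u \<in> carrier (power_module k M)" "v \<in> carrier (power_module k M)"
    then have closed: "u i \<in> carrier M \<and> v i \<in> carrier M" if "i < k" for i
      using that power_component[of _ k "carrier M" i] by simp
    then show "u \<oplus>\<^bsub>power_module k M\<^esub> v = v \<oplus>\<^bsub>power_module k M\<^esub> u"
      by (intro ext) (simp add: restrict_def M.a_comm)
    show "u \<oplus>\<^bsub>power_module k M\<^esub> v \<in> carrier (power_module k M)"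
      using closed by auto
  qed auto
  show "\<one> \<odot>\<^bsub>power_module k M\<^esub> v = v" if "v \<in> carrier (power_module k M)" for v
    by (rule power_eqI[OF _ that[simplified]]) (auto simp: power_component[OF that[simplified]])
  fix r v assume r: "r \<in> carrier R" and "v \<in> carrier (power_module k M)"
  then have v: "v i \<in> carrier M" if "i < k" for i
    using that power_component[of v k "carrier M" i] by simp
  show "r \<odot>\<^bsub>power_module k M\<^esub> v \<in> carrier (power_module k M)"
    using r v by auto
  show "(r \<oplus> s) \<odot>\<^bsub>power_module k M\<^esub> v =
      r \<odot>\<^bsub>power_module k M\<^esub> v \<oplus>\<^bsub>power_module k M\<^esub> s \<odot>\<^bsub>power_module k M\<^esub> v" if "s \<in> carrier R" for s
    using r v that by (intro ext) (simp add: restrict_def smult_l_distr)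
  show "(s \<otimes> r) \<odot>\<^bsub>power_module k M\<^esub> v = s \<odot>\<^bsub>power_module k M\<^esub> (r \<odot>\<^bsub>power_module k M\<^esub> v)"
    if "s \<in> carrier R" for s
    using r v that by (intro ext) (simp add: restrict_def smult_assoc1)
  fix w assume "w \<in> carrier (power_module k M)"
  then have "w i \<in> carrier M" if "i < k" for i
    using that power_component[of w k "carrier M" i] by simp
  then show "r \<odot>\<^bsub>power_module k M\<^esub> (v \<oplus>\<^bsub>power_module k M\<^esub> w) =
      r \<odot>\<^bsub>power_module k M\<^esub> v \<oplus>\<^bsub>power_module k M\<^esub> r \<odot>\<^bsub>power_module k M\<^esub> w"
    using r v by (intro ext) (simp add: restrict_def smult_r_distr)
qed

lemma power_finsum:
  assumes "i < k" "f \<in> S \<rightarrow> carrier (power_module k M)" "finite S"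
  shows "finsum (power_module k M) f S i = finsum M (\<lambda>s. f s i) S"
  using assms(3,2)
proof (induction S rule: finite_induct)
  case empty
  interpret P: left_module R "power_module k M"
    by (rule left_module_power)
  show ?case
    using assms(1) P.M.finsum_empty by simp
next
  case (insert s S)
  interpret P: left_module R "power_module k M"
    by (rule left_module_power)
  have f: "f \<in> S \<rightarrow> carrier (power_module k M)" "f s \<in> carrier (power_module k M)"
    using insert.prems by auto
  have "(\<lambda>s. f s i) \<in> S \<rightarrow> carrier M" "f s i \<in> carrier M"
    using f assms(1) by auto
  then have "finsum M (\<lambda>s. f s i) (insert s S) = f s i \<oplus>\<^bsub>M\<^esub> finsum M (\<lambda>s. f s i) S"
    by (rule M.finsum_insert[OF insert.hyps])
  moreover have "finsum (power_module k M) f (insert s S) = f s \<oplus>\<^bsub>power_module k M\<^esub> finsum (power_module k M) f S"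
    by (rule P.M.finsum_insert[OF insert.hyps f])
  ultimately show ?case
    using insert.IH[OF f(1)] assms(1) by simp
qed

definition single :: "nat \<Rightarrow> nat \<Rightarrow> 'm \<Rightarrow> nat \<Rightarrow> 'm" where
  "single k i x = (\<lambda>j\<in>{..<k}. if j = i then x else \<zero>\<^bsub>M\<^esub>)"

lemma single_closed: "x \<in> carrier M \<Longrightarrow> single k i x \<in> {..<k} \<rightarrow>\<^sub>E carrier M"
  unfolding single_def by (rule restrict_power) simp

lemma power_span:
  assumes B: "B \<subseteq> carrier M" and w: "w \<in> {..<k} \<rightarrow>\<^sub>E submodule_span R M B"
  shows "w \<in> submodule_span R (power_module k M) (\<Union>i<k. single k i ` B)"
proof -
  interpret P: left_module R "power_module k M"
    by (rule left_module_power)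
  let ?S = "submodule_span R (power_module k M) (\<Union>i<k. single k i ` B)"
  have closed: "single k i x \<in> carrier (power_module k M)" if "x \<in> carrier M" for i x
    using single_closed[OF that] by simp
  have S: "submodule ?S R (power_module k M)"
    by (rule P.submodule_span_submodule) (use closed B in blast)
  note D = P.submoduleD[OF S]
  have sB: "submodule_span R M B \<subseteq> carrier M"
    using submoduleD(1)[OF submodule_span_submodule[OF B]] by blast
  have mem: "single k i x \<in> ?S" if i: "i < k" and x: "x \<in> submodule_span R M B" for i x
  proof -
    have "submodule {x \<in> carrier M. single k i x \<in> ?S} R M" (is "submodule ?N R M")
    proof (rule submodule_vimage[OF submodule_carrier left_module_power S, of _ "\<lambda>r. r"])
      show "single k i (x \<oplus>\<^bsub>M\<^esub> y) = single k i x \<oplus>\<^bsub>power_module k M\<^esub> single k i y"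
        if "x \<in> carrier M" "y \<in> carrier M" for x y
        using that by (auto simp: single_def fun_eq_iff)
      show "single k i (r \<odot>\<^bsub>M\<^esub> x) = r \<odot>\<^bsub>power_module k M\<^esub> single k i x"
        if "r \<in> carrier R" "x \<in> carrier M" for r x
        using that by (auto simp: single_def fun_eq_iff)
    qed (use closed in auto)
    moreover have "B \<subseteq> ?N"
      using B i P.submodule_span_superset[of "\<Union>i<k. single k i ` B"] by auto
    ultimately show ?thesis
      using submodule_span_minimal x by blast
  qed
  have wi: "w i \<in> submodule_span R M B" "w i \<in> carrier M" if "i < k" for i
    using w that sB by auto
  have f: "(\<lambda>i. single k i (w i)) \<in> {..<k} \<rightarrow> carrier (power_module k M)"
    using wi(2) closed by blast
  have "w = finsum (power_module k M) (\<lambda>i. single k i (w i)) {..<k}"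
  proof (rule power_eqI)
    show "w \<in> {..<k} \<rightarrow>\<^sub>E carrier M"
      using w sB by auto
    show "finsum (power_module k M) (\<lambda>i. single k i (w i)) {..<k} \<in> {..<k} \<rightarrow>\<^sub>E carrier M"
      using P.M.finsum_closed[OF f] by simp
    fix j assume j: "j < k"
    have "finsum (power_module k M) (\<lambda>i. single k i (w i)) {..<k} j =
        finsum M (\<lambda>i. if j = i then w i else \<zero>\<^bsub>M\<^esub>) {..<k}"
      using power_finsum[OF j f] j by (simp add: single_def)
    also have "\<dots> = w j"
      using j wi(2) by (intro M.add.finprod_singleton) auto
    finally show "w j = finsum (power_module k M) (\<lambda>i. single k i (w i)) {..<k} j" ..
  qed
  moreover have "finsum (power_module k M) (\<lambda>i. single k i (w i)) {..<k} \<in> ?S"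
    using mem wi(1) by (intro P.submodule_finsum[OF S]) auto
  ultimately show ?thesis
    by simp
qed

end

context twisted_graded_module
begin

text \<open>
  All structure is componentwise; the powers are needed because matrices over \<open>End(M)\<close> act on powers of \<open>M\<close>.
\<close>

lemma twisted_graded_module_power:
  "twisted_graded_module R (power_module k V) G \<sigma> (\<lambda>g v. \<lambda>i\<in>{..<k}. \<gamma> g (v i))
     (\<lambda>g v. \<lambda>i\<in>{..<k}. c g (v i)) (\<Union>i<k. single k i ` B)"
proof (intro twisted_graded_module.intro twisted_graded_module_axioms.intro)
  interpret P: left_module R "power_module k V"
    by (rule left_module_power)
  have comp: "v i \<in> carrier V" if "v \<in> carrier (power_module k V)" "i < k" for v i
    using that by auto
  have nz: "{g \<in> carrier G. (\<lambda>i\<in>{..<k}. c g (v i)) \<noteq> \<zero>\<^bsub>power_module k V\<^esub>} =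
      (\<Union>i<k. {g \<in> carrier G. c g (v i) \<noteq> \<zero>\<^bsub>V\<^esub>})" for v
    by (auto simp: fun_eq_iff restrict_def)
  show "left_module R (power_module k V)" by (rule left_module_power)
  show "group G" by (rule G.is_group)
  show "\<sigma> g \<in> ring_iso R R" if "g \<in> carrier G" for g
    by (rule aut[OF that])
  show "finite (\<Union>i<k. single k i ` B)"
    using base_finite by simp
  show "(\<Union>i<k. single k i ` B) \<subseteq> carrier (power_module k V)"
    unfolding power_module_simps using base_closed single_closed by blast
  show "(\<lambda>i\<in>{..<k}. c g (v i)) \<in> submodule_span R (power_module k V) (\<Union>i<k. single k i ` B)"
    if "g \<in> carrier G" "v \<in> carrier (power_module k V)" for g v
    using coord_base[OF that(1)] comp[OF that(2)] by (intro power_span base_closed) auto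
  show "finite {g \<in> carrier G. (\<lambda>i\<in>{..<k}. c g (v i)) \<noteq> \<zero>\<^bsub>power_module k V\<^esub>}"
    if "v \<in> carrier (power_module k V)" for v
    unfolding nz using coord_finite comp[OF that] by auto
  show "v = finsum (power_module k V) (\<lambda>g. \<lambda>i\<in>{..<k}. \<gamma> g ((\<lambda>i\<in>{..<k}. c g (v i)) i)) E"
    if v: "v \<in> carrier (power_module k V)" and E: "finite E" "E \<subseteq> carrier G"
      and sub: "{g \<in> carrier G. (\<lambda>i\<in>{..<k}. c g (v i)) \<noteq> \<zero>\<^bsub>power_module k V\<^esub>} \<subseteq> E" for v E
  proof (rule power_eqI)
    have f: "(\<lambda>g. \<lambda>i\<in>{..<k}. \<gamma> g ((\<lambda>i\<in>{..<k}. c g (v i)) i)) \<in> E \<rightarrow> carrier (power_module k V)"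
      unfolding power_module_simps
      by (intro Pi_I restrict_power, simp)
        (use gamma_closed[OF _ coord_closed] comp[OF v] E(2) in blast)
    show "v \<in> {..<k} \<rightarrow>\<^sub>E carrier V"
      using v by simp
    show "finsum (power_module k V) (\<lambda>g. \<lambda>i\<in>{..<k}. \<gamma> g ((\<lambda>i\<in>{..<k}. c g (v i)) i)) E \<in> {..<k} \<rightarrow>\<^sub>E carrier V"
      using P.M.finsum_closed[OF f] by simp
    fix i assume i: "i < k"
    then have "{g \<in> carrier G. c g (v i) \<noteq> \<zero>\<^bsub>V\<^esub>} \<subseteq> E"
      using sub unfolding nz by blast
    then show "v i = finsum (power_module k V) (\<lambda>g. \<lambda>i\<in>{..<k}. \<gamma> g ((\<lambda>i\<in>{..<k}. c g (v i)) i)) E i"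
      unfolding power_finsum[OF i f E(1)] using coord_expansion[OF comp[OF v i] E] i by simp
  qed
  show "(\<lambda>i\<in>{..<k}. c (g \<otimes>\<^bsub>G\<^esub> h) ((\<lambda>i\<in>{..<k}. \<gamma> g (v i)) i)) = \<zero>\<^bsub>power_module k V\<^esub> \<longleftrightarrow>
      (\<lambda>i\<in>{..<k}. c h (v i)) = \<zero>\<^bsub>power_module k V\<^esub>"
    if "g \<in> carrier G" "h \<in> carrier G" "v \<in> carrier (power_module k V)" for g h v
    using coord_gamma[OF that(1,2)] comp[OF that(3)] by (simp add: fun_eq_iff restrict_def)
  fix g v assume g: "g \<in> carrier G" and "v \<in> carrier (power_module k V)"
  then have v: "v i \<in> carrier V" if "i < k" for i
    using that comp by blast
  show "(\<lambda>i\<in>{..<k}. \<gamma> g (v i)) \<in> carrier (power_module k V)"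
    "(\<lambda>i\<in>{..<k}. c g (v i)) \<in> carrier (power_module k V)"
    using gamma_closed[OF g v] coord_closed[OF g v] by auto
  show "(\<lambda>i\<in>{..<k}. \<gamma> g ((r \<odot>\<^bsub>power_module k V\<^esub> v) i)) =
      \<sigma> g r \<odot>\<^bsub>power_module k V\<^esub> (\<lambda>i\<in>{..<k}. \<gamma> g (v i))" if "r \<in> carrier R" for r
    using gamma_smult[OF g that v] by (intro ext) (simp add: restrict_def)
  show "(\<lambda>i\<in>{..<k}. c g ((\<sigma> g r \<odot>\<^bsub>power_module k V\<^esub> v) i)) =
      r \<odot>\<^bsub>power_module k V\<^esub> (\<lambda>i\<in>{..<k}. c g (v i))" if "r \<in> carrier R" for r
    using coord_smult[OF g that v] by (intro ext) (simp add: restrict_def)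
  fix w assume "w \<in> carrier (power_module k V)"
  then have w: "w i \<in> carrier V" if "i < k" for i
    using that comp by blast
  show "(\<lambda>i\<in>{..<k}. \<gamma> g ((v \<oplus>\<^bsub>power_module k V\<^esub> w) i)) =
      (\<lambda>i\<in>{..<k}. \<gamma> g (v i)) \<oplus>\<^bsub>power_module k V\<^esub> (\<lambda>i\<in>{..<k}. \<gamma> g (w i))"
    using gamma_add[OF g v w] by (intro ext) (simp add: restrict_def)
  show "(\<lambda>i\<in>{..<k}. c g ((v \<oplus>\<^bsub>power_module k V\<^esub> w) i)) =
      (\<lambda>i\<in>{..<k}. c g (v i)) \<oplus>\<^bsub>power_module k V\<^esub> (\<lambda>i\<in>{..<k}. c g (w i))"
    using coord_add[OF g v w] by (intro ext) (simp add: restrict_def)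
qed

end

section \<open>Matrices over endomorphism rings\<close>

lemma (in abelian_monoid) finsum_swap:
  assumes "finite I" "finite J" "\<And>i j. i \<in> I \<Longrightarrow> j \<in> J \<Longrightarrow> f i j \<in> carrier G"
  shows "(\<Oplus>i\<in>I. \<Oplus>j\<in>J. f i j) = (\<Oplus>j\<in>J. \<Oplus>i\<in>I. f i j)"
  using assms(1,3)
proof (induction I rule: finite_induct)
  case empty
  show ?case
    by (simp add: finsum_zero)
next
  case (insert i I)
  have fi: "f i \<in> J \<rightarrow> carrier G" and fI: "(\<lambda>j. \<Oplus>i\<in>I. f i j) \<in> J \<rightarrow> carrier G"
    using insert.prems by (auto intro!: finsum_closed)
  have "(\<Oplus>i\<in>insert i I. \<Oplus>j\<in>J. f i j) = (\<Oplus>j\<in>J. f i j) \<oplus> (\<Oplus>i\<in>I. \<Oplus>j\<in>J. f i j)"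
    using insert.prems by (intro finsum_insert[OF insert.hyps]) (auto intro!: finsum_closed)
  also have "\<dots> = (\<Oplus>j\<in>J. f i j) \<oplus> (\<Oplus>j\<in>J. \<Oplus>i\<in>I. f i j)"
    using insert by simp
  also have "\<dots> = (\<Oplus>j\<in>J. f i j \<oplus> (\<Oplus>i\<in>I. f i j))"
    by (rule finsum_addf[symmetric, OF fi fI])
  also have "\<dots> = (\<Oplus>j\<in>J. \<Oplus>i\<in>insert i I. f i j)"
  proof (rule finsum_cong')
    fix j assume j: "j \<in> J"
    show "f i j \<oplus> (\<Oplus>i\<in>I. f i j) = (\<Oplus>i\<in>insert i I. f i j)"
      by (rule finsum_insert[symmetric, OF insert.hyps]) (use insert.prems j in auto)
  qed (use insert.prems in \<open>auto intro!: finsum_closed\<close>)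
  finally show ?case .
qed

lemma (in abelian_group) additive_finsum:
  assumes cl: "\<And>x. x \<in> carrier G \<Longrightarrow> h x \<in> carrier G"
    and add: "\<And>x y. x \<in> carrier G \<Longrightarrow> y \<in> carrier G \<Longrightarrow> h (x \<oplus> y) = h x \<oplus> h y"
    and f: "finite I" "f \<in> I \<rightarrow> carrier G"
  shows "h (finsum G f I) = (\<Oplus>i\<in>I. h (f i))"
  using f
proof (induction I rule: finite_induct)
  case empty
  have "h \<zero> \<oplus> h \<zero> = h \<zero>"
    using add[of \<zero> \<zero>] by simp
  then have "h \<zero> = \<zero>"
    using cl[OF zero_closed] by (metis add.r_cancel_one')
  then show ?case
    by simp
next
  case (insert i I)
  then have fI: "f \<in> I \<rightarrow> carrier G" "f i \<in> carrier G"
    by auto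
  then have "(\<lambda>i. h (f i)) \<in> I \<rightarrow> carrier G" "h (f i) \<in> carrier G"
    using cl by auto
  then show ?case
    using insert.hyps insert.IH[OF fI(1)] fI add[OF fI(2) finsum_closed[OF fI(1)]]
    by (simp add: finsum_insert)
qed

text \<open>
  The scalars are required to act by additive maps, which is what makes \<open>End_ring D N\<close> closed under addition.
\<close>

locale operator_module = N: abelian_group N
  for D :: "('s, 'a) ring_scheme" and N :: "('s, 'm, 'b) module_scheme" (structure) +
  assumes op_closed: "r \<in> carrier D \<Longrightarrow> x \<in> carrier N \<Longrightarrow> r \<odot> x \<in> carrier N"
    and op_add: "r \<in> carrier D \<Longrightarrow> x \<in> carrier N \<Longrightarrow> y \<in> carrier N \<Longrightarrow> r \<odot> (x \<oplus> y) = r \<odot> x \<oplus> r \<odot> y"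
begin

abbreviation "S \<equiv> End_ring D N"

lemma module_EndD:
  assumes "f \<in> module_End D N"
  shows "x \<in> carrier N \<Longrightarrow> f x \<in> carrier N"
    "x \<in> carrier N \<Longrightarrow> y \<in> carrier N \<Longrightarrow> f (x \<oplus> y) = f x \<oplus> f y"
    "r \<in> carrier D \<Longrightarrow> x \<in> carrier N \<Longrightarrow> f (r \<odot> x) = r \<odot> f x"
    "f \<in> extensional (carrier N)"
  using assms unfolding module_End_def by (auto simp: PiE_iff)

lemma module_EndI:
  assumes "f \<in> extensional (carrier N)" "\<And>x. x \<in> carrier N \<Longrightarrow> f x \<in> carrier N"
    "\<And>x y. x \<in> carrier N \<Longrightarrow> y \<in> carrier N \<Longrightarrow> f (x \<oplus> y) = f x \<oplus> f y"
    "\<And>r x. r \<in> carrier D \<Longrightarrow> x \<in> carrier N \<Longrightarrow> f (r \<odot> x) = r \<odot> f x"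
  shows "f \<in> module_End D N"
  using assms unfolding module_End_def by (auto simp: PiE_iff)

lemma module_End_finsum:
  assumes "f \<in> module_End D N" "finite I" "g \<in> I \<rightarrow> carrier N"
  shows "f (finsum N g I) = (\<Oplus>i\<in>I. f (g i))"
  by (rule N.additive_finsum[OF module_EndD(1,2)[OF assms(1)] assms(2,3)])

lemma op_zero: "r \<in> carrier D \<Longrightarrow> r \<odot> \<zero> = \<zero>"
  using N.additive_finsum[of "\<lambda>x. r \<odot> x" "{}" "\<lambda>_. \<zero>"] op_closed op_add by simp

lemma End_ring_simps:
  "carrier S = module_End D N" "f \<otimes>\<^bsub>S\<^esub> g = compose (carrier N) f g" "\<one>\<^bsub>S\<^esub> = (\<lambda>x\<in>carrier N. x)"
  "\<zero>\<^bsub>S\<^esub> = (\<lambda>x\<in>carrier N. \<zero>)" "f \<oplus>\<^bsub>S\<^esub> g = (\<lambda>x\<in>carrier N. f x \<oplus> g x)"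
  by (simp_all add: End_ring_def)

lemma End_zero_closed: "\<zero>\<^bsub>S\<^esub> \<in> carrier S"
  unfolding End_ring_simps by (rule module_EndI) (auto simp: op_closed op_zero)

lemma End_one_closed: "\<one>\<^bsub>S\<^esub> \<in> carrier S"
  unfolding End_ring_simps by (rule module_EndI) (auto simp: op_closed)

lemma End_add_closed: "f \<in> carrier S \<Longrightarrow> g \<in> carrier S \<Longrightarrow> f \<oplus>\<^bsub>S\<^esub> g \<in> carrier S"
  unfolding End_ring_simps
  by (rule module_EndI) (auto simp: module_EndD op_closed op_add N.add.m_ac)

lemma End_mult_closed: "f \<in> carrier S \<Longrightarrow> g \<in> carrier S \<Longrightarrow> f \<otimes>\<^bsub>S\<^esub> g \<in> carrier S"
  unfolding End_ring_simps
  by (rule module_EndI) (auto simp: module_EndD op_closed compose_def)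

lemma End_eqI:
  assumes "f \<in> carrier S" "g \<in> carrier S" "\<And>x. x \<in> carrier N \<Longrightarrow> f x = g x"
  shows "f = g"
  using assms module_EndD(4) unfolding End_ring_simps by (intro extensionalityI[of f "carrier N" g]) auto

lemma abelian_monoid_End: "abelian_monoid S"
proof (rule abelian_monoidI)
  fix f g h assume f: "f \<in> carrier S" "g \<in> carrier S" "h \<in> carrier S"
  then have cl: "f x \<in> carrier N \<and> g x \<in> carrier N \<and> h x \<in> carrier N" if "x \<in> carrier N" for x
    using that module_EndD(1) unfolding End_ring_simps by blast
  show "f \<oplus>\<^bsub>S\<^esub> g \<oplus>\<^bsub>S\<^esub> h = f \<oplus>\<^bsub>S\<^esub> (g \<oplus>\<^bsub>S\<^esub> h)"
    using f cl by (intro End_eqI End_add_closed) (auto simp: End_ring_simps N.a_assoc)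
next
  fix f g assume f: "f \<in> carrier S" "g \<in> carrier S"
  then have cl: "f x \<in> carrier N \<and> g x \<in> carrier N" if "x \<in> carrier N" for x
    using that module_EndD(1) unfolding End_ring_simps by blast
  show "f \<oplus>\<^bsub>S\<^esub> g = g \<oplus>\<^bsub>S\<^esub> f"
    using f cl by (intro End_eqI End_add_closed) (auto simp: End_ring_simps N.a_comm)
next
  fix f assume f: "f \<in> carrier S"
  then have cl: "f x \<in> carrier N" if "x \<in> carrier N" for x
    using that module_EndD(1) unfolding End_ring_simps by blast
  show "\<zero>\<^bsub>S\<^esub> \<oplus>\<^bsub>S\<^esub> f = f"
    using f cl by (intro End_eqI End_add_closed End_zero_closed) (auto simp: End_ring_simps)
qed (use End_add_closed End_zero_closed in auto)

lemma End_finsum: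
  assumes "finite I" "f \<in> I \<rightarrow> carrier S" "x \<in> carrier N"
  shows "finsum S f I x = (\<Oplus>l\<in>I. f l x)"
  using assms(1,2)
proof (induction I rule: finite_induct)
  interpret S: abelian_monoid S
    by (rule abelian_monoid_End)
  case empty
  show ?case
    using assms(3) S.finsum_empty by (simp add: End_ring_simps)
next
  interpret S: abelian_monoid S
    by (rule abelian_monoid_End)
  case (insert i I)
  then have f: "f \<in> I \<rightarrow> carrier S" "f i \<in> carrier S"
    by auto
  have "f l x \<in> carrier N" if "l \<in> insert i I" for l
    using insert.prems that module_EndD(1)[OF _ assms(3)] unfolding End_ring_simps by auto
  then have g: "(\<lambda>l. f l x) \<in> I \<rightarrow> carrier N" "f i x \<in> carrier N"
    by auto
  have "finsum S f (insert i I) x = (f i \<oplus>\<^bsub>S\<^esub> finsum S f I) x"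
    using S.finsum_insert[OF insert.hyps f] by simp
  also have "\<dots> = f i x \<oplus> finsum S f I x"
    using assms(3) by (simp add: End_ring_simps)
  also have "\<dots> = (\<Oplus>l\<in>insert i I. f l x)"
    using N.finsum_insert[OF insert.hyps g] insert.IH[OF f(1)] by simp
  finally show ?case .
qed

definition mat_action :: "nat \<Rightarrow> (nat \<times> nat \<Rightarrow> 'm \<Rightarrow> 'm) \<Rightarrow> (nat \<Rightarrow> 'm) \<Rightarrow> nat \<Rightarrow> 'm" where
  "mat_action k P v = (\<lambda>i\<in>{..<k}. \<Oplus>l\<in>{..<k}. P (i, l) (v l))"

context
  fixes k :: nat
begin

lemma mat_entry: "P \<in> carrier (mat_ring k S) \<Longrightarrow> i < k \<Longrightarrow> j < k \<Longrightarrow> P (i, j) \<in> carrier S"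
  by (auto simp: mat_ring_def)

lemma mat_entry_closed:
  "P \<in> carrier (mat_ring k S) \<Longrightarrow> i < k \<Longrightarrow> j < k \<Longrightarrow> x \<in> carrier N \<Longrightarrow> P (i, j) x \<in> carrier N"
  using mat_entry module_EndD(1) unfolding End_ring_simps by blast

lemma mat_action_closed:
  assumes "P \<in> carrier (mat_ring k S)" "v \<in> {..<k} \<rightarrow>\<^sub>E carrier N"
  shows "mat_action k P v \<in> {..<k} \<rightarrow>\<^sub>E carrier N"
  using mat_entry_closed[OF assms(1)] assms(2) unfolding mat_action_def
  by (auto intro!: N.finsum_closed)

lemma mat_mult_closed:
  assumes P: "P \<in> carrier (mat_ring k S)" and Q: "Q \<in> carrier (mat_ring k S)"
  shows "P \<otimes>\<^bsub>mat_ring k S\<^esub> Q \<in> carrier (mat_ring k S)"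
proof -
  interpret S: abelian_monoid S
    by (rule abelian_monoid_End)
  have "(\<Oplus>\<^bsub>S\<^esub>l\<in>{..<k}. P (i, l) \<otimes>\<^bsub>S\<^esub> Q (l, j)) \<in> carrier S" if "i < k" "j < k" for i j
    using mat_entry[OF P] mat_entry[OF Q] that by (intro S.finsum_closed) (auto intro!: End_mult_closed)
  then show ?thesis
    by (auto simp: mat_ring_def)
qed

lemma mat_one_closed: "\<one>\<^bsub>mat_ring k S\<^esub> \<in> carrier (mat_ring k S)"
  using End_zero_closed End_one_closed by (auto simp: mat_ring_def)

lemma mat_action_mult:
  assumes P: "P \<in> carrier (mat_ring k S)" and Q: "Q \<in> carrier (mat_ring k S)"
    and v: "v \<in> {..<k} \<rightarrow>\<^sub>E carrier N"
  shows "mat_action k (P \<otimes>\<^bsub>mat_ring k S\<^esub> Q) v = mat_action k P (mat_action k Q v)"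
proof (rule power_eqI)
  show "mat_action k (P \<otimes>\<^bsub>mat_ring k S\<^esub> Q) v \<in> {..<k} \<rightarrow>\<^sub>E carrier N"
    by (rule mat_action_closed[OF mat_mult_closed[OF P Q] v])
  show "mat_action k P (mat_action k Q v) \<in> {..<k} \<rightarrow>\<^sub>E carrier N"
    by (rule mat_action_closed[OF P mat_action_closed[OF Q v]])
  fix i assume i: "i < k"
  have vj: "v j \<in> carrier N" if "j < k" for j
    using v that by auto
  have cl: "P (i, l) (Q (l, j) (v j)) \<in> carrier N" if "l < k" "j < k" for l j
    using mat_entry_closed[OF P i that(1)] mat_entry_closed[OF Q that vj[OF that(2)]] .
  have entry: "(P \<otimes>\<^bsub>mat_ring k S\<^esub> Q) (i, j) (v j) = (\<Oplus>l\<in>{..<k}. P (i, l) (Q (l, j) (v j)))" if j: "j < k" for j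
  proof -
    have f: "(\<lambda>l. P (i, l) \<otimes>\<^bsub>S\<^esub> Q (l, j)) \<in> {..<k} \<rightarrow> carrier S"
      using mat_entry[OF P i] mat_entry[OF Q _ j] by (auto intro!: End_mult_closed)
    have "(P \<otimes>\<^bsub>mat_ring k S\<^esub> Q) (i, j) (v j) = (\<Oplus>l\<in>{..<k}. (P (i, l) \<otimes>\<^bsub>S\<^esub> Q (l, j)) (v j))"
      using End_finsum[OF _ f vj[OF j]] i j by (simp add: mat_ring_def)
    also have "\<dots> = (\<Oplus>l\<in>{..<k}. P (i, l) (Q (l, j) (v j)))"
      using vj[OF j] by (simp add: End_ring_simps compose_def)
    finally show ?thesis .
  qed
  have "mat_action k (P \<otimes>\<^bsub>mat_ring k S\<^esub> Q) v i = (\<Oplus>j\<in>{..<k}. \<Oplus>l\<in>{..<k}. P (i, l) (Q (l, j) (v j)))"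
    unfolding mat_action_def using i entry cl
    by (simp, intro N.finsum_cong') (auto intro!: N.finsum_closed)
  also have "\<dots> = (\<Oplus>l\<in>{..<k}. \<Oplus>j\<in>{..<k}. P (i, l) (Q (l, j) (v j)))"
    using cl by (intro N.finsum_swap) auto
  also have "\<dots> = (\<Oplus>l\<in>{..<k}. P (i, l) (\<Oplus>j\<in>{..<k}. Q (l, j) (v j)))"
  proof (rule N.finsum_cong')
    have inner: "(\<lambda>j. Q (l, j) (v j)) \<in> {..<k} \<rightarrow> carrier N" if "l < k" for l
      using mat_entry_closed[OF Q that] vj by auto
    show "(\<lambda>l. P (i, l) (\<Oplus>j\<in>{..<k}. Q (l, j) (v j))) \<in> {..<k} \<rightarrow> carrier N"
      using mat_entry_closed[OF P i] N.finsum_closed[OF inner] by auto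
    fix l assume "l \<in> {..<k}"
    then show "(\<Oplus>j\<in>{..<k}. P (i, l) (Q (l, j) (v j))) = P (i, l) (\<Oplus>j\<in>{..<k}. Q (l, j) (v j))"
      using module_End_finsum[OF _ _ inner, of "P (i, l)" l] mat_entry[OF P i, of l]
      by (simp add: End_ring_simps)
  qed simp
  also have "\<dots> = mat_action k P (mat_action k Q v) i"
  proof -
    have "P (i, l) (mat_action k Q v l) \<in> carrier N" if "l < k" for l
      using mat_entry_closed[OF P i that] mat_action_closed[OF Q v] that by auto
    then show ?thesis
      unfolding mat_action_def[of k P] using i
      by (simp, intro N.finsum_cong') (auto simp: mat_action_def)
  qed
  finally show "mat_action k (P \<otimes>\<^bsub>mat_ring k S\<^esub> Q) v i = mat_action k P (mat_action k Q v) i" .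
qed

lemma mat_action_one:
  assumes v: "v \<in> {..<k} \<rightarrow>\<^sub>E carrier N"
  shows "mat_action k \<one>\<^bsub>mat_ring k S\<^esub> v = v"
proof (rule power_eqI[OF mat_action_closed[OF mat_one_closed v] v])
  fix i assume i: "i < k"
  have vj: "v j \<in> carrier N" if "j < k" for j
    using v that by auto
  have "mat_action k \<one>\<^bsub>mat_ring k S\<^esub> v i = (\<Oplus>j\<in>{..<k}. if i = j then v j else \<zero>)"
    unfolding mat_action_def using i vj
    by (simp, intro N.finsum_cong') (auto simp: mat_ring_def End_ring_simps)
  also have "\<dots> = v i"
    using i vj by (intro N.add.finprod_singleton) auto
  finally show "mat_action k \<one>\<^bsub>mat_ring k S\<^esub> v i = v i" .
qed

text \<open>A matrix is determined by its action: the vectors with one nonzero entry reveal its columns.\<close>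

lemma mat_action_eqI:
  assumes P: "P \<in> carrier (mat_ring k S)" and Q: "Q \<in> carrier (mat_ring k S)"
    and eq: "\<And>v. v \<in> {..<k} \<rightarrow>\<^sub>E carrier N \<Longrightarrow> mat_action k P v = mat_action k Q v"
  shows "P = Q"
proof -
  have column: "mat_action k U (\<lambda>l\<in>{..<k}. if l = j then x else \<zero>) i = U (i, j) x"
    if U: "U \<in> carrier (mat_ring k S)" and ij: "i < k" "j < k" and x: "x \<in> carrier N" for U i j x
  proof -
    have "U (i, l) \<zero> = \<zero>" if "l < k" for l
      using module_End_finsum[of "U (i, l)" "{}" "\<lambda>_. \<zero>"] mat_entry[OF U ij(1) that]
      by (simp add: End_ring_simps)
    then have "mat_action k U (\<lambda>l\<in>{..<k}. if l = j then x else \<zero>) i =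
        (\<Oplus>l\<in>{..<k}. if j = l then U (i, l) x else \<zero>)"
      unfolding mat_action_def using ij(1) mat_entry_closed[OF U ij(1) _ x]
      by (simp, intro N.finsum_cong') auto
    also have "\<dots> = U (i, j) x"
      using ij mat_entry_closed[OF U ij(1) _ x] by (intro N.add.finprod_singleton) auto
    finally show ?thesis .
  qed
  have "P (i, j) = Q (i, j)" if ij: "i < k" "j < k" for i j
  proof (rule End_eqI[OF mat_entry[OF P ij] mat_entry[OF Q ij]])
    fix x assume x: "x \<in> carrier N"
    then have "(\<lambda>l\<in>{..<k}. if l = j then x else \<zero>) \<in> {..<k} \<rightarrow>\<^sub>E carrier N"
      by auto
    from eq[OF this] show "P (i, j) x = Q (i, j) x"
      using column[OF P ij x] column[OF Q ij x] by simp
  qed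
  then show ?thesis
    using P Q unfolding mat_ring_def
    by (intro extensionalityI[of P "{..<k} \<times> {..<k}" Q]) (auto simp: PiE_iff)
qed

text \<open>
  A matrix with a right inverse acts surjectively; once it acts injectively, the right inverse is also a left
  inverse, first for the action and then for the matrices themselves.
\<close>

lemma directly_finite_mat_ring:
  assumes inj: "\<And>P. P \<in> carrier (mat_ring k S) \<Longrightarrow>
      mat_action k P ` ({..<k} \<rightarrow>\<^sub>E carrier N) = {..<k} \<rightarrow>\<^sub>E carrier N \<Longrightarrow>
      inj_on (mat_action k P) ({..<k} \<rightarrow>\<^sub>E carrier N)"
  shows "directly_finite (mat_ring k S)"
  unfolding directly_finite_def
proof (intro ballI impI)
  fix P Q assume P: "P \<in> carrier (mat_ring k S)" and Q: "Q \<in> carrier (mat_ring k S)"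
    and PQ: "P \<otimes>\<^bsub>mat_ring k S\<^esub> Q = \<one>\<^bsub>mat_ring k S\<^esub>"
  have right_inv: "mat_action k P (mat_action k Q v) = v" if "v \<in> {..<k} \<rightarrow>\<^sub>E carrier N" for v
    using mat_action_mult[OF P Q that] mat_action_one[OF that] PQ by simp
  have "mat_action k P ` ({..<k} \<rightarrow>\<^sub>E carrier N) = {..<k} \<rightarrow>\<^sub>E carrier N"
  proof
    show "mat_action k P ` ({..<k} \<rightarrow>\<^sub>E carrier N) \<subseteq> {..<k} \<rightarrow>\<^sub>E carrier N"
      using mat_action_closed[OF P] by blast
    show "{..<k} \<rightarrow>\<^sub>E carrier N \<subseteq> mat_action k P ` ({..<k} \<rightarrow>\<^sub>E carrier N)"
    proof
      fix v assume v: "v \<in> {..<k} \<rightarrow>\<^sub>E carrier N"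
      show "v \<in> mat_action k P ` ({..<k} \<rightarrow>\<^sub>E carrier N)"
        using imageI[OF mat_action_closed[OF Q v], of "mat_action k P"] unfolding right_inv[OF v] .
    qed
  qed
  then have inj': "inj_on (mat_action k P) ({..<k} \<rightarrow>\<^sub>E carrier N)"
    by (rule inj[OF P])
  show "Q \<otimes>\<^bsub>mat_ring k S\<^esub> P = \<one>\<^bsub>mat_ring k S\<^esub>"
  proof (rule mat_action_eqI[OF mat_mult_closed[OF Q P] mat_one_closed])
    fix v assume v: "v \<in> {..<k} \<rightarrow>\<^sub>E carrier N"
    note Pv = mat_action_closed[OF P v]
    have "mat_action k Q (mat_action k P v) = v"
      by (rule inj_onD[OF inj' right_inv[OF Pv] mat_action_closed[OF Q Pv] v])
    then show "mat_action k (Q \<otimes>\<^bsub>mat_ring k S\<^esub> P) v = mat_action k \<one>\<^bsub>mat_ring k S\<^esub> v"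
      by (simp add: mat_action_mult[OF Q P v] mat_action_one[OF v])
  qed
qed

lemma mat_action_smult:
  assumes P: "P \<in> carrier (mat_ring k S)" and r: "r \<in> carrier D" and v: "v \<in> {..<k} \<rightarrow>\<^sub>E carrier N"
  shows "mat_action k P (\<lambda>i\<in>{..<k}. r \<odot> v i) = (\<lambda>i\<in>{..<k}. r \<odot> mat_action k P v i)"
proof
  fix i
  show "mat_action k P (\<lambda>i\<in>{..<k}. r \<odot> v i) i = (\<lambda>i\<in>{..<k}. r \<odot> mat_action k P v i) i"
  proof (cases "i < k")
    case True
    have vl: "v l \<in> carrier N" if "l < k" for l
      using v that by auto
    have f: "(\<lambda>l. P (i, l) (v l)) \<in> {..<k} \<rightarrow> carrier N"
      using mat_entry_closed[OF P True] vl by auto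
    have "mat_action k P (\<lambda>i\<in>{..<k}. r \<odot> v i) i = (\<Oplus>l\<in>{..<k}. r \<odot> P (i, l) (v l))"
    proof -
      have "P (i, l) (r \<odot> v l) = r \<odot> P (i, l) (v l)" if "l < k" for l
        using module_EndD(3)[of "P (i, l)"] mat_entry[OF P True that] r vl[OF that] by (simp add: End_ring_simps)
      then show ?thesis
        unfolding mat_action_def using True f op_closed[OF r] by (simp, intro N.finsum_cong') auto
    qed
    also have "\<dots> = r \<odot> (\<Oplus>l\<in>{..<k}. P (i, l) (v l))"
      by (rule N.additive_finsum[symmetric, of "\<lambda>x. r \<odot> x"]) (use op_closed[OF r] op_add[OF r] f in auto)
    finally show ?thesis
      using True by (simp add: mat_action_def)
  qed (simp add: mat_action_def)
qed

lemma mat_action_add: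
  assumes P: "P \<in> carrier (mat_ring k S)"
    and v: "v \<in> {..<k} \<rightarrow>\<^sub>E carrier N" and w: "w \<in> {..<k} \<rightarrow>\<^sub>E carrier N"
  shows "mat_action k P (\<lambda>i\<in>{..<k}. v i \<oplus> w i) = (\<lambda>i\<in>{..<k}. mat_action k P v i \<oplus> mat_action k P w i)"
proof
  fix i
  show "mat_action k P (\<lambda>i\<in>{..<k}. v i \<oplus> w i) i = (\<lambda>i\<in>{..<k}. mat_action k P v i \<oplus> mat_action k P w i) i"
  proof (cases "i < k")
    case True
    have vl: "v l \<in> carrier N" "w l \<in> carrier N" if "l < k" for l
      using v w that by auto
    have f: "(\<lambda>l. P (i, l) (v l)) \<in> {..<k} \<rightarrow> carrier N" "(\<lambda>l. P (i, l) (w l)) \<in> {..<k} \<rightarrow> carrier N"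
      using mat_entry_closed[OF P True] vl by auto
    have "P (i, l) (v l \<oplus> w l) = P (i, l) (v l) \<oplus> P (i, l) (w l)" if "l < k" for l
      using module_EndD(2)[of "P (i, l)"] mat_entry[OF P True that] vl[OF that] by (simp add: End_ring_simps)
    note add = this
    have "mat_action k P (\<lambda>i\<in>{..<k}. v i \<oplus> w i) i =
        (\<Oplus>l\<in>{..<k}. P (i, l) ((\<lambda>i\<in>{..<k}. v i \<oplus> w i) l))"
      using True unfolding mat_action_def by (rule restrict_apply'[OF lessThan_iff[THEN iffD2]])
    also have "\<dots> = (\<Oplus>l\<in>{..<k}. P (i, l) (v l) \<oplus> P (i, l) (w l))"
    proof (rule N.finsum_cong')
      show "(\<lambda>l. P (i, l) (v l) \<oplus> P (i, l) (w l)) \<in> {..<k} \<rightarrow> carrier N"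
        using f by (intro Pi_I N.a_closed) auto
    qed (use add in auto)
    also have "\<dots> = (\<Oplus>l\<in>{..<k}. P (i, l) (v l)) \<oplus> (\<Oplus>l\<in>{..<k}. P (i, l) (w l))"
      by (rule N.finsum_addf[OF f])
    finally show ?thesis
      using True by (simp add: mat_action_def)
  qed (simp add: mat_action_def)
qed

end

end

section \<open>Submodules of the induced module\<close>

context crossed_extension
begin

text \<open>
  Left multiplication by \<open>a\<close> is a finite sum of left multiplications by monomials.
\<close>

lemma right_linear_mult:
  assumes a: "a \<in> carrier A"
  shows "E.right_linear (\<lambda>b. a \<otimes>\<^bsub>A\<^esub> b)"
proof -
  have sa: "supp R a \<subseteq> carrier G" "finite (supp R a)"
    using a by (simp_all add: crossed_product_carrier)
  have rl: "E.right_linear (\<lambda>b. monomial R (a g) g \<otimes>\<^bsub>A\<^esub> b)" if "g \<in> supp R a" for g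
    using right_linear_monomial sa(1) a that by auto
  have cl: "(\<lambda>g. (monomial R (a g) g \<otimes>\<^bsub>A\<^esub> b) x) \<in> supp R a \<rightarrow> carrier R" if "b \<in> carrier A" for b x
    using E.right_linearD(1)[OF rl that] by (intro Pi_I crossed_product_coeff)
  show ?thesis
    unfolding E.right_linear_def
  proof (intro conjI ballI)
    show "a \<otimes>\<^bsub>A\<^esub> b \<in> carrier A" if "b \<in> carrier A" for b
      by (rule mult_closed[OF a that])
    show "a \<otimes>\<^bsub>A\<^esub> (b \<oplus>\<^bsub>A\<^esub> b') = a \<otimes>\<^bsub>A\<^esub> b \<oplus>\<^bsub>A\<^esub> a \<otimes>\<^bsub>A\<^esub> b'"
      if b: "b \<in> carrier A" "b' \<in> carrier A" for b b'
    proof (rule crossed_product_eqI)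
      fix x assume x: "x \<in> carrier G"
      have "(a \<otimes>\<^bsub>A\<^esub> (b \<oplus>\<^bsub>A\<^esub> b')) x = finsum R (\<lambda>g. (monomial R (a g) g \<otimes>\<^bsub>A\<^esub> (b \<oplus>\<^bsub>A\<^esub> b')) x) (supp R a)"
        by (rule mult_eq_finsum_monomials[OF a crossed_product_add_closed[OF b] x])
      also have "\<dots> = finsum R (\<lambda>g. (monomial R (a g) g \<otimes>\<^bsub>A\<^esub> b) x \<oplus> (monomial R (a g) g \<otimes>\<^bsub>A\<^esub> b') x) (supp R a)"
      proof (rule R.finsum_cong')
        show "(\<lambda>g. (monomial R (a g) g \<otimes>\<^bsub>A\<^esub> b) x \<oplus> (monomial R (a g) g \<otimes>\<^bsub>A\<^esub> b') x) \<in> supp R a \<rightarrow> carrier R"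
          using cl[OF b(1)] cl[OF b(2)] by (intro Pi_I R.a_closed) auto
        show "(monomial R (a g) g \<otimes>\<^bsub>A\<^esub> (b \<oplus>\<^bsub>A\<^esub> b')) x =
            (monomial R (a g) g \<otimes>\<^bsub>A\<^esub> b) x \<oplus> (monomial R (a g) g \<otimes>\<^bsub>A\<^esub> b') x" if "g \<in> supp R a" for g
          by (simp add: E.right_linearD(2)[OF rl[OF that] b])
      qed simp
      also have "\<dots> = (a \<otimes>\<^bsub>A\<^esub> b \<oplus>\<^bsub>A\<^esub> a \<otimes>\<^bsub>A\<^esub> b') x"
        using R.finsum_addf[OF cl[OF b(1)] cl[OF b(2)]]
        by (simp add: mult_eq_finsum_monomials[OF a b(1) x] mult_eq_finsum_monomials[OF a b(2) x])
      finally show "(a \<otimes>\<^bsub>A\<^esub> (b \<oplus>\<^bsub>A\<^esub> b')) x = (a \<otimes>\<^bsub>A\<^esub> b \<oplus>\<^bsub>A\<^esub> a \<otimes>\<^bsub>A\<^esub> b') x" .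
    qed (use a b mult_closed crossed_product_add_closed in blast)+
    show "a \<otimes>\<^bsub>A\<^esub> (b \<otimes>\<^bsub>A\<^esub> coeff_embed R G s) = a \<otimes>\<^bsub>A\<^esub> b \<otimes>\<^bsub>A\<^esub> coeff_embed R G s"
      if b: "b \<in> carrier A" and s: "s \<in> carrier R" for b s
    proof (rule crossed_product_eqI)
      fix x assume x: "x \<in> carrier G"
      have sx: "\<sigma> x s \<in> carrier R"
        using x s by simp
      have "(a \<otimes>\<^bsub>A\<^esub> (b \<otimes>\<^bsub>A\<^esub> coeff_embed R G s)) x =
          finsum R (\<lambda>g. (monomial R (a g) g \<otimes>\<^bsub>A\<^esub> (b \<otimes>\<^bsub>A\<^esub> coeff_embed R G s)) x) (supp R a)"
        by (rule mult_eq_finsum_monomials[OF a mult_coeff_embed_closed[OF b s] x])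
      also have "\<dots> = finsum R (\<lambda>g. (monomial R (a g) g \<otimes>\<^bsub>A\<^esub> b) x \<otimes> \<sigma> x s) (supp R a)"
      proof (rule R.finsum_cong')
        show "(\<lambda>g. (monomial R (a g) g \<otimes>\<^bsub>A\<^esub> b) x \<otimes> \<sigma> x s) \<in> supp R a \<rightarrow> carrier R"
          using cl[OF b] sx by (intro Pi_I R.m_closed) auto
        show "(monomial R (a g) g \<otimes>\<^bsub>A\<^esub> (b \<otimes>\<^bsub>A\<^esub> coeff_embed R G s)) x =
            (monomial R (a g) g \<otimes>\<^bsub>A\<^esub> b) x \<otimes> \<sigma> x s" if "g \<in> supp R a" for g
          using E.right_linearD(3)[OF rl[OF that] b s] E.right_linearD(1)[OF rl[OF that] b]
          by (simp add: mult_coeff_embed s x)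
      qed simp
      also have "\<dots> = finsum R (\<lambda>g. (monomial R (a g) g \<otimes>\<^bsub>A\<^esub> b) x) (supp R a) \<otimes> \<sigma> x s"
        using R.finsum_ldistr[OF sa(2) sx cl[OF b]] by simp
      also have "\<dots> = (a \<otimes>\<^bsub>A\<^esub> b \<otimes>\<^bsub>A\<^esub> coeff_embed R G s) x"
        using mult_coeff_embed[OF mult_closed[OF a b] s x] mult_eq_finsum_monomials[OF a b x] by simp
      finally show "(a \<otimes>\<^bsub>A\<^esub> (b \<otimes>\<^bsub>A\<^esub> coeff_embed R G s)) x = (a \<otimes>\<^bsub>A\<^esub> b \<otimes>\<^bsub>A\<^esub> coeff_embed R G s) x" .
    qed (use a b s mult_closed mult_coeff_embed_closed in blast)+
  qed
qed

lemma tensor_hom_mult: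
  assumes "a \<in> carrier A"
  shows "E.tensor_hom (\<lambda>v. a \<odot>\<^bsub>T\<^esub> v)"
  unfolding T_eq E.tensor_smult by (rule E.tensor_map_hom[OF right_linear_mult[OF assms]])

context
  fixes M
  assumes M: "submodule M A T"
begin

abbreviation "N \<equiv> T\<lparr>carrier := M\<rparr>"

lemma M_closed:
  shows "M \<subseteq> carrier V" "\<zero>\<^bsub>V\<^esub> \<in> M" "v \<in> M \<Longrightarrow> w \<in> M \<Longrightarrow> v \<oplus>\<^bsub>T\<^esub> w \<in> M"
    "a \<in> carrier A \<Longrightarrow> v \<in> M \<Longrightarrow> a \<odot>\<^bsub>T\<^esub> v \<in> M" "v \<in> M \<Longrightarrow> \<ominus>\<^bsub>E.T\<^esub> v \<in> M"
proof -
  note S = submodule.axioms(1)[OF M]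
  show "M \<subseteq> carrier V" "\<zero>\<^bsub>V\<^esub> \<in> M" "v \<in> M \<Longrightarrow> w \<in> M \<Longrightarrow> v \<oplus>\<^bsub>T\<^esub> w \<in> M"
    using subgroup.subset[OF S] subgroup.one_closed[OF S] subgroup.m_closed[OF S, of v w] by simp_all
  show "a \<in> carrier A \<Longrightarrow> v \<in> M \<Longrightarrow> a \<odot>\<^bsub>T\<^esub> v \<in> M"
    by (rule submodule.smult_closed[OF M])
  show "v \<in> M \<Longrightarrow> \<ominus>\<^bsub>E.T\<^esub> v \<in> M"
    using subgroup.m_inv_closed[OF S, of v] by (simp add: a_inv_def T_eq)
qed

lemma M_submodule: "submodule M R V"
  by (rule left_module.submoduleI[OF left_module_V])
    (use M_closed(1,2) M_closed(3) M_closed(4)[OF coeff_embed_closed] in auto)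

lemma M_gamma: "g \<in> carrier G \<Longrightarrow> v \<in> M \<Longrightarrow> \<gamma> g v \<in> M"
  unfolding \<gamma>_def by (rule M_closed(4)[OF monomial_closed[OF R.one_closed]])

lemma operator_module_N: "operator_module A N"
proof (intro operator_module.intro operator_module_axioms.intro)
  have sub: "v \<in> carrier E.T" if "v \<in> M" for v
    using that M_closed(1) by (auto simp: T_eq)
  show "abelian_group N"
  proof (rule abelian_groupI)
    fix v assume "v \<in> carrier N"
    then show "\<exists>w\<in>carrier N. w \<oplus>\<^bsub>N\<^esub> v = \<zero>\<^bsub>N\<^esub>"
      using M_closed(5) sub by (intro bexI[of _ "\<ominus>\<^bsub>E.T\<^esub> v"]) (simp_all add: T_eq E.T.l_neg)
  next
    fix u v w assume "u \<in> carrier N" "v \<in> carrier N" "w \<in> carrier N"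
    then show "u \<oplus>\<^bsub>N\<^esub> v \<oplus>\<^bsub>N\<^esub> w = u \<oplus>\<^bsub>N\<^esub> (v \<oplus>\<^bsub>N\<^esub> w)"
      using sub E.T.a_assoc by (simp add: T_eq)
  next
    fix u v assume "u \<in> carrier N" "v \<in> carrier N"
    then show "u \<oplus>\<^bsub>N\<^esub> v = v \<oplus>\<^bsub>N\<^esub> u"
      using sub E.T.a_comm by (simp add: T_eq)
  next
    fix v assume "v \<in> carrier N"
    then show "\<zero>\<^bsub>N\<^esub> \<oplus>\<^bsub>N\<^esub> v = v"
      using sub by (simp add: T_eq)
  qed (use M_closed(2,3) in auto)
  show "a \<odot>\<^bsub>N\<^esub> v \<in> carrier N" if "a \<in> carrier A" "v \<in> carrier N" for a v
    using M_closed(4) that by simp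
  show "a \<odot>\<^bsub>N\<^esub> (v \<oplus>\<^bsub>N\<^esub> w) = a \<odot>\<^bsub>N\<^esub> v \<oplus>\<^bsub>N\<^esub> a \<odot>\<^bsub>N\<^esub> w"
    if "a \<in> carrier A" "v \<in> carrier N" "w \<in> carrier N" for a v w
    using E.tensor_homD(2)[OF tensor_hom_mult[OF that(1)]] sub that(2,3) by (simp add: T_eq)
qed

context
  fixes B
  assumes noeth: "left_noetherian R" and folner: "has_folner_sets G"
    and B: "finite B" "B \<subseteq> carrier K" "submodule_span R K B = carrier K"
begin

lemma hopfian_N: "hopfian A N"
  unfolding hopfian_def
proof (intro ballI impI)
  interpret O: operator_module A N
    by (rule operator_module_N)
  interpret tg: twisted_graded_module R V G \<sigma> \<gamma> coord "E.pure (coeff_embed R G \<one>) ` B"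
    by (rule twisted_graded_module_V[OF B])
  fix f assume f: "f \<in> module_End A N" and surj: "f ` carrier N = carrier N"
  note D = O.module_EndD[OF f]
  have "tg.equivariant_surjection M f"
    unfolding tg.equivariant_surjection_def
    using M_submodule M_gamma surj D(2) D(3)[OF coeff_embed_closed]
      D(3)[OF monomial_closed[OF R.one_closed]] by (simp add: \<gamma>_def)
  then have "inj_on f M"
    by (rule tg.equivariant_surjection_inj_on[OF noeth folner])
  then show "bij_betw f (carrier N) (carrier N)"
    using surj by (simp add: bij_betw_def)
qed

lemma stably_finite_N: "stably_finite (End_ring A N)"
  unfolding stably_finite_def
proof (intro allI impI)
  interpret O: operator_module A N
    by (rule operator_module_N)
  interpret tg: twisted_graded_module R V G \<sigma> \<gamma> coord "E.pure (coeff_embed R G \<one>) ` B"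
    by (rule twisted_graded_module_V[OF B])
  fix k :: nat
  interpret pw: twisted_graded_module R "power_module k V" G \<sigma> "\<lambda>g v. \<lambda>i\<in>{..<k}. \<gamma> g (v i)"
    "\<lambda>g v. \<lambda>i\<in>{..<k}. coord g (v i)" "\<Union>i<k. tg.single k i ` E.pure (coeff_embed R G \<one>) ` B"
    by (rule tg.twisted_graded_module_power)
  let ?W = "{..<k} \<rightarrow>\<^sub>E M"
  have W: "submodule ?W R (power_module k V)"
  proof (rule pw.submoduleI)
    show "?W \<subseteq> carrier (power_module k V)"
      using M_closed(1) by (auto simp: PiE_iff)
    show "\<zero>\<^bsub>power_module k V\<^esub> \<in> ?W"
      using M_closed(2) by (auto intro: restrict_power)
    show "v \<oplus>\<^bsub>power_module k V\<^esub> w \<in> ?W" if "v \<in> ?W" "w \<in> ?W" for v w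
      unfolding power_module_simps restrict_scalars_simps
      using that by (intro restrict_power M_closed(3)) auto
    show "r \<odot>\<^bsub>power_module k V\<^esub> v \<in> ?W" if "r \<in> carrier R" "v \<in> ?W" for r v
      unfolding power_module_simps restrict_scalars_simps
      using that by (intro restrict_power M_closed(4) coeff_embed_closed) auto
  qed
  show "directly_finite (mat_ring k (End_ring A N))"
  proof (rule O.directly_finite_mat_ring)
    fix P assume P: "P \<in> carrier (mat_ring k (End_ring A N))"
      and surj: "O.mat_action k P ` ({..<k} \<rightarrow>\<^sub>E carrier N) = {..<k} \<rightarrow>\<^sub>E carrier N"
    have "pw.equivariant_surjection ?W (O.mat_action k P)"
      unfolding pw.equivariant_surjection_def
    proof (intro conjI ballI W)
      show "(\<lambda>i\<in>{..<k}. \<gamma> g (v i)) \<in> ?W" if "g \<in> carrier G" "v \<in> ?W" for g v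
        using that by (intro restrict_power M_gamma) auto
      show "O.mat_action k P ` ?W = ?W"
        using surj by simp
      show "O.mat_action k P (v \<oplus>\<^bsub>power_module k V\<^esub> w) =
          O.mat_action k P v \<oplus>\<^bsub>power_module k V\<^esub> O.mat_action k P w" if "v \<in> ?W" "w \<in> ?W" for v w
        using O.mat_action_add[OF P, of v w] that by simp
      show "O.mat_action k P (r \<odot>\<^bsub>power_module k V\<^esub> v) = r \<odot>\<^bsub>power_module k V\<^esub> O.mat_action k P v"
        if "r \<in> carrier R" "v \<in> ?W" for r v
        using O.mat_action_smult[OF P coeff_embed_closed[OF that(1)], of v] that(2) by simp
      show "O.mat_action k P (\<lambda>i\<in>{..<k}. \<gamma> g (v i)) = (\<lambda>i\<in>{..<k}. \<gamma> g (O.mat_action k P v i))"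
        if "g \<in> carrier G" "v \<in> ?W" for g v
        using O.mat_action_smult[OF P monomial_closed[OF R.one_closed that(1)], of v] that(2)
        by (simp add: \<gamma>_def)
    qed
    then have "inj_on (O.mat_action k P) ?W"
      by (rule pw.equivariant_surjection_inj_on[OF noeth folner])
    then show "inj_on (O.mat_action k P) ({..<k} \<rightarrow>\<^sub>E carrier N)"
      by simp
  qed
qed

end

end

end

theorem theoremA:
  fixes R :: "('r, 'a) ring_scheme"
    and G :: "('g, 'b) monoid_scheme"
    and \<sigma> :: "'g \<Rightarrow> 'r \<Rightarrow> 'r"
    and \<rho> :: "'g \<Rightarrow> 'g \<Rightarrow> 'r"
    and K :: "('r, 'k, 'c) module_scheme"
  assumes "left_noetherian R"
    and "fin_gen_group G"
    and "amenable TYPE('i) G"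
    and "crossed_system R G \<sigma> \<rho>"
    and "fin_gen_module R K"
    and "submodule M (crossed_product R G \<sigma> \<rho>) (induced_module R G \<sigma> \<rho> K)"
  shows "hopfian (crossed_product R G \<sigma> \<rho>) ((induced_module R G \<sigma> \<rho> K)\<lparr>carrier := M\<rparr>) \<and>
    stably_finite (End_ring (crossed_product R G \<sigma> \<rho>) ((induced_module R G \<sigma> \<rho> K)\<lparr>carrier := M\<rparr>))"
proof -
  obtain B where K: "left_module R K" and B: "finite B" "B \<subseteq> carrier K" "submodule_span R K B = carrier K"
    using assms(5) unfolding fin_gen_module_def by blast
  interpret crossed_system R G \<sigma> \<rho> by fact
  interpret crossed_extension R G \<sigma> \<rho> K
    by (intro crossed_extension.intro assms(4) K)
  have "has_folner_sets G"
    by (rule amenable_has_folner_sets[OF assms(3)])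
  then show ?thesis
    using hopfian_N[OF assms(6,1) _ B] stably_finite_N[OF assms(6,1) _ B] by blast
qed

end
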